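(* Consider the downlink virtual-cell mmWave network model described in the context, with Rayleigh small-scale fading: all fading powers $|\xi_k|^2$ (for serving APs and for LOS and NLOS interfering APs) are i.i.d., independent of everything else, with $|\xi_k|^2\sim\exp(\mu)$, meaning exponentially distributed with mean $\mu>0$. Put $H(x)=1-\frac{1}{1+x}$ and, for $s>0$, $$V_{\rm L}(s)=2\pi\lambda\sum_{n=1}^{2}b_n\int_{r_K}^{\infty}H(\mu s a_n C_{\rm L}x^{-\alpha_{\rm L}})\,p(x)\,x\,dx,$$ $$V_{\rm N}(s)=2\pi\lambda\sum_{n=1}^{2}b_n\int_{r_K}^{\infty}H(\mu s a_n C_{\rm N}x^{-\alpha_{\rm N}})\,(1-p(x))\,x\,dx.$$ Then for $\bm r=(r_1,\dots,r_K)$ with $0<r_1\le\cdots\le r_K$ the conditional ergodic capacity is $$C_{\rm cond}(\bm r)=\frac{1}{\ln 2}\int_0^\infty\frac{e^{-s\sigma^2}}{s}\,e^{-(V_{\rm L}(s)+V_{\rm N}(s))}\left(1-\prod_{k=1}^{K}\bigl(1-H(\mu sMC_{\rm L}r_k^{-\alpha_{\rm L}})\bigr)\right)ds,$$ and the downlink ergodic capacity is $$C=\frac{(2\pi\lambda)^K}{\ln 2}\int\cdots\int_{\mathcal D} r_1\cdots r_K\,e^{-\pi\lambda r_K^2}\int_0^\infty\frac{e^{-s\sigma^2}}{s}\,e^{-(V_{\rm L}(s)+V_{\rm N}(s))}\left(1-\prod_{k=1}^{K}\bigl(1-H(\mu sMC_{\rm L}r_k^{-\alpha_{\rm L}})\bigr)\right)ds\,d\bm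 r,$$ where $\mathcal D=\{0<r_1\le\cdots\le r_K\}$ and $d\bm r=dr_1\cdots dr_K$.
   Context: Parameters: density $\lambda>0$; integer $K\ge 1$; blockage parameter $\beta>0$ and LOS probability function $p(r)=e^{-\beta r}$; path loss exponents $\alpha_{\rm L},\alpha_{\rm N}>0$ and intercepts $C_{\rm L},C_{\rm N}>0$; main lobe gain $M>0$, sidelobe gain $m>0$, beamwidth $\theta_b\in(0,2\pi]$; noise power $\sigma^2>0$ (normalized by transmit power). Set $a_1=M$, $b_1=\theta_b/(2\pi)$, $a_2=m$, $b_2=1-\theta_b/(2\pi)$. Model. Access points (APs) form a homogeneous Poisson point process (PPP) of density $\lambda$ on $\mathbb R^2$; the typical user is at the origin. Order the APs by increasing distance $r_1\le r_2\le\cdots$ to the origin. The $K$ closest APs serve the user; all others interfere. The joint density of $(r_1,\dots,r_K)$ on $\mathcal D=\{0<r_1\le\cdots\le r_K\}$ is $f(\bm r)=(2\pi\lambda)^K r_1\cdots r_K e^{-\pi\lambda r_K^2}$. All serving APs are assumed to be line-of-sight (LOS), each with antenna gain $M$. Conditionally on $(r_1,\dots,r_K)$, the interfering APs are the points, outside the disc $\mathcal B(r_K)$ of radius $r_K$ centered at the origin, of two independent non-homogeneous PPPs: the LOS process $\Phi_{\rm L}$ with intensity $\lambda p(|x|)$ and the non-line-of-sight (NLOS) process $\Phi_{\rm N}$ with intensity $\lambda(1-p(|x|))$. The antenna gains $G_l$ of interfering APs are i.i.d. (and independent of everything else) with $\mathbb P(G_l=a_n)=b_n$, $n=1,2$.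 $|\xi_l|^2$ denotes the small-scale fading power of the link to AP $l$. The SINR is $$\gamma=\frac{\sum_{k=1}^K MC_{\rm L}r_k^{-\alpha_{\rm L}}|\xi_k|^2}{I_{\rm L}+I_{\rm N}+\sigma^2},\quad I_{\rm L}=\sum_{l\in\Phi_{\rm L},\,r_l>r_K}G_lC_{\rm L}r_l^{-\alpha_{\rm L}}|\xi_l|^2,\quad I_{\rm N}=\sum_{l\in\Phi_{\rm N},\,r_l>r_K}G_lC_{\rm N}r_l^{-\alpha_{\rm N}}|\xi_l|^2.$$ The conditional ergodic capacity $C_{\rm cond}(\bm r)$ is the conditional expectation of $\log_2(1+\gamma)$ given that the serving APs are at distances $\bm r=(r_1,\dots,r_K)$ (averaging over interfering AP locations, gains and fading). The ergodic capacity is $C=\mathbb E[\log_2(1+\gamma)]=\int\cdots\int_{\mathcal D}C_{\rm cond}(\bm r)f(\bm r)\,d\bm r$. Conventions: if $I_{\rm L}+I_{\rm N}=\infty$ then $\gamma=0$, and $e^{-\infty}=0$. *)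

theory Defs
  imports "HOL-Probability.Probability"
begin

section \<open>Poisson point processes and conditional laws\<close>

text \<open>
  A point process is given by random points \<open>X l\<close> together with a random set \<open>J\<close> of the indices
  that are in use; points are counted with multiplicity.
\<close>

definition point_count :: "(nat \<Rightarrow> 'w \<Rightarrow> 'a) \<Rightarrow> ('w \<Rightarrow> nat set) \<Rightarrow> 'a set \<Rightarrow> 'w \<Rightarrow> nat" where
  "point_count X J A \<omega> = card {l \<in> J \<omega>. X l \<omega> \<in> A}"

definition finite_sets :: "'a measure \<Rightarrow> 'a set set" where
  "finite_sets \<Lambda> = {A \<in> sets \<Lambda>. emeasure \<Lambda> A < \<infinity>}"

text \<open>
  The Poisson probabilities are written out because \<open>poisson_pmf\<close> is only specified for
  positive rates, whereas \<open>\<Lambda> A\<close> may be zero. The a.s. finiteness clause is needed since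
  \<open>card\<close> is zero on infinite sets.
\<close>

definition poisson_process ::
  "'w measure \<Rightarrow> 'a measure \<Rightarrow> (nat \<Rightarrow> 'w \<Rightarrow> 'a) \<Rightarrow> ('w \<Rightarrow> nat set) \<Rightarrow> bool" where
  "poisson_process M \<Lambda> X J \<longleftrightarrow>
     (\<forall>l. X l \<in> measurable M \<Lambda>) \<and>
     (\<forall>l. {\<omega> \<in> space M. l \<in> J \<omega>} \<in> sets M) \<and>
     (\<forall>A \<in> finite_sets \<Lambda>.
        (AE \<omega> in M. finite {l \<in> J \<omega>. X l \<omega> \<in> A}) \<and>
        (\<forall>n. measure M {\<omega> \<in> space M. point_count X J A \<omega> = n} =
               measure \<Lambda> A ^ n / fact n * exp (- measure \<Lambda> A))) \<and>
     (\<forall>A :: nat \<Rightarrow> 'a set. range A \<subseteq> finite_sets \<Lambda> \<and> disjoint_family A \<longrightarrow>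
        prob_space.indep_vars M (\<lambda>_. count_space UNIV) (\<lambda>i. point_count X J (A i)) UNIV)"

text \<open>
  This is the unfolding of the library's \<open>indep_var\<close>, without its restriction that both random
  elements have the same value type.
\<close>

definition indep_elements ::
  "'w measure \<Rightarrow> 'a measure \<Rightarrow> ('w \<Rightarrow> 'a) \<Rightarrow> 'b measure \<Rightarrow> ('w \<Rightarrow> 'b) \<Rightarrow> bool" where
  "indep_elements M S X T Y \<longleftrightarrow>
     X \<in> measurable M S \<and> Y \<in> measurable M T \<and>
     prob_space.indep_set M {X -` A \<inter> space M |A. A \<in> sets S} {Y -` B \<inter> space M |B. B \<in> sets T}"

text \<open>Independence of the \<open>\<sigma>\<close>-algebras generated by all the counts of the two processes.\<close>

definition indep_processes ::
  "'w measure \<Rightarrow> 'a measure \<Rightarrow> 'a measure \<Rightarrow> (nat \<Rightarrow> 'w \<Rightarrow> 'a) \<Rightarrow>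
     ('w \<Rightarrow> nat set) \<Rightarrow> ('w \<Rightarrow> nat set) \<Rightarrow> bool" where
  "indep_processes M \<Lambda>\<^sub>1 \<Lambda>\<^sub>2 X J\<^sub>1 J\<^sub>2 \<longleftrightarrow>
     prob_space.indep_var M
       (PiM (finite_sets \<Lambda>\<^sub>1) (\<lambda>_. count_space UNIV))
       (\<lambda>\<omega>. \<lambda>A\<in>finite_sets \<Lambda>\<^sub>1. point_count X J\<^sub>1 A \<omega>)
       (PiM (finite_sets \<Lambda>\<^sub>2) (\<lambda>_. count_space UNIV))
       (\<lambda>\<omega>. \<lambda>A\<in>finite_sets \<Lambda>\<^sub>2. point_count X J\<^sub>2 A \<omega>)"

definition regular_cond_prob ::
  "'w measure \<Rightarrow> 'a measure \<Rightarrow> ('w \<Rightarrow> 'a) \<Rightarrow> ('a \<Rightarrow> 'w measure) \<Rightarrow> bool" where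
  "regular_cond_prob M S R \<kappa> \<longleftrightarrow>
     R \<in> measurable M S \<and>
     \<kappa> \<in> measurable S (prob_algebra M) \<and>
     (\<forall>A\<in>sets M. \<forall>B\<in>sets S.
        emeasure M (A \<inter> (R -` B \<inter> space M)) = (\<integral>\<^sup>+r\<in>B. emeasure (\<kappa> r) A \<partial>distr M S R))"


section \<open>Parameters of the virtual-cell network\<close>

record vcell_params =
  ap_density :: real
  cell_size :: nat
  blockage :: real
  los_exp :: real
  nlos_exp :: real
  los_icpt :: real
  nlos_icpt :: real
  main_gain :: real
  side_gain :: real
  beamwidth :: real
  noise_power :: real
  fading_mean :: real

definition valid_params :: "vcell_params \<Rightarrow> bool" where
  "valid_params P \<longleftrightarrow>
     ap_density P > 0 \<and> cell_size P \<ge> 1 \<and> blockage P > 0 \<and>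
     los_exp P > 0 \<and> nlos_exp P > 0 \<and> los_icpt P > 0 \<and> nlos_icpt P > 0 \<and>
     main_gain P > 0 \<and> side_gain P > 0 \<and> 0 < beamwidth P \<and> beamwidth P \<le> 2 * pi \<and>
     noise_power P > 0 \<and> fading_mean P > 0"

definition los_prob :: "vcell_params \<Rightarrow> real \<Rightarrow> real" where
  "los_prob P x = exp (- blockage P * x)"

definition gain_val :: "vcell_params \<Rightarrow> nat \<Rightarrow> real" where
  "gain_val P n = (if n = 1 then main_gain P else side_gain P)"

definition gain_prob :: "vcell_params \<Rightarrow> nat \<Rightarrow> real" where
  "gain_prob P n = (if n = 1 then beamwidth P / (2 * pi) else 1 - beamwidth P / (2 * pi))"

text \<open>The law \<open>b\<^sub>1 \<delta>(a\<^sub>1) + b\<^sub>2 \<delta>(a\<^sub>2)\<close>; this form also makes sense when \<open>a\<^sub>1 = a\<^sub>2\<close>.\<close>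

definition gain_law :: "vcell_params \<Rightarrow> real measure" where
  "gain_law P =
     distr (measure_pmf (bernoulli_pmf (gain_prob P 1))) borel
       (\<lambda>main. if main then gain_val P 1 else gain_val P 2)"

text \<open>
  Distance vectors are indexed from 0: the entry \<open>r k\<close> is the distance of the access point that
  is the \<open>(k + 1)\<close>-st closest to the origin, and \<open>r (cell_size P - 1)\<close> is the radius of the
  cell. Such vectors are extensional functions on \<open>{..<cell_size P}\<close>, as in \<^const>\<open>PiM\<close>.
\<close>

definition dist_dom :: "vcell_params \<Rightarrow> (nat \<Rightarrow> real) set" where
  "dist_dom P = {r \<in> {..<cell_size P} \<rightarrow>\<^sub>E {0<..}. mono_on {..<cell_size P} r}"


section \<open>The random network and its SINR\<close>

text \<open>
  Access points are enumerated by \<open>l = 0, 1, 2, \<dots>\<close> by increasing distance to the user at the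
  origin. The flag \<open>ap_los N l\<close> says whether access point \<open>l\<close> is line-of-sight; it and
  \<open>ap_gain N l\<close> are not used for the serving access points \<open>l < cell_size P\<close>, which count as
  line-of-sight with main lobe gain. \<open>ap_fade N l\<close> is the fading power of the link.
\<close>

record 'w network =
  ap_pos :: "nat \<Rightarrow> 'w \<Rightarrow> real ^ 2"
  ap_los :: "nat \<Rightarrow> 'w \<Rightarrow> bool"
  ap_gain :: "nat \<Rightarrow> 'w \<Rightarrow> real"
  ap_fade :: "nat \<Rightarrow> 'w \<Rightarrow> real"

definition ap_dist :: "'w network \<Rightarrow> nat \<Rightarrow> 'w \<Rightarrow> real" where
  "ap_dist N l \<omega> = norm (ap_pos N l \<omega>)"

definition serving_dists :: "vcell_params \<Rightarrow> 'w network \<Rightarrow> 'w \<Rightarrow> nat \<Rightarrow> real" where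
  "serving_dists P N \<omega> = (\<lambda>k\<in>{..<cell_size P}. ap_dist N k \<omega>)"

definition los_interferers :: "vcell_params \<Rightarrow> 'w network \<Rightarrow> 'w \<Rightarrow> nat set" where
  "los_interferers P N \<omega> = {l. ap_los N l \<omega> \<and> ap_dist N l \<omega> > ap_dist N (cell_size P - 1) \<omega>}"

definition nlos_interferers :: "vcell_params \<Rightarrow> 'w network \<Rightarrow> 'w \<Rightarrow> nat set" where
  "nlos_interferers P N \<omega> = {l. \<not> ap_los N l \<omega> \<and> ap_dist N l \<omega> > ap_dist N (cell_size P - 1) \<omega>}"

text \<open>The total interference may be infinite, e.g. for \<open>nlos_exp P \<le> 2\<close>.\<close>

definition interference :: "vcell_params \<Rightarrow> 'w network \<Rightarrow> 'w \<Rightarrow> ennreal" where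
  "interference P N \<omega> =
     (\<integral>\<^sup>+l. ennreal (ap_gain N l \<omega> * los_icpt P * ap_dist N l \<omega> powr (- los_exp P) * ap_fade N l \<omega>)
        \<partial>count_space (los_interferers P N \<omega>)) +
     (\<integral>\<^sup>+l. ennreal (ap_gain N l \<omega> * nlos_icpt P * ap_dist N l \<omega> powr (- nlos_exp P) * ap_fade N l \<omega>)
        \<partial>count_space (nlos_interferers P N \<omega>))"

definition sinr :: "vcell_params \<Rightarrow> 'w network \<Rightarrow> 'w \<Rightarrow> real" where
  "sinr P N \<omega> =
     (if interference P N \<omega> = \<infinity> then 0
      else (\<Sum>k<cell_size P. main_gain P * los_icpt P * ap_dist N k \<omega> powr (- los_exp P) * ap_fade N k \<omega>) /
           (enn2real (interference P N \<omega>) + noise_power P))"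


section \<open>The probabilistic model\<close>

text \<open>Intensity measures of the interferers outside the disc of radius \<open>\<rho>\<close>.\<close>

definition los_intensity :: "vcell_params \<Rightarrow> real \<Rightarrow> (real ^ 2) measure" where
  "los_intensity P \<rho> = density lborel
     (\<lambda>x. ennreal (ap_density P * los_prob P (norm x)) * indicator {x. norm x > \<rho>} x)"

definition nlos_intensity :: "vcell_params \<Rightarrow> real \<Rightarrow> (real ^ 2) measure" where
  "nlos_intensity P \<rho> = density lborel
     (\<lambda>x. ennreal (ap_density P * (1 - los_prob P (norm x))) * indicator {x. norm x > \<rho>} x)"

text \<open>
  The last three conjuncts say that all gains and all fading powers are mutually independent, and
  independent of the configuration of the access points.
\<close>

definition conditional_model ::
  "vcell_params \<Rightarrow> 'w network \<Rightarrow> (nat \<Rightarrow> real) \<Rightarrow> 'w measure \<Rightarrow> bool" where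
  "conditional_model P N r Q \<longleftrightarrow>
     prob_space Q \<and>
     (AE \<omega> in Q. serving_dists P N \<omega> = r) \<and>
     poisson_process Q (los_intensity P (r (cell_size P - 1))) (ap_pos N) (los_interferers P N) \<and>
     poisson_process Q (nlos_intensity P (r (cell_size P - 1))) (ap_pos N) (nlos_interferers P N) \<and>
     indep_processes Q (los_intensity P (r (cell_size P - 1))) (nlos_intensity P (r (cell_size P - 1)))
       (ap_pos N) (los_interferers P N) (nlos_interferers P N) \<and>
     (\<forall>l. distr Q borel (ap_gain N l) = gain_law P) \<and>
     (\<forall>l. distributed Q lborel (ap_fade N l) (exponential_density (1 / fading_mean P))) \<and>
     (\<forall>l. prob_space.indep_var Q borel (ap_gain N l) borel (ap_fade N l)) \<and>
     prob_space.indep_vars Q (\<lambda>_. borel \<Otimes>\<^sub>M borel) (\<lambda>l \<omega>. (ap_gain N l \<omega>, ap_fade N l \<omega>)) UNIV \<and>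
     indep_elements Q
       (PiM UNIV (\<lambda>_. borel \<Otimes>\<^sub>M count_space UNIV)) (\<lambda>\<omega> l. (ap_pos N l \<omega>, ap_los N l \<omega>))
       (PiM UNIV (\<lambda>_. borel \<Otimes>\<^sub>M borel)) (\<lambda>\<omega> l. (ap_gain N l \<omega>, ap_fade N l \<omega>))"

text \<open>
  \<open>M\<close> is the law of the whole network and \<open>\<kappa> r\<close> its conditional law given that the serving
  distances are \<open>r\<close>. The kernel is part of the data because conditioning on the null event
  \<open>serving_dists = r\<close> determines it only up to null sets, while the capacity formula is claimed
  for every \<open>r\<close>.
\<close>

definition virtual_cell_network ::
  "vcell_params \<Rightarrow> 'w measure \<Rightarrow> 'w network \<Rightarrow> ((nat \<Rightarrow> real) \<Rightarrow> 'w measure) \<Rightarrow> bool" where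
  "virtual_cell_network P M N \<kappa> \<longleftrightarrow>
     prob_space M \<and>
     poisson_process M (density lborel (\<lambda>_. ennreal (ap_density P))) (ap_pos N) (\<lambda>_. UNIV) \<and>
     (\<forall>\<omega>\<in>space M. mono (\<lambda>l. ap_dist N l \<omega>)) \<and>
     regular_cond_prob M (PiM {..<cell_size P} (\<lambda>_. borel)) (serving_dists P N) \<kappa> \<and>
     (\<forall>r\<in>dist_dom P. conditional_model P N r (\<kappa> r))"


section \<open>Capacities and the functions in their closed form\<close>

definition cond_capacity ::
  "vcell_params \<Rightarrow> 'w network \<Rightarrow> ((nat \<Rightarrow> real) \<Rightarrow> 'w measure) \<Rightarrow> (nat \<Rightarrow> real) \<Rightarrow> real" where
  "cond_capacity P N \<kappa> r = (\<integral>\<omega>. log 2 (1 + sinr P N \<omega>) \<partial>\<kappa> r)"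

definition ergodic_capacity :: "vcell_params \<Rightarrow> 'w measure \<Rightarrow> 'w network \<Rightarrow> real" where
  "ergodic_capacity P M N = (\<integral>\<omega>. log 2 (1 + sinr P N \<omega>) \<partial>M)"

definition Hfun :: "real \<Rightarrow> real" where
  "Hfun x = 1 - 1 / (1 + x)"

text \<open>\<open>V\<^sub>N\<close> may be infinite, so both exponents take values in \<^typ>\<open>ennreal\<close>.\<close>

definition V_los :: "vcell_params \<Rightarrow> real \<Rightarrow> real \<Rightarrow> ennreal" where
  "V_los P \<rho> s = ennreal (2 * pi * ap_density P) * (\<Sum>n\<in>{1, 2}. ennreal (gain_prob P n) *
     (\<integral>\<^sup>+x\<in>{\<rho>..}. ennreal (Hfun (fading_mean P * s * gain_val P n * los_icpt P * x powr (- los_exp P)) *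
         los_prob P x * x) \<partial>lborel))"

definition V_nlos :: "vcell_params \<Rightarrow> real \<Rightarrow> real \<Rightarrow> ennreal" where
  "V_nlos P \<rho> s = ennreal (2 * pi * ap_density P) * (\<Sum>n\<in>{1, 2}. ennreal (gain_prob P n) *
     (\<integral>\<^sup>+x\<in>{\<rho>..}. ennreal (Hfun (fading_mean P * s * gain_val P n * nlos_icpt P * x powr (- nlos_exp P)) *
         (1 - los_prob P x) * x) \<partial>lborel))"

definition exp_neg :: "ennreal \<Rightarrow> real" where
  "exp_neg v = (if v = \<infinity> then 0 else exp (- enn2real v))"

end

theory Submission
  imports Defs
begin

text \<open>
  For a signal \<open>S\<close>, noise \<open>\<sigma>\<^sup>2\<close> and interference \<open>I\<close>, the Frullani-type identity
  \<open>ln (1 + S / (I + \<sigma>\<^sup>2)) = \<integral> e\<^bsup>-s(I + \<sigma>\<^sup>2)\<^esup> (1 - e\<^bsup>-sS\<^esup>) / s ds\<close> (over \<open>s > 0\<close>) and Tonelli reduce the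
  conditional capacity to the Laplace transform of \<open>I\<close>, since \<open>S\<close> is independent of \<open>I\<close> and its
  transform is a product. Averaging over gains and fading first turns \<open>E e\<^bsup>-sI\<^esup>\<close> into the Laplace
  functional of the two independent Poisson processes of interferers, which is explicit for simple
  functions and passes to monotone limits; polar coordinates give \<open>V\<^sub>L + V\<^sub>N\<close>.

  For the ergodic capacity the conditional one is integrated against the law of the serving distances.
  On boxes \<open>\<Pi> (a\<^sub>k, b\<^sub>k]\<close> with \<open>b\<^sub>k \<le> a\<^sub>k\<^sub>+\<^sub>1\<close> this law is read off the independent counts of consecutive
  annuli; such boxes are closed under intersection, and they cover the strictly increasing vectors,
  which carry the whole mass because ties almost surely do not occur.
\<close>

text \<open>Infinite values shape the development: the interference and the NLOS exponent may be
  \<top>, so all transforms are written with \<open>exp_neg\<close> on \<open>ennreal\<close>. It is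
  continuous up to \<top> and bounded by 1, so limits go through by dominated convergence with bound
  1. A Poisson process is accessible only through its counts, while gains and fading are attached to
  indices. The marks are therefore averaged for a frozen configuration, index by index, and each
  factor is rewritten as \<open>exp_neg\<close> of minus its logarithm. What remains is again a sum
  over points, now of a deterministic function, and 1 minus its exponential is exactly the mixture
  of \<open>Hfun\<close> over the two gains. The serving fading powers are treated as further marks
  of the same indices. A parameter \<theta> in the joint transform switches the signal on or off,
  and the capacity integrand is the difference of the cases 0 and 1. Ordered boxes are the events
  that annulus counts can describe: the gap before each side is empty, each side holds one point,
  and only the last side may hold more.\<close>

section \<open>Exponentials of extended nonnegative exponents\<close>

lemma exp_neg_ennreal [simp]: "0 \<le> x \<Longrightarrow> exp_neg (ennreal x) = exp (- x)"
  by (simp add: exp_neg_def)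

lemma exp_neg_top [simp]: "exp_neg \<top> = 0"
  by (simp add: exp_neg_def)

lemma exp_neg_0 [simp]: "exp_neg 0 = 1"
  by (simp add: exp_neg_def)

lemma exp_neg_nonneg [simp]: "0 \<le> exp_neg v"
  by (simp add: exp_neg_def)

lemma exp_neg_le_1 [simp]: "exp_neg v \<le> 1"
  by (simp add: exp_neg_def)

lemma exp_neg_add: "exp_neg (u + v) = exp_neg u * exp_neg v"
  by (cases u; cases v) (auto simp: exp_diff exp_minus field_simps simp flip: ennreal_plus)

lemma exp_neg_sum: "exp_neg (\<Sum>i\<in>A. f i) = (\<Prod>i\<in>A. exp_neg (f i))"
  by (induction A rule: infinite_finite_induct) (auto simp: exp_neg_add)

lemma exp_neg_of_nat_mult: "exp_neg (of_nat n * c) = exp_neg c ^ n"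
  by (induction n) (auto simp: exp_neg_add algebra_simps)

lemma exp_neg_antimono: "u \<le> v \<Longrightarrow> exp_neg v \<le> exp_neg u"
  by (cases u; cases v) (auto simp: top_unique)

text \<open>Continuity at \<top> is the point: later limits may run into infinite interference or an
  infinite exponent without a separate case.\<close>

lemma tendsto_exp_neg:
  assumes "(f \<longlongrightarrow> v) F"
  shows "((\<lambda>x. exp_neg (f x)) \<longlongrightarrow> exp_neg v) F"
proof (cases "v = \<top>")
  case True
  have "eventually (\<lambda>x. exp_neg (f x) < e) F" if "e > 0" for e
  proof -
    \<comment> \<open>A threshold with \<open>exp (- C) < e\<close>; the maximum with 0 keeps
      \<open>ennreal C\<close> from truncating a negative number.\<close>
    define C where "C = max 0 (1 - ln e)"
    have "exp (- C) \<le> exp (ln e - 1)" unfolding C_def by simp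
    also have "\<dots> < exp (ln e)" by (subst exp_less_cancel_iff) simp
    finally have C: "exp (- C) < e" using that by simp
    have "eventually (\<lambda>x. ennreal C < f x) F"
      using assms True by (intro order_tendstoD(1)[of f v]) auto
    then show ?thesis
    proof eventually_elim
      case (elim x)
      have "exp_neg (f x) \<le> exp_neg (ennreal C)"
        using elim by (intro exp_neg_antimono) auto
      moreover have "0 \<le> C" by (simp add: C_def)
      ultimately show ?case using C by simp
    qed
  qed
  then show ?thesis
    using True by (intro order_tendstoI) (auto intro!: always_eventually less_le_trans[OF _ exp_neg_nonneg])
next
  case False
  have "eventually (\<lambda>x. f x < \<top>) F"
    using assms False by (intro order_tendstoD(2)[of f v]) (auto simp: less_top)
  then have "eventually (\<lambda>x. exp (- enn2real (f x)) = exp_neg (f x)) F"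
    by eventually_elim (auto simp: exp_neg_def)
  moreover have "((\<lambda>x. exp (- enn2real (f x))) \<longlongrightarrow> exp (- enn2real v)) F"
    using assms False by (intro tendsto_intros) (auto simp: less_top)
  ultimately show ?thesis
    using False by (subst (asm) tendsto_cong) (auto simp: exp_neg_def)
qed

lemma measurable_exp_neg [measurable]: "exp_neg \<in> borel_measurable borel"
  by (intro borel_measurable_continuous_onI)
     (auto simp: continuous_on_def intro!: tendsto_exp_neg)

text \<open>Covers divergent series as well: the products then tend to 0, the value of
  \<open>exp_neg\<close> at \<top>.\<close>

lemma exp_neg_suminf:
  fixes f :: "nat \<Rightarrow> ennreal"
  shows "(\<lambda>n. \<Prod>l<n. exp_neg (f l)) \<longlonglongrightarrow> exp_neg (\<Sum>l. f l)"
  unfolding exp_neg_sum[symmetric]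
  by (intro tendsto_exp_neg summable_LIMSEQ) auto

section \<open>Exponential integrals and the Frullani-type identity\<close>

lemma nn_integral_exp_Icc:
  fixes s b :: real
  assumes "0 < s" "0 \<le> b"
  shows "(\<integral>\<^sup>+t\<in>{0..b}. ennreal (exp (- s * t)) \<partial>lborel) = ennreal ((1 - exp (- s * b)) / s)"
proof -
  have "(\<integral>\<^sup>+t\<in>{0..b}. ennreal (exp (- s * t)) \<partial>lborel) =
      ennreal (- exp (- s * b) / s - (- exp (- s * 0) / s))"
    using assms by (intro nn_integral_FTC_Icc) (auto intro!: derivative_eq_intros)
  then show ?thesis
    using assms by (simp add: field_simps)
qed

lemma nn_integral_exp_atLeast:
  fixes c :: real
  assumes "0 < c"
  shows "(\<integral>\<^sup>+s\<in>{0<..}. ennreal (exp (- s * c)) \<partial>lborel) = ennreal (1 / c)"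
proof -
  have "(\<integral>\<^sup>+s\<in>{0<..}. ennreal (exp (- s * c)) \<partial>lborel) = (\<integral>\<^sup>+s\<in>{0..}. ennreal (exp (- s * c)) \<partial>lborel)"
    using AE_lborel_singleton[of 0]
    by (intro nn_integral_cong_AE) (auto elim!: eventually_mono split: split_indicator)
  also have "\<dots> = ennreal (0 - (- exp (- 0 * c) / c))"
  proof (rule nn_integral_FTC_atLeast)
    have "((\<lambda>x. - (exp (- (c * x)) / c)) \<longlongrightarrow> - (0 / c)) at_top"
      using assms
      by (intro tendsto_intros filterlim_compose[OF exp_at_bot] filterlim_compose[OF filterlim_uminus_at_bot_at_top])
         (auto intro!: filterlim_tendsto_pos_mult_at_top filterlim_ident)
    then show "((\<lambda>x. - exp (- x * c) / c) \<longlongrightarrow> 0) at_top" by (simp add: mult.commute)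
  qed (use assms in \<open>auto intro!: derivative_eq_intros simp: field_simps\<close>)
  finally show ?thesis by simp
qed

text \<open>\<open>(1 - exp (- s S)) / s\<close> is the integral of \<open>exp (- s t)\<close> over \<open>0 \<le> t \<le> S\<close>, so the identity is
  Fubini for \<open>exp (- s (a + t))\<close>.\<close>

lemma ln_frullani:
  fixes a S :: real
  assumes "0 < a" "0 \<le> S"
  shows "(\<integral>\<^sup>+s\<in>{0<..}. ennreal (exp (- s * a) / s * (1 - exp (- s * S))) \<partial>lborel) = ennreal (ln (1 + S / a))"
proof -
  have "(\<integral>\<^sup>+s\<in>{0<..}. ennreal (exp (- s * a) / s * (1 - exp (- s * S))) \<partial>lborel) =
     (\<integral>\<^sup>+s. (\<integral>\<^sup>+t. ennreal (exp (- s * (a + t))) * indicator {0..S} t * indicator {0<..} s \<partial>lborel) \<partial>lborel)"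
  proof (intro nn_integral_cong)
    fix s :: real
    show "ennreal (exp (- s * a) / s * (1 - exp (- s * S))) * indicator {0<..} s =
      (\<integral>\<^sup>+t. ennreal (exp (- s * (a + t))) * indicator {0..S} t * indicator {0<..} s \<partial>lborel)"
    proof (cases "s > 0")
      case True
      have "(\<integral>\<^sup>+t. ennreal (exp (- s * (a + t))) * indicator {0..S} t * indicator {0<..} s \<partial>lborel)
        = (\<integral>\<^sup>+t. ennreal (exp (- s * a)) * (ennreal (exp (- s * t)) * indicator {0..S} t) \<partial>lborel)"
        using True
        by (intro nn_integral_cong)
           (auto simp: exp_add[symmetric] ennreal_mult[symmetric] algebra_simps split: split_indicator)
      also have "\<dots> = ennreal (exp (- s * a)) * ennreal ((1 - exp (- s * S)) / s)"
        using True assms nn_integral_exp_Icc[of s S] by (subst nn_integral_cmult) simp_all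
      also have "\<dots> = ennreal (exp (- s * a) / s * (1 - exp (- s * S)))"
        using True assms by (simp add: ennreal_mult[symmetric])
      finally show ?thesis using True by simp
    qed simp
  qed
  also have "\<dots> = (\<integral>\<^sup>+t. (\<integral>\<^sup>+s. ennreal (exp (- s * (a + t))) * indicator {0..S} t * indicator {0<..} s \<partial>lborel) \<partial>lborel)"
    by (intro lborel_pair.Fubini') measurable
  also have "\<dots> = (\<integral>\<^sup>+t. ennreal (1 / (a + t)) * indicator {0..S} t \<partial>lborel)"
  proof (intro nn_integral_cong)
    fix t :: real
    show "(\<integral>\<^sup>+s. ennreal (exp (- s * (a + t))) * indicator {0..S} t * indicator {0<..} s \<partial>lborel) =
      ennreal (1 / (a + t)) * indicator {0..S} t"
    proof (cases "t \<in> {0..S}")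
      case True
      then show ?thesis using nn_integral_exp_atLeast[of "a + t"] assms by simp
    qed simp
  qed
  also have "\<dots> = ennreal (ln (a + S) - ln (a + 0))"
    using assms by (intro nn_integral_FTC_Icc) (auto intro!: derivative_eq_intros simp: field_simps)
  also have "ln (a + S) - ln (a + 0) = ln (1 + S / a)"
  proof -
    have "1 + S / a = (a + S) / a" using assms by (simp add: field_simps)
    then show ?thesis using assms by (simp add: ln_div)
  qed
  finally show ?thesis .
qed

section \<open>Polar coordinates in the plane\<close>

lemma emeasure_cball_plane: "0 \<le> r \<Longrightarrow> emeasure lborel (cball (0 :: real ^ 2) r) = ennreal (pi * r\<^sup>2)"
  by (simp add: emeasure_cball eval_unit_ball_vol)

text \<open>The preimage of a half-line \<open>{..a}\<close> is a disc, and the derivative of its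
  area \<pi> a^2 is 2 \<pi> a. Half-lines are closed under intersection and generate the Borel sets,
  so discs settle the whole law.\<close>

lemma distr_norm_plane:
  "distr lborel borel (norm :: real ^ 2 \<Rightarrow> real) =
     density lborel (\<lambda>r. ennreal (2 * pi * r) * indicator {0..} r)"
proof (rule measure_eqI_generator_eq[where E = "range (\<lambda>a. {..a})" and \<Omega> = UNIV and A = "\<lambda>i. {..real i}"])
  show "sets (distr lborel borel (norm :: real ^ 2 \<Rightarrow> real)) = sigma_sets UNIV (range (\<lambda>a. {..a}))"
    "sets (density lborel (\<lambda>r. ennreal (2 * pi * r) * indicator {0..} r)) = sigma_sets UNIV (range (\<lambda>a::real. {..a}))"
    by (auto simp: borel_eq_atMost)
  have eq: "emeasure (distr lborel borel (norm :: real ^ 2 \<Rightarrow> real)) {..a} =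
      (if a < 0 then 0 else ennreal (pi * a\<^sup>2))" for a
  proof -
    have "norm -` {..a} = cball (0 :: real ^ 2) a" by auto
    then show ?thesis
      by (auto simp: emeasure_distr emeasure_cball_plane not_less)
  qed
  show "emeasure (distr lborel borel (norm :: real ^ 2 \<Rightarrow> real)) {..real i} \<noteq> \<infinity>" for i
    unfolding eq by auto
  fix X :: "real set" assume "X \<in> range (\<lambda>a. {..a})"
  then obtain a where X: "X = {..a}" by auto
  have "emeasure (density lborel (\<lambda>r. ennreal (2 * pi * r) * indicator {0..} r)) {..a} =
     (\<integral>\<^sup>+r\<in>{0..a}. ennreal (2 * pi * r) \<partial>lborel)"
    by (subst emeasure_density) (auto intro!: nn_integral_cong split: split_indicator)
  also have "\<dots> = (if a < 0 then 0 else ennreal (pi * a\<^sup>2 - pi * 0\<^sup>2))"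
  proof (cases "a < 0")
    case False
    then show ?thesis
      by (simp del: ennreal_minus)
         (intro nn_integral_FTC_Icc[where F = "\<lambda>x. pi * x\<^sup>2", THEN trans], auto intro!: derivative_eq_intros)
  qed simp
  finally show "emeasure (distr lborel borel (norm :: real ^ 2 \<Rightarrow> real)) X =
      emeasure (density lborel (\<lambda>r. ennreal (2 * pi * r) * indicator {0..} r)) X"
    by (simp add: X eq)
qed (auto simp: Int_stable_def real_arch_simple intro: exI[of _ "min _ _"])

lemma nn_integral_radial:
  fixes g :: "real \<Rightarrow> ennreal"
  assumes [measurable]: "g \<in> borel_measurable borel"
  shows "(\<integral>\<^sup>+x. g (norm x) \<partial>(lborel :: (real ^ 2) measure)) = (\<integral>\<^sup>+r\<in>{0..}. ennreal (2 * pi * r) * g r \<partial>lborel)"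
proof -
  have "(\<integral>\<^sup>+x. g (norm x) \<partial>(lborel :: (real ^ 2) measure)) = (\<integral>\<^sup>+r. g r \<partial>distr lborel borel (norm :: real ^ 2 \<Rightarrow> real))"
    by (simp add: nn_integral_distr)
  also have "\<dots> = (\<integral>\<^sup>+r\<in>{0..}. ennreal (2 * pi * r) * g r \<partial>lborel)"
    unfolding distr_norm_plane by (subst nn_integral_density) (auto simp: ac_simps)
  finally show ?thesis .
qed

section \<open>The Laplace functional of a Poisson process\<close>

text \<open>The probability generating function of a Poisson variable, summed by the exponential
  series at \<open>m * q\<close>. It is applied with \<open>q = exp_neg (c i)\<close>, one value for
  each level of a simple function.\<close>

lemma (in prob_space) expectation_power_poisson:
  fixes q m :: real
  assumes [measurable]: "Y \<in> measurable M (count_space UNIV)"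
    and P: "\<And>n. prob {\<omega> \<in> space M. Y \<omega> = n} = m ^ n / fact n * exp (- m)"
    and "0 \<le> m" "0 \<le> q" "q \<le> 1"
  shows "expectation (\<lambda>\<omega>. q ^ Y \<omega>) = exp (- m * (1 - q))"
proof -
  have "distr M (count_space UNIV) Y = density (count_space UNIV) (\<lambda>n. ennreal (m ^ n / fact n * exp (- m)))"
  proof (rule measure_eqI_countable[where A = UNIV])
    fix n :: nat
    have "emeasure (distr M (count_space UNIV) Y) {n} = emeasure M {\<omega> \<in> space M. Y \<omega> = n}"
      by (subst emeasure_distr) (auto intro!: arg_cong[where f = "emeasure M"])
    then show "emeasure (distr M (count_space UNIV) Y) {n} =
        emeasure (density (count_space UNIV) (\<lambda>n. ennreal (m ^ n / fact n * exp (- m)))) {n}"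
      by (simp add: emeasure_eq_measure P emeasure_density nn_integral_count_space_indicator[symmetric])
  qed auto
  note D = this
  have sums: "(\<lambda>n. m ^ n / fact n * exp (- m) * q ^ n) sums (exp (m * q) * exp (- m))"
    using sums_mult2[OF exp_converges[of "m * q"], of "exp (- m)"]
    by (simp add: power_mult_distrib field_simps)
  have "(\<integral>\<^sup>+\<omega>. ennreal (q ^ Y \<omega>) \<partial>M) = (\<integral>\<^sup>+n. ennreal (q ^ n) \<partial>distr M (count_space UNIV) Y)"
    by (simp add: nn_integral_distr)
  also have "\<dots> = (\<Sum>n. ennreal (m ^ n / fact n * exp (- m)) * ennreal (q ^ n))"
    unfolding D by (subst nn_integral_density) (auto simp: nn_integral_count_space_nat)
  also have "\<dots> = (\<Sum>n. ennreal (m ^ n / fact n * exp (- m) * q ^ n))"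
    using assms by (intro suminf_cong ennreal_mult[symmetric]) auto
  also have "\<dots> = ennreal (exp (m * q) * exp (- m))"
    using sums assms by (intro suminf_ennreal_eq) auto
  also have "exp (m * q) * exp (- m) = exp (- m * (1 - q))"
    by (simp add: exp_add[symmetric] algebra_simps)
  finally show ?thesis
    using assms by (intro integral_eq_nn_integral[THEN trans]) auto
qed

lemma empty_in_finite_sets [simp]: "{} \<in> finite_sets \<Lambda>"
  by (simp add: finite_sets_def)

text \<open>Poisson counts are prescribed only on sets of finite measure, so the usual simple
  approximants are also cut off by an exhaustion. The level sets are arranged as a disjoint sequence
  because independence of counts is given for such sequences.\<close>

lemma (in sigma_finite_measure) simple_approximation_finite_sets:
  fixes u :: "'a \<Rightarrow> ennreal"
  assumes u: "u \<in> borel_measurable M"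
  obtains g and c :: "nat \<Rightarrow> nat \<Rightarrow> ennreal" and A m where
    "\<And>n x. x \<in> space M \<Longrightarrow> g n x = (\<Sum>i<m n. c n i * indicator (A n i) x)"
    "\<And>n. range (A n) \<subseteq> finite_sets M" "\<And>n. disjoint_family (A n)"
    "incseq g" "\<And>n. g n \<in> borel_measurable M" "\<And>x. x \<in> space M \<Longrightarrow> (\<lambda>n. g n x) \<longlonglongrightarrow> u x"
proof -
  obtain f where f: "\<And>i. simple_function M (f i)" "incseq f" "\<And>x. (SUP i. f i x) = u x"
    using borel_measurable_implies_simple_function_sequence'[OF u] by metis
  obtain B :: "nat \<Rightarrow> 'a set" where B: "range B \<subseteq> sets M" "(\<Union>i. B i) = space M"
      "\<And>i. emeasure M (B i) \<noteq> \<infinity>" "incseq B"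
    using sigma_finite_incseq by metis
  define g where "g n x = f n x * indicator (B n) x" for n x
  have "\<exists>e m. bij_betw e {..<m::nat} (f n ` space M)" for n
    using f(1)[of n] ex_bij_betw_nat_finite[of "f n ` space M"]
    by (auto simp: simple_function_def atLeast0LessThan)
  then obtain c m where c: "\<And>n. bij_betw (c n) {..<m n :: nat} (f n ` space M)"
    by metis
  \<comment> \<open>Beyond \<open>m n\<close> the sequence is filled with empty sets, which keeps it
    disjoint and inside \<open>finite_sets M\<close>.\<close>
  define A where "A n i = (if i < m n then f n -` {c n i} \<inter> space M \<inter> B n else {})" for n i
  have 4: "incseq g"
  proof (intro monoI le_funI)
    fix i j x assume "i \<le> (j::nat)"
    then have "f i x \<le> f j x" "B i \<subseteq> B j"
      using f(2) B(4) by (auto simp: incseq_def le_fun_def)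
    then show "g i x \<le> g j x"
      by (auto simp: g_def split: split_indicator)
  qed
  have 6: "(\<lambda>n. g n x) \<longlonglongrightarrow> u x" if x: "x \<in> space M" for x
  proof -
    obtain k where "x \<in> B k" using B(2) x by blast
    then have "eventually (\<lambda>n. f n x = g n x) sequentially"
      using B(4) unfolding eventually_sequentially g_def incseq_def
      by (intro exI[of _ k]) (auto split: split_indicator)
    moreover have "(\<lambda>n. f n x) \<longlonglongrightarrow> u x"
      unfolding f(3)[symmetric] using f(2) by (intro LIMSEQ_SUP) (auto simp: incseq_def le_fun_def)
    ultimately show ?thesis by (subst (asm) tendsto_cong) auto
  qed
  have 5: "g n \<in> borel_measurable M" for n
    unfolding g_def using B(1) borel_measurable_simple_function[OF f(1)[of n]] by auto
  have 2: "range (A n) \<subseteq> finite_sets M" for n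
  proof -
    have "f n -` {y} \<inter> space M \<inter> B n \<in> finite_sets M" for y
      using simple_functionD(2)[OF f(1)[of n], of "{y}"] B(1) B(3)[of n]
      by (auto simp: finite_sets_def less_top intro!: le_less_trans[OF emeasure_mono[of _ "B n"]])
    then show ?thesis by (auto simp: A_def)
  qed
  have 3: "disjoint_family (A n)" for n
    using c[of n] by (auto simp: A_def disjoint_family_on_def bij_betw_def inj_on_def)
  have 1: "g n x = (\<Sum>i<m n. c n i * indicator (A n i) x)" if "x \<in> space M" for n x
  proof -
    have "f n x = (\<Sum>y\<in>f n ` space M. y * indicator (f n -` {y} \<inter> space M) x)"
      by (intro simple_function_indicator_representation f that)
    also have "\<dots> = (\<Sum>i<m n. c n i * indicator (f n -` {c n i} \<inter> space M) x)"
      by (intro sum.reindex_bij_betw[symmetric] c)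
    finally show ?thesis
      unfolding g_def by (auto simp: sum_distrib_right A_def intro!: sum.cong split: split_indicator)
  qed
  show ?thesis by (rule that[OF 1 2 3 4 5 6])
qed

lemma nn_integral_points_suminf:
  "(\<integral>\<^sup>+l. h (X l \<omega>) \<partial>count_space (J \<omega>)) = (\<Sum>l. h (X l \<omega>) * indicator (J \<omega>) l)"
  for J :: "'w \<Rightarrow> nat set"
  by (simp add: nn_integral_count_space_indicator nn_integral_count_space_nat)

text \<open>Finiteness matters because \<open>point_count\<close> is 0 on an infinite index set,
  where the sum need not vanish.\<close>

lemma nn_integral_points_simple:
  fixes c :: "nat \<Rightarrow> ennreal"
  assumes "\<And>l. g (X l \<omega>) = (\<Sum>i<m. c i * indicator (A i) (X l \<omega>))"
    and "\<And>i. i < m \<Longrightarrow> finite {l \<in> J \<omega>. X l \<omega> \<in> A i}"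
  shows "(\<integral>\<^sup>+l. g (X l \<omega>) \<partial>count_space (J \<omega>)) = (\<Sum>i<m. of_nat (point_count X J (A i) \<omega>) * c i)"
proof -
  have "(\<integral>\<^sup>+l. g (X l \<omega>) \<partial>count_space (J \<omega>)) =
      (\<Sum>i<m. \<integral>\<^sup>+l. c i * indicator {l \<in> J \<omega>. X l \<omega> \<in> A i} l \<partial>count_space (J \<omega>))"
    by (subst nn_integral_sum[symmetric])
       (auto simp: assms(1) indicator_def intro!: nn_integral_cong sum.cong)
  also have "\<dots> = (\<Sum>i<m. of_nat (point_count X J (A i) \<omega>) * c i)"
    using assms(2)
    by (intro sum.cong refl) (subst nn_integral_cmult_indicator, auto simp: point_count_def mult.commute)
  finally show ?thesis .
qed

context
  fixes M :: "'w measure" and \<Lambda> :: "'a measure" and X :: "nat \<Rightarrow> 'w \<Rightarrow> 'a" and J :: "'w \<Rightarrow> nat set"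
  assumes pp: "poisson_process M \<Lambda> X J"
begin

lemma poisson_process_measurable:
  "X l \<in> measurable M \<Lambda>" "Measurable.pred M (\<lambda>\<omega>. l \<in> J \<omega>)"
  using pp by (auto simp: poisson_process_def pred_def)

lemma poisson_process_AE_finite:
  "A \<in> finite_sets \<Lambda> \<Longrightarrow> AE \<omega> in M. finite {l \<in> J \<omega>. X l \<omega> \<in> A}"
  using pp by (auto simp: poisson_process_def)

lemma poisson_process_prob:
  "A \<in> finite_sets \<Lambda> \<Longrightarrow> measure M {\<omega> \<in> space M. point_count X J A \<omega> = n} =
     measure \<Lambda> A ^ n / fact n * exp (- measure \<Lambda> A)"
  using pp by (auto simp: poisson_process_def)

lemma poisson_process_indep_vars:
  "range A \<subseteq> finite_sets \<Lambda> \<Longrightarrow> disjoint_family A \<Longrightarrow>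
     prob_space.indep_vars M (\<lambda>_. count_space UNIV) (\<lambda>i::nat. point_count X J (A i)) UNIV"
  using pp by (auto simp: poisson_process_def)

lemma measurable_point_sum:
  fixes h :: "'a \<Rightarrow> ennreal"
  assumes [measurable]: "h \<in> borel_measurable \<Lambda>"
  shows "(\<lambda>\<omega>. \<integral>\<^sup>+l. h (X l \<omega>) \<partial>count_space (J \<omega>)) \<in> borel_measurable M"
  using poisson_process_measurable[measurable]
  unfolding nn_integral_points_suminf indicator_def by measurable

lemma tendsto_point_sum:
  fixes g :: "nat \<Rightarrow> 'a \<Rightarrow> ennreal"
  assumes "incseq g" "\<And>x. x \<in> space \<Lambda> \<Longrightarrow> (\<lambda>n. g n x) \<longlonglongrightarrow> u x" "\<omega> \<in> space M"
  shows "(\<lambda>n. \<integral>\<^sup>+l. g n (X l \<omega>) \<partial>count_space (J \<omega>)) \<longlonglongrightarrow> (\<integral>\<^sup>+l. u (X l \<omega>) \<partial>count_space (J \<omega>))"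
  using assms measurable_space[OF poisson_process_measurable(1)]
  by (intro nn_integral_LIMSEQ) (auto simp: incseq_def le_fun_def)

lemma AE_exp_neg_simple_sum:
  fixes c :: "nat \<Rightarrow> ennreal"
  assumes g: "\<And>x. x \<in> space \<Lambda> \<Longrightarrow> g x = (\<Sum>i<m. c i * indicator (A i) x)"
    and A: "range A \<subseteq> finite_sets \<Lambda>"
  shows "AE \<omega> in M. exp_neg (\<integral>\<^sup>+l. g (X l \<omega>) \<partial>count_space (J \<omega>)) =
    (\<Prod>i<m. exp_neg (c i) ^ point_count X J (A i) \<omega>)"
proof -
  have "AE \<omega> in M. \<forall>i. finite {l \<in> J \<omega>. X l \<omega> \<in> A i}"
    using A by (subst AE_all_countable) (auto intro!: poisson_process_AE_finite)
  then show ?thesis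
  proof (rule AE_mp, intro AE_I2 impI)
    fix \<omega> assume "\<omega> \<in> space M" "\<forall>i. finite {l \<in> J \<omega>. X l \<omega> \<in> A i}"
    moreover from this have "g (X l \<omega>) = (\<Sum>i<m. c i * indicator (A i) (X l \<omega>))" for l
      using g measurable_space[OF poisson_process_measurable(1)] by auto
    ultimately show "exp_neg (\<integral>\<^sup>+l. g (X l \<omega>) \<partial>count_space (J \<omega>)) =
        (\<Prod>i<m. exp_neg (c i) ^ point_count X J (A i) \<omega>)"
      by (subst nn_integral_points_simple[where A = A and c = c and m = m])
         (auto simp: exp_neg_sum exp_neg_of_nat_mult)
  qed
qed

text \<open>Independent counts split the expectation into Poisson generating functions, whose
  exponents \<open>measure \<Lambda> (A i) * (1 - exp_neg (c i))\<close> add up to the integral of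
  \<open>1 - exp_neg (g x)\<close>, since \<open>g\<close> takes the value \<open>c i\<close> on
  \<open>A i\<close> and 0 off all of them.\<close>

lemma expectation_exp_neg_simple_sum:
  fixes c :: "nat \<Rightarrow> ennreal"
  assumes "prob_space M"
    and g: "\<And>x. x \<in> space \<Lambda> \<Longrightarrow> g x = (\<Sum>i<m. c i * indicator (A i) x)"
    and A: "range A \<subseteq> finite_sets \<Lambda>" "disjoint_family A"
  shows "(\<integral>\<omega>. (\<Prod>i<m. exp_neg (c i) ^ point_count X J (A i) \<omega>) \<partial>M) =
    exp_neg (\<integral>\<^sup>+x. ennreal (1 - exp_neg (g x)) \<partial>\<Lambda>)"
proof -
  interpret prob_space M by fact
  have iv: "indep_vars (\<lambda>_. count_space UNIV) (\<lambda>i. point_count X J (A i)) {..<m}"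
    using poisson_process_indep_vars[OF A] by (rule indep_vars_subset) auto
  have rv [measurable]: "point_count X J (A i) \<in> measurable M (count_space UNIV)" for i
    using poisson_process_indep_vars[OF A] by (auto simp: indep_vars_def)
  have As [measurable]: "A i \<in> sets \<Lambda>" for i
    using A by (auto simp: finite_sets_def)
  have Ai: "A i \<in> finite_sets \<Lambda>" for i using A by auto
  have "(\<integral>\<omega>. (\<Prod>i<m. exp_neg (c i) ^ point_count X J (A i) \<omega>) \<partial>M) =
      (\<Prod>i<m. \<integral>\<omega>. exp_neg (c i) ^ point_count X J (A i) \<omega> \<partial>M)"
    by (intro indep_vars_lebesgue_integral indep_vars_compose2[OF iv] finite_lessThan
          integrable_const_bound[where B = 1])
       (auto intro!: power_le_one)
  also have "\<dots> = (\<Prod>i<m. exp (- measure \<Lambda> (A i) * (1 - exp_neg (c i))))"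
    using Ai by (intro prod.cong refl expectation_power_poisson poisson_process_prob) auto
  also have "\<dots> = (\<Prod>i<m. exp_neg (ennreal (1 - exp_neg (c i)) * emeasure \<Lambda> (A i)))"
  proof (intro prod.cong refl)
    fix i
    have "emeasure \<Lambda> (A i) = ennreal (measure \<Lambda> (A i))"
      using Ai[of i] by (simp add: finite_sets_def emeasure_eq_ennreal_measure less_top)
    then show "exp (- measure \<Lambda> (A i) * (1 - exp_neg (c i))) =
        exp_neg (ennreal (1 - exp_neg (c i)) * emeasure \<Lambda> (A i))"
      by (simp add: ennreal_mult[symmetric] mult.commute)
  qed
  also have "\<dots> = exp_neg (\<Sum>i<m. \<integral>\<^sup>+x. ennreal (1 - exp_neg (c i)) * indicator (A i) x \<partial>\<Lambda>)"
    by (simp add: exp_neg_sum nn_integral_cmult_indicator)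
  also have "(\<Sum>i<m. \<integral>\<^sup>+x. ennreal (1 - exp_neg (c i)) * indicator (A i) x \<partial>\<Lambda>) =
      (\<integral>\<^sup>+x. (\<Sum>i<m. ennreal (1 - exp_neg (c i)) * indicator (A i) x) \<partial>\<Lambda>)"
    by (intro nn_integral_sum[symmetric]) auto
  also have "\<dots> = (\<integral>\<^sup>+x. ennreal (1 - exp_neg (g x)) \<partial>\<Lambda>)"
  proof (intro nn_integral_cong)
    fix x assume x: "x \<in> space \<Lambda>"
    show "(\<Sum>i<m. ennreal (1 - exp_neg (c i)) * indicator (A i) x) = ennreal (1 - exp_neg (g x))"
    proof (cases "\<exists>i<m. x \<in> A i")
      case True
      then obtain j where j: "j < m" "x \<in> A j" by auto
      then have "x \<in> A i \<longleftrightarrow> i = j" for i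
        using A(2) by (auto simp: disjoint_family_on_def)
      \<comment> \<open>Stated for every \<open>f\<close> so that it rewrites both
        \<open>g x\<close> itself and the sum of transformed values.\<close>
      then have "(\<Sum>i<m. f i * indicator (A i) x) = f j" for f :: "nat \<Rightarrow> ennreal"
        using j by (subst sum.mono_neutral_right[where S = "{j}"]) auto
      then show ?thesis by (simp only: g[OF x])
    qed (simp add: g[OF x])
  qed
  finally show ?thesis .
qed

end

lemma tendsto_nn_integral_one_minus_exp_neg:
  assumes "incseq g" and [measurable]: "\<And>n. g n \<in> borel_measurable \<Lambda>"
    and lim: "\<And>x. x \<in> space \<Lambda> \<Longrightarrow> (\<lambda>n. g n x) \<longlonglongrightarrow> h x"
  shows "(\<lambda>n. \<integral>\<^sup>+x. ennreal (1 - exp_neg (g n x)) \<partial>\<Lambda>) \<longlonglongrightarrow> (\<integral>\<^sup>+x. ennreal (1 - exp_neg (h x)) \<partial>\<Lambda>)"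
proof -
  let ?f = "\<lambda>n x. ennreal (1 - exp_neg (g n x))"
  have inc: "incseq ?f"
    using \<open>incseq g\<close> by (auto simp: incseq_def le_fun_def intro!: ennreal_leI exp_neg_antimono)
  \<comment> \<open>The limit \<open>h\<close> is controlled only on the space of \<Lambda>, so
    monotone convergence first targets the supremum, which is identified with the limit under the
    integral afterwards.\<close>
  have sup: "(\<lambda>n. ?f n x) \<longlonglongrightarrow> (SUP n. ?f n x)" for x
    using inc by (intro LIMSEQ_SUP) (auto simp: incseq_def le_fun_def)
  have "(\<lambda>n. \<integral>\<^sup>+x. ?f n x \<partial>\<Lambda>) \<longlonglongrightarrow> (\<integral>\<^sup>+x. (SUP n. ?f n x) \<partial>\<Lambda>)"
    by (intro nn_integral_LIMSEQ inc sup) measurable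
  also have "(\<integral>\<^sup>+x. (SUP n. ?f n x) \<partial>\<Lambda>) = (\<integral>\<^sup>+x. ennreal (1 - exp_neg (h x)) \<partial>\<Lambda>)"
    by (intro nn_integral_cong LIMSEQ_unique[OF sup] tendsto_ennrealI tendsto_diff tendsto_const
          tendsto_exp_neg lim)
  finally show ?thesis .
qed

text \<open>Both sums sit in one expectation, and independence is given only between the two
  families of counts. It is therefore used at the level of simple functions, whose sums are almost
  surely expressions in finitely many counts; only then are limits taken.\<close>

lemma (in prob_space) poisson_laplace_functional_pair:
  fixes X :: "nat \<Rightarrow> 'a \<Rightarrow> 'b" and h\<^sub>1 h\<^sub>2 :: "'b \<Rightarrow> ennreal"
  assumes pp\<^sub>1: "poisson_process M \<Lambda>\<^sub>1 X J\<^sub>1" and pp\<^sub>2: "poisson_process M \<Lambda>\<^sub>2 X J\<^sub>2"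
    and indep: "indep_processes M \<Lambda>\<^sub>1 \<Lambda>\<^sub>2 X J\<^sub>1 J\<^sub>2"
    and "sigma_finite_measure \<Lambda>\<^sub>1" "sigma_finite_measure \<Lambda>\<^sub>2"
    and h [measurable]: "h\<^sub>1 \<in> borel_measurable \<Lambda>\<^sub>1" "h\<^sub>2 \<in> borel_measurable \<Lambda>\<^sub>2"
  shows "expectation (\<lambda>\<omega>. exp_neg (\<integral>\<^sup>+l. h\<^sub>1 (X l \<omega>) \<partial>count_space (J\<^sub>1 \<omega>)) *
      exp_neg (\<integral>\<^sup>+l. h\<^sub>2 (X l \<omega>) \<partial>count_space (J\<^sub>2 \<omega>))) =
    exp_neg (\<integral>\<^sup>+x. ennreal (1 - exp_neg (h\<^sub>1 x)) \<partial>\<Lambda>\<^sub>1) * exp_neg (\<integral>\<^sup>+x. ennreal (1 - exp_neg (h\<^sub>2 x)) \<partial>\<Lambda>\<^sub>2)"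
proof -
  interpret L1: sigma_finite_measure \<Lambda>\<^sub>1 by fact
  interpret L2: sigma_finite_measure \<Lambda>\<^sub>2 by fact
  obtain g\<^sub>1 and c\<^sub>1 :: "nat \<Rightarrow> nat \<Rightarrow> ennreal" and A\<^sub>1 m\<^sub>1 where g1:
    "\<And>n x. x \<in> space \<Lambda>\<^sub>1 \<Longrightarrow> g\<^sub>1 n x = (\<Sum>i<m\<^sub>1 n. c\<^sub>1 n i * indicator (A\<^sub>1 n i) x)"
    "\<And>n. range (A\<^sub>1 n) \<subseteq> finite_sets \<Lambda>\<^sub>1" "\<And>n. disjoint_family (A\<^sub>1 n)"
    "incseq g\<^sub>1" and g1_meas [measurable]: "\<And>n. g\<^sub>1 n \<in> borel_measurable \<Lambda>\<^sub>1"
    and g1_lim: "\<And>x. x \<in> space \<Lambda>\<^sub>1 \<Longrightarrow> (\<lambda>n. g\<^sub>1 n x) \<longlonglongrightarrow> h\<^sub>1 x"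
    using L1.simple_approximation_finite_sets[OF h(1)] by blast
  obtain g\<^sub>2 and c\<^sub>2 :: "nat \<Rightarrow> nat \<Rightarrow> ennreal" and A\<^sub>2 m\<^sub>2 where g2:
    "\<And>n x. x \<in> space \<Lambda>\<^sub>2 \<Longrightarrow> g\<^sub>2 n x = (\<Sum>i<m\<^sub>2 n. c\<^sub>2 n i * indicator (A\<^sub>2 n i) x)"
    "\<And>n. range (A\<^sub>2 n) \<subseteq> finite_sets \<Lambda>\<^sub>2" "\<And>n. disjoint_family (A\<^sub>2 n)"
    "incseq g\<^sub>2" and g2_meas [measurable]: "\<And>n. g\<^sub>2 n \<in> borel_measurable \<Lambda>\<^sub>2"
    and g2_lim: "\<And>x. x \<in> space \<Lambda>\<^sub>2 \<Longrightarrow> (\<lambda>n. g\<^sub>2 n x) \<longlonglongrightarrow> h\<^sub>2 x"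
    using L2.simple_approximation_finite_sets[OF h(2)] by blast
  define G\<^sub>1 where "G\<^sub>1 h \<omega> = exp_neg (\<integral>\<^sup>+l. h (X l \<omega>) \<partial>count_space (J\<^sub>1 \<omega>))" for h \<omega>
  define G\<^sub>2 where "G\<^sub>2 h \<omega> = exp_neg (\<integral>\<^sup>+l. h (X l \<omega>) \<partial>count_space (J\<^sub>2 \<omega>))" for h \<omega>
  have Gm [measurable]: "\<And>h. h \<in> borel_measurable \<Lambda>\<^sub>1 \<Longrightarrow> G\<^sub>1 h \<in> borel_measurable M"
      "\<And>h. h \<in> borel_measurable \<Lambda>\<^sub>2 \<Longrightarrow> G\<^sub>2 h \<in> borel_measurable M"
    unfolding G\<^sub>1_def G\<^sub>2_def
    by (auto intro!: measurable_compose[OF _ measurable_exp_neg]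
        measurable_point_sum[OF pp\<^sub>1] measurable_point_sum[OF pp\<^sub>2])
  have bound: "norm (G\<^sub>1 h \<omega> * G\<^sub>2 k \<omega>) \<le> 1" for h k \<omega>
    unfolding G\<^sub>1_def G\<^sub>2_def by (auto simp: abs_mult intro!: mult_le_one)
  let ?E = "\<lambda>\<Lambda> h. exp_neg (\<integral>\<^sup>+x. ennreal (1 - exp_neg (h x)) \<partial>\<Lambda>)"
  have simple: "expectation (\<lambda>\<omega>. G\<^sub>1 (g\<^sub>1 n) \<omega> * G\<^sub>2 (g\<^sub>2 n) \<omega>) = ?E \<Lambda>\<^sub>1 (g\<^sub>1 n) * ?E \<Lambda>\<^sub>2 (g\<^sub>2 n)" for n
  proof -
    \<comment> \<open>Functions of the whole vector of counts, so that the independence of the two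
      vectors passes to them by composition.\<close>
    define F\<^sub>1 where "F\<^sub>1 y = (\<Prod>i<m\<^sub>1 n. exp_neg (c\<^sub>1 n i) ^ y (A\<^sub>1 n i))" for y
    define F\<^sub>2 where "F\<^sub>2 y = (\<Prod>i<m\<^sub>2 n. exp_neg (c\<^sub>2 n i) ^ y (A\<^sub>2 n i))" for y
    let ?Y1 = "\<lambda>\<omega>. \<lambda>A\<in>finite_sets \<Lambda>\<^sub>1. point_count X J\<^sub>1 A \<omega>"
    let ?Y2 = "\<lambda>\<omega>. \<lambda>A\<in>finite_sets \<Lambda>\<^sub>2. point_count X J\<^sub>2 A \<omega>"
    have A1 [simp]: "A\<^sub>1 n i \<in> finite_sets \<Lambda>\<^sub>1" for i using g1(2)[of n] by auto
    have A2 [simp]: "A\<^sub>2 n i \<in> finite_sets \<Lambda>\<^sub>2" for i using g2(2)[of n] by auto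
    have F1m: "F\<^sub>1 \<in> borel_measurable (PiM (finite_sets \<Lambda>\<^sub>1) (\<lambda>_. count_space UNIV))"
      unfolding F\<^sub>1_def
      by (intro borel_measurable_prod measurable_compose[OF measurable_component_singleton[OF A1]]) auto
    have F2m: "F\<^sub>2 \<in> borel_measurable (PiM (finite_sets \<Lambda>\<^sub>2) (\<lambda>_. count_space UNIV))"
      unfolding F\<^sub>2_def
      by (intro borel_measurable_prod measurable_compose[OF measurable_component_singleton[OF A2]]) auto
    have iv: "indep_var borel (F\<^sub>1 \<circ> ?Y1) borel (F\<^sub>2 \<circ> ?Y2)"
      using indep F1m F2m unfolding indep_processes_def by (rule indep_var_compose)
    have Fle: "0 \<le> F\<^sub>1 y \<and> F\<^sub>1 y \<le> 1" "0 \<le> F\<^sub>2 z \<and> F\<^sub>2 z \<le> 1" for y z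
      unfolding F\<^sub>1_def F\<^sub>2_def by (auto intro!: prod_nonneg prod_le_1 power_le_one)
    have eq1: "AE \<omega> in M. G\<^sub>1 (g\<^sub>1 n) \<omega> = (F\<^sub>1 \<circ> ?Y1) \<omega>"
      using AE_exp_neg_simple_sum[OF pp\<^sub>1, where g = "g\<^sub>1 n" and m = "m\<^sub>1 n" and c = "c\<^sub>1 n" and A = "A\<^sub>1 n"] g1
      by (simp add: G\<^sub>1_def F\<^sub>1_def)
    have eq2: "AE \<omega> in M. G\<^sub>2 (g\<^sub>2 n) \<omega> = (F\<^sub>2 \<circ> ?Y2) \<omega>"
      using AE_exp_neg_simple_sum[OF pp\<^sub>2, where g = "g\<^sub>2 n" and m = "m\<^sub>2 n" and c = "c\<^sub>2 n" and A = "A\<^sub>2 n"] g2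
      by (simp add: G\<^sub>2_def F\<^sub>2_def)
    have rv [measurable]: "F\<^sub>1 \<circ> ?Y1 \<in> borel_measurable M" "F\<^sub>2 \<circ> ?Y2 \<in> borel_measurable M"
      using iv by (auto dest: indep_var_rv1 indep_var_rv2)
    have "expectation (\<lambda>\<omega>. G\<^sub>1 (g\<^sub>1 n) \<omega> * G\<^sub>2 (g\<^sub>2 n) \<omega>) =
        expectation (\<lambda>\<omega>. (F\<^sub>1 \<circ> ?Y1) \<omega> * (F\<^sub>2 \<circ> ?Y2) \<omega>)"
      by (intro integral_cong_AE borel_measurable_times rv Gm g1_meas g2_meas) (use eq1 eq2 in auto)
    also have "\<dots> = expectation (F\<^sub>1 \<circ> ?Y1) * expectation (F\<^sub>2 \<circ> ?Y2)"
      using Fle by (intro indep_var_lebesgue_integral iv integrable_const_bound[where B = 1] rv) auto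
    also have "expectation (F\<^sub>1 \<circ> ?Y1) = ?E \<Lambda>\<^sub>1 (g\<^sub>1 n)"
      using expectation_exp_neg_simple_sum[OF pp\<^sub>1 prob_space_axioms g1(1-3), of n]
      by (simp add: F\<^sub>1_def comp_def)
    also have "expectation (F\<^sub>2 \<circ> ?Y2) = ?E \<Lambda>\<^sub>2 (g\<^sub>2 n)"
      using expectation_exp_neg_simple_sum[OF pp\<^sub>2 prob_space_axioms g2(1-3), of n]
      by (simp add: F\<^sub>2_def comp_def)
    finally show ?thesis .
  qed
  have "(\<lambda>n. expectation (\<lambda>\<omega>. G\<^sub>1 (g\<^sub>1 n) \<omega> * G\<^sub>2 (g\<^sub>2 n) \<omega>)) \<longlonglongrightarrow> expectation (\<lambda>\<omega>. G\<^sub>1 h\<^sub>1 \<omega> * G\<^sub>2 h\<^sub>2 \<omega>)"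
  proof (rule integral_dominated_convergence[where w = "\<lambda>_. 1"])
    show "AE \<omega> in M. (\<lambda>n. G\<^sub>1 (g\<^sub>1 n) \<omega> * G\<^sub>2 (g\<^sub>2 n) \<omega>) \<longlonglongrightarrow> G\<^sub>1 h\<^sub>1 \<omega> * G\<^sub>2 h\<^sub>2 \<omega>"
      unfolding G\<^sub>1_def G\<^sub>2_def
      by (intro AE_I2 tendsto_mult tendsto_exp_neg tendsto_point_sum[OF pp\<^sub>1] tendsto_point_sum[OF pp\<^sub>2]
            g1 g2 g1_lim g2_lim)
  qed (use bound in auto)
  moreover have "(\<lambda>n. ?E \<Lambda>\<^sub>1 (g\<^sub>1 n) * ?E \<Lambda>\<^sub>2 (g\<^sub>2 n)) \<longlonglongrightarrow> ?E \<Lambda>\<^sub>1 h\<^sub>1 * ?E \<Lambda>\<^sub>2 h\<^sub>2"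
    by (intro tendsto_mult tendsto_exp_neg tendsto_nn_integral_one_minus_exp_neg
          g1(4) g2(4) g1_meas g2_meas g1_lim g2_lim)
  ultimately have "expectation (\<lambda>\<omega>. G\<^sub>1 h\<^sub>1 \<omega> * G\<^sub>2 h\<^sub>2 \<omega>) = ?E \<Lambda>\<^sub>1 h\<^sub>1 * ?E \<Lambda>\<^sub>2 h\<^sub>2"
    unfolding simple by (rule LIMSEQ_unique)
  then show ?thesis by (simp add: G\<^sub>1_def G\<^sub>2_def)
qed

section \<open>Independent marks\<close>

text \<open>The case of a frozen configuration. Finite partial products factor by independence, and
  the bound 1 carries this to the full series; giving the factors as \<open>exp_neg (k l)\<close>
  makes the limit a sum of exponents.\<close>

lemma (in prob_space) expectation_exp_neg_indep_sum:
  fixes V :: "nat \<Rightarrow> 'a \<Rightarrow> 'm" and f :: "nat \<Rightarrow> 'm \<Rightarrow> ennreal"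
  assumes indep: "indep_vars (\<lambda>_. N) V UNIV"
    and f [measurable]: "\<And>l. f l \<in> borel_measurable N"
    and k: "\<And>l. expectation (\<lambda>\<omega>. exp_neg (f l (V l \<omega>))) = exp_neg (k l)"
  shows "expectation (\<lambda>\<omega>. exp_neg (\<Sum>l. f l (V l \<omega>))) = exp_neg (\<Sum>l. k l)"
proof -
  have V [measurable]: "V l \<in> measurable M N" for l
    using indep by (auto simp: indep_vars_def)
  have "expectation (\<lambda>\<omega>. \<Prod>l<n. exp_neg (f l (V l \<omega>))) = (\<Prod>l<n. exp_neg (k l))" for n
    unfolding k[symmetric]
    by (intro indep_vars_lebesgue_integral indep_vars_compose2[OF indep_vars_subset[OF indep]]
          integrable_const_bound[where B = 1]) auto
  moreover have "(\<lambda>n. expectation (\<lambda>\<omega>. \<Prod>l<n. exp_neg (f l (V l \<omega>)))) \<longlonglongrightarrow>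
      expectation (\<lambda>\<omega>. exp_neg (\<Sum>l. f l (V l \<omega>)))"
    by (rule integral_dominated_convergence[where w = "\<lambda>_. 1"])
       (auto intro!: exp_neg_suminf prod_le_1 simp: abs_prod)
  ultimately show ?thesis
    using exp_neg_suminf[of k] by (auto dest: LIMSEQ_unique)
qed

text \<open>Independence gives the product formula on rectangles, and these determine the joint law.
  This is what allows the configuration to be frozen by Fubini.\<close>

lemma (in prob_space) indep_elements_distr:
  assumes "indep_elements M S X T Y"
  shows "distr M (S \<Otimes>\<^sub>M T) (\<lambda>\<omega>. (X \<omega>, Y \<omega>)) = distr M S X \<Otimes>\<^sub>M distr M T Y"
proof -
  have [measurable]: "X \<in> measurable M S" "Y \<in> measurable M T"
    and ind: "indep_set {X -` A \<inter> space M |A. A \<in> sets S} {Y -` B \<inter> space M |B. B \<in> sets T}"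
    using assms by (auto simp: indep_elements_def)
  interpret X: prob_space "distr M S X" by (rule prob_space_distr) measurable
  interpret Y: prob_space "distr M T Y" by (rule prob_space_distr) measurable
  show ?thesis
  proof (rule pair_measure_eqI[symmetric])
    fix A B assume A: "A \<in> sets (distr M S X)" and B: "B \<in> sets (distr M T Y)"
    then have [measurable]: "A \<in> sets S" "B \<in> sets T" by auto
    have "emeasure M ((X -` A \<inter> space M) \<inter> (Y -` B \<inter> space M)) =
        emeasure M (X -` A \<inter> space M) * emeasure M (Y -` B \<inter> space M)"
    proof -
      have "prob ((X -` A \<inter> space M) \<inter> (Y -` B \<inter> space M)) =
          prob (X -` A \<inter> space M) * prob (Y -` B \<inter> space M)"
        using \<open>A \<in> sets S\<close> \<open>B \<in> sets T\<close> by (intro indep_setD[OF ind]) blast+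
      then show ?thesis by (simp add: emeasure_eq_measure ennreal_mult[symmetric])
    qed
    moreover have "(\<lambda>\<omega>. (X \<omega>, Y \<omega>)) -` (A \<times> B) \<inter> space M = (X -` A \<inter> space M) \<inter> (Y -` B \<inter> space M)"
      by auto
    ultimately show "emeasure (distr M S X) A * emeasure (distr M T Y) B =
        emeasure (distr M (S \<Otimes>\<^sub>M T) (\<lambda>\<omega>. (X \<omega>, Y \<omega>))) (A \<times> B)"
      by (simp add: emeasure_distr)
  qed (auto intro: X.sigma_finite_measure_axioms Y.sigma_finite_measure_axioms)
qed

text \<open>Fubini for the product law of configuration and marks: the marks are integrated out for
  fixed \<open>w\<close>. The result is again \<open>exp_neg\<close> of a sum, with terms depending
  on the configuration alone, so a Laplace functional can be applied to it.\<close>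

lemma (in prob_space) expectation_exp_neg_marked_sum:
  fixes V :: "nat \<Rightarrow> 'a \<Rightarrow> 'm" and F :: "'c \<Rightarrow> nat \<Rightarrow> 'm \<Rightarrow> ennreal"
  assumes ie: "indep_elements M A W (PiM UNIV (\<lambda>_. N)) (\<lambda>\<omega> l. V l \<omega>)"
    and indep: "indep_vars (\<lambda>_. N) V UNIV"
    and F [measurable]: "\<And>l. (\<lambda>(w, m). F w l m) \<in> borel_measurable (A \<Otimes>\<^sub>M N)"
    and k [measurable]: "\<And>l. (\<lambda>w. k w l) \<in> borel_measurable A"
    and Fk: "\<And>w l. w \<in> space A \<Longrightarrow> expectation (\<lambda>\<omega>. exp_neg (F w l (V l \<omega>))) = exp_neg (k w l)"
  shows "expectation (\<lambda>\<omega>. exp_neg (\<Sum>l. F (W \<omega>) l (V l \<omega>))) = expectation (\<lambda>\<omega>. exp_neg (\<Sum>l. k (W \<omega>) l))"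
proof -
  let ?T = "PiM UNIV (\<lambda>_. N) :: (nat \<Rightarrow> 'm) measure"
  have W [measurable]: "W \<in> measurable M A" and V [measurable]: "(\<lambda>\<omega> l. V l \<omega>) \<in> measurable M ?T"
    using ie by (auto simp: indep_elements_def)
  interpret X: prob_space "distr M A W" by (rule prob_space_distr) measurable
  interpret Y: prob_space "distr M ?T (\<lambda>\<omega> l. V l \<omega>)" by (rule prob_space_distr) measurable
  interpret XY: pair_prob_space "distr M A W" "distr M ?T (\<lambda>\<omega> l. V l \<omega>)" ..
  have G [measurable]: "(\<lambda>(w, v). exp_neg (\<Sum>l. F w l (v l))) \<in> borel_measurable (A \<Otimes>\<^sub>M ?T)"
  proof -
    have "(\<lambda>p. F (fst p) l (snd p l)) \<in> borel_measurable (A \<Otimes>\<^sub>M ?T)" for l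
    proof -
      have "(\<lambda>p. (fst p, snd p l)) \<in> measurable (A \<Otimes>\<^sub>M ?T) (A \<Otimes>\<^sub>M N)" by measurable
      from measurable_compose[OF this F[of l]] show ?thesis by simp
    qed
    then show ?thesis by (simp add: split_beta')
  qed
  have "expectation (\<lambda>\<omega>. exp_neg (\<Sum>l. F (W \<omega>) l (V l \<omega>))) =
      integral\<^sup>L (distr M (A \<Otimes>\<^sub>M ?T) (\<lambda>\<omega>. (W \<omega>, \<lambda>l. V l \<omega>))) (\<lambda>(w, v). exp_neg (\<Sum>l. F w l (v l)))"
    by (subst integral_distr) auto
  also have "\<dots> = (\<integral>w. (\<integral>v. exp_neg (\<Sum>l. F w l (v l)) \<partial>distr M ?T (\<lambda>\<omega> l. V l \<omega>)) \<partial>distr M A W)"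
    unfolding indep_elements_distr[OF ie] using G
    by (subst XY.integral_fst'[symmetric])
       (auto intro!: XY.P.integrable_const_bound[where B = 1] simp: split_beta'
             simp: measurable_cong_sets[OF sets_pair_measure_cong[OF sets_distr sets_distr] refl])
  also have "\<dots> = (\<integral>w. exp_neg (\<Sum>l. k w l) \<partial>distr M A W)"
  proof (intro Bochner_Integration.integral_cong refl)
    fix w assume "w \<in> space (distr M A W)"
    then have w [measurable]: "w \<in> space A" by simp
    have Fw [measurable]: "F w l \<in> borel_measurable N" for l
      using measurable_compose[OF measurable_Pair1'[OF w] F[of l]] by simp
    have "(\<integral>v. exp_neg (\<Sum>l. F w l (v l)) \<partial>distr M ?T (\<lambda>\<omega> l. V l \<omega>)) = expectation (\<lambda>\<omega>. exp_neg (\<Sum>l. F w l (V l \<omega>)))"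
      by (subst integral_distr) auto
    also have "\<dots> = exp_neg (\<Sum>l. k w l)"
      using Fk[OF w] by (intro expectation_exp_neg_indep_sum[OF indep]) auto
    finally show "(\<integral>v. exp_neg (\<Sum>l. F w l (v l)) \<partial>distr M ?T (\<lambda>\<omega> l. V l \<omega>)) = exp_neg (\<Sum>l. k w l)" .
  qed
  also have "\<dots> = expectation (\<lambda>\<omega>. exp_neg (\<Sum>l. k (W \<omega>) l))"
    by (subst integral_distr) auto
  finally show ?thesis .
qed

section \<open>The Laplace transform of the fading power\<close>

text \<open>For negative \<open>x\<close> the exponent \<open>ennreal (c * x)\<close> is truncated
  to 0, which does no harm because the density vanishes there.\<close>

lemma nn_integral_exponential_laplace:
  fixes \<mu> c :: real
  assumes "0 < \<mu>" "0 \<le> c"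
  shows "(\<integral>\<^sup>+x. ennreal (exponential_density (1 / \<mu>) x) * ennreal (exp_neg (ennreal (c * x))) \<partial>lborel) =
    ennreal (1 / (1 + \<mu> * c))"
proof -
  have "(\<integral>\<^sup>+x. ennreal (exponential_density (1 / \<mu>) x) * ennreal (exp_neg (ennreal (c * x))) \<partial>lborel) =
      (\<integral>\<^sup>+x. ennreal (1 / \<mu>) * (ennreal (exp (- x * (1 / \<mu> + c))) * indicator {0<..} x) \<partial>lborel)"
  proof (intro nn_integral_cong_AE, use AE_lborel_singleton[of 0] in eventually_elim)
    fix x :: real assume "x \<noteq> 0"
    then show "ennreal (exponential_density (1 / \<mu>) x) * ennreal (exp_neg (ennreal (c * x))) =
        ennreal (1 / \<mu>) * (ennreal (exp (- x * (1 / \<mu> + c))) * indicator {0<..} x)"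
      using assms
      by (auto simp: exponential_density_def ennreal_mult[symmetric] exp_add[symmetric] algebra_simps
               split: split_indicator)
  qed
  also have "\<dots> = ennreal (1 / \<mu>) * ennreal (1 / (1 / \<mu> + c))"
    using nn_integral_exp_atLeast[of "1 / \<mu> + c"] assms
    by (subst nn_integral_cmult) (simp_all add: add_pos_nonneg)
  also have "\<dots> = ennreal (1 / (1 + \<mu> * c))"
    using assms by (auto simp: ennreal_mult[symmetric] field_simps)
  finally show ?thesis .
qed

lemma (in prob_space) expectation_exponential_laplace:
  assumes X: "distributed M lborel X (exponential_density (1 / \<mu>))" and "0 < \<mu>" "0 \<le> c"
  shows "expectation (\<lambda>\<omega>. exp_neg (ennreal (c * X \<omega>))) = 1 / (1 + \<mu> * c)"
proof -
  have [measurable]: "X \<in> borel_measurable M"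
    using distributed_measurable[OF X] by simp
  have "(\<integral>\<^sup>+\<omega>. ennreal (exp_neg (ennreal (c * X \<omega>))) \<partial>M) = ennreal (1 / (1 + \<mu> * c))"
    unfolding nn_integral_exponential_laplace[OF assms(2,3), symmetric]
    by (rule distributed_nn_integral[OF X, symmetric]) measurable
  then show ?thesis
    using assms by (intro integral_eq_nn_integral[THEN trans]) auto
qed

section \<open>Laplace transforms of the marks\<close>

text \<open>For \<open>t \<ge> 0\<close> this is the Laplace transform at \<open>t\<close> of gain
  times fading power of one interferer.\<close>

definition mark_laplace :: "vcell_params \<Rightarrow> real \<Rightarrow> real" where
  "mark_laplace P t = (\<Sum>n\<in>{1, 2}. gain_prob P n / (1 + fading_mean P * t * gain_val P n))"

text \<open>The logarithm turns the product of mark transforms over the points into a sum over the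
  points. For \<open>t \<ge> 0\<close> the argument of \<open>ennreal\<close> is nonnegative, so
  nothing is truncated.\<close>

definition mark_exponent :: "vcell_params \<Rightarrow> real \<Rightarrow> ennreal" where
  "mark_exponent P t = ennreal (- ln (mark_laplace P t))"

lemma measurable_mark_exponent [measurable]: "mark_exponent P \<in> borel_measurable borel"
  unfolding mark_exponent_def mark_laplace_def by measurable

context
  fixes P assumes valid: "valid_params P"
begin

lemma gain_prob_nonneg: "0 \<le> gain_prob P n"
  using valid by (auto simp: gain_prob_def valid_params_def field_simps)

lemma gain_prob_le_1: "gain_prob P n \<le> 1"
  using valid by (auto simp: gain_prob_def valid_params_def field_simps)

lemma gain_val_pos: "0 < gain_val P n"
  using valid by (auto simp: gain_val_def valid_params_def)

text \<open>Strict positivity comes from the main lobe: at beamwidth 2 \<pi> the sidelobe has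
  probability 0, whereas the main lobe probability is always positive.\<close>

lemma mark_laplace_pos: "0 \<le> t \<Longrightarrow> 0 < mark_laplace P t"
proof -
  assume t: "0 \<le> t"
  have "0 < gain_prob P 1 / (1 + fading_mean P * t * gain_val P 1)"
    using t valid gain_val_pos[of 1]
    by (intro divide_pos_pos add_pos_nonneg) (auto simp: valid_params_def gain_prob_def)
  moreover have "0 \<le> gain_prob P 2 / (1 + fading_mean P * t * gain_val P 2)"
    using t valid gain_val_pos[of 2] gain_prob_nonneg[of 2] by (auto simp: valid_params_def)
  ultimately show ?thesis by (simp add: mark_laplace_def)
qed

text \<open>Here \<open>Hfun\<close> enters: the two gain probabilities sum to 1, so the 1 can be
  distributed over the mixture.\<close>

lemma one_minus_mark_laplace:
  "1 - mark_laplace P t = (\<Sum>n\<in>{1, 2}. gain_prob P n * Hfun (fading_mean P * t * gain_val P n))"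
  by (simp add: mark_laplace_def Hfun_def right_diff_distrib) (simp add: gain_prob_def)

lemma Hfun_nonneg: "0 \<le> x \<Longrightarrow> 0 \<le> Hfun x"
  by (simp add: Hfun_def)

lemma mark_laplace_le_1: "0 \<le> t \<Longrightarrow> mark_laplace P t \<le> 1"
proof -
  assume "0 \<le> t"
  then have "0 \<le> (\<Sum>n\<in>{1, 2}. gain_prob P n * Hfun (fading_mean P * t * gain_val P n))"
    using gain_prob_nonneg less_imp_le[OF gain_val_pos] valid
    by (intro sum_nonneg mult_nonneg_nonneg Hfun_nonneg) (auto simp: valid_params_def)
  then show ?thesis unfolding one_minus_mark_laplace[symmetric] by simp
qed

lemma exp_neg_mark_exponent: "0 \<le> t \<Longrightarrow> exp_neg (mark_exponent P t) = mark_laplace P t"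
  using mark_laplace_pos[of t] mark_laplace_le_1[of t]
  by (simp add: mark_exponent_def ln_le_zero_iff)

lemma mark_exponent_0 [simp]: "mark_exponent P 0 = 0"
  by (simp add: mark_exponent_def mark_laplace_def) (simp add: gain_prob_def)

text \<open>The product law of gain and fading power allows the fading to be integrated first at
  each gain value; the Bernoulli law then mixes the two results.\<close>

lemma expectation_mark_laplace:
  assumes "prob_space Q"
    and G: "distr Q borel G = gain_law P" and [measurable]: "G \<in> borel_measurable Q"
    and X: "distributed Q lborel X (exponential_density (1 / fading_mean P))"
    and indep: "prob_space.indep_var Q borel G borel X" and "0 \<le> t"
  shows "(\<integral>\<omega>. exp_neg (ennreal t * ennreal (G \<omega> * X \<omega>)) \<partial>Q) = mark_laplace P t"
proof -
  interpret prob_space Q by fact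
  have \<mu>: "0 < fading_mean P" using valid by (simp add: valid_params_def)
  have [measurable]: "X \<in> borel_measurable Q"
    using distributed_measurable[OF X] by simp
  interpret X: prob_space "distr Q borel X" by (rule prob_space_distr) measurable
  let ?f = "\<lambda>(g, x). ennreal (exp_neg (ennreal t * ennreal (g * x)))"
  have inner: "(\<integral>\<^sup>+x. ?f (gain_val P n, x) \<partial>distr Q borel X) =
      ennreal (1 / (1 + fading_mean P * t * gain_val P n))" for n
  proof -
    have "(\<integral>\<^sup>+x. ?f (gain_val P n, x) \<partial>distr Q borel X) =
       (\<integral>\<^sup>+\<omega>. ennreal (exp_neg (ennreal (t * gain_val P n * X \<omega>))) \<partial>Q)"
      using \<open>0 \<le> t\<close> by (subst nn_integral_distr) (auto simp: ennreal_mult'[symmetric] mult.assoc)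
    also have "\<dots> = ennreal (1 / (1 + fading_mean P * (t * gain_val P n)))"
      using \<open>0 \<le> t\<close> gain_val_pos[of n]
      by (subst nn_integral_exponential_laplace[OF \<mu>, symmetric])
         (auto intro!: distributed_nn_integral[OF X, symmetric])
    finally show ?thesis by (simp add: mult.assoc)
  qed
  have "(\<integral>\<^sup>+\<omega>. ennreal (exp_neg (ennreal t * ennreal (G \<omega> * X \<omega>))) \<partial>Q) =
      integral\<^sup>N (distr Q (borel \<Otimes>\<^sub>M borel) (\<lambda>\<omega>. (G \<omega>, X \<omega>))) ?f"
    by (subst nn_integral_distr) auto
  also have "distr Q (borel \<Otimes>\<^sub>M borel) (\<lambda>\<omega>. (G \<omega>, X \<omega>)) = distr Q borel G \<Otimes>\<^sub>M distr Q borel X"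
    using indep by (simp add: indep_var_distribution_eq)
  also have "integral\<^sup>N (distr Q borel G \<Otimes>\<^sub>M distr Q borel X) ?f =
      (\<integral>\<^sup>+g. (\<integral>\<^sup>+x. ?f (g, x) \<partial>distr Q borel X) \<partial>gain_law P)"
    unfolding G[symmetric]
    by (subst X.nn_integral_fst[symmetric])
       (auto simp: measurable_cong_sets[OF sets_pair_measure_cong[OF sets_distr sets_distr] refl])
  also have "\<dots> = (\<integral>\<^sup>+main. (\<integral>\<^sup>+x. ?f (gain_val P (if main then 1 else 2), x) \<partial>distr Q borel X)
      \<partial>measure_pmf (bernoulli_pmf (gain_prob P 1)))"
    unfolding gain_law_def by (subst nn_integral_distr) (auto intro!: nn_integral_cong)
  also have "\<dots> = ennreal (gain_prob P 1) * ennreal (1 / (1 + fading_mean P * t * gain_val P 1)) +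
      ennreal (1 - gain_prob P 1) * ennreal (1 / (1 + fading_mean P * t * gain_val P 2))"
    unfolding inner using gain_prob_nonneg[of 1] gain_prob_le_1[of 1]
    by (subst nn_integral_bernoulli_pmf) (auto simp: mult.commute)
  also have "\<dots> = ennreal (mark_laplace P t)"
  proof -
    have "1 - gain_prob P 1 = gain_prob P 2" by (simp add: gain_prob_def)
    then show ?thesis
      using gain_prob_nonneg[of 1] gain_prob_nonneg[of 2] gain_val_pos[of 1] gain_val_pos[of 2] \<mu> \<open>0 \<le> t\<close>
      by (simp add: mark_laplace_def ennreal_mult[symmetric] ennreal_plus[symmetric] del: ennreal_plus)
  qed
  finally show ?thesis
    using mark_laplace_pos[OF \<open>0 \<le> t\<close>] by (intro integral_eq_nn_integral[THEN trans]) auto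
qed

text \<open>One computation for both kinds of interferers, with \<open>q\<close> the LOS probability
  or its complement. Nonnegativity of \<open>q\<close> is asked only on positive radii because the
  complement is negative for negative arguments.\<close>

lemma nn_integral_mark_exponent_radial:
  fixes q :: "real \<Rightarrow> real"
  assumes [measurable]: "q \<in> borel_measurable borel"
    and "\<And>x. 0 < x \<Longrightarrow> 0 \<le> q x" "0 \<le> s" "0 \<le> C" "0 < \<rho>"
  shows "(\<integral>\<^sup>+x. ennreal (1 - exp_neg (mark_exponent P (s * (C * norm x powr (- \<alpha>)))))
        \<partial>density (lborel :: (real ^ 2) measure) (\<lambda>x. ennreal (ap_density P * q (norm x)) * indicator {x. norm x > \<rho>} x)) =
    ennreal (2 * pi * ap_density P) * (\<Sum>n\<in>{1, 2}. ennreal (gain_prob P n) *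
     (\<integral>\<^sup>+x\<in>{\<rho>..}. ennreal (Hfun (fading_mean P * s * gain_val P n * C * x powr (- \<alpha>)) * q x * x) \<partial>lborel))"
proof -
  have [measurable]: "Hfun \<in> borel_measurable borel" unfolding Hfun_def by measurable
  have pos: "0 < ap_density P" "0 < fading_mean P" using valid by (auto simp: valid_params_def)
  let ?H = "\<lambda>n x. Hfun (fading_mean P * s * gain_val P n * C * x powr (- \<alpha>))"
  have H: "0 \<le> ?H n x" for n x
    using pos assms gain_val_pos[of n] by (intro Hfun_nonneg) auto
  have "(\<integral>\<^sup>+x. ennreal (1 - exp_neg (mark_exponent P (s * (C * norm x powr (- \<alpha>)))))
        \<partial>density (lborel :: (real ^ 2) measure) (\<lambda>x. ennreal (ap_density P * q (norm x)) * indicator {x. norm x > \<rho>} x)) =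
    (\<integral>\<^sup>+x. (\<lambda>y. ennreal (ap_density P * q y) * indicator {\<rho><..} y *
        ennreal (1 - exp_neg (mark_exponent P (s * (C * y powr (- \<alpha>)))))) (norm x) \<partial>(lborel :: (real ^ 2) measure))"
    by (subst nn_integral_density) (auto intro!: nn_integral_cong split: split_indicator)
  also have "\<dots> = (\<integral>\<^sup>+y\<in>{0..}. ennreal (2 * pi * y) * (ennreal (ap_density P * q y) * indicator {\<rho><..} y *
        ennreal (1 - exp_neg (mark_exponent P (s * (C * y powr (- \<alpha>)))))) \<partial>lborel)"
    by (rule nn_integral_radial) measurable
  also have "\<dots> = (\<integral>\<^sup>+y. ennreal (2 * pi * ap_density P) * (\<Sum>n\<in>{1, 2}. ennreal (gain_prob P n) *
      (ennreal (?H n y * q y * y) * indicator {\<rho>..} y)) \<partial>lborel)"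
  \<comment> \<open>The interferers have radii strictly above \<rho>, whereas the integrals in V
    start at \<rho> itself; the difference is one null point.\<close>
  proof (intro nn_integral_cong_AE, use AE_lborel_singleton[of \<rho>] in eventually_elim)
    fix y assume "y \<noteq> \<rho>"
    show "ennreal (2 * pi * y) * (ennreal (ap_density P * q y) * indicator {\<rho><..} y *
        ennreal (1 - exp_neg (mark_exponent P (s * (C * y powr (- \<alpha>)))))) * indicator {0..} y =
      ennreal (2 * pi * ap_density P) * (\<Sum>n\<in>{1, 2}. ennreal (gain_prob P n) *
      (ennreal (?H n y * q y * y) * indicator {\<rho>..} y))"
    proof (cases "y > \<rho>")
      case True
      have t: "0 \<le> s * (C * y powr (- \<alpha>))" using assms by simp
      have e: "1 - exp_neg (mark_exponent P (s * (C * y powr (- \<alpha>)))) = (\<Sum>n\<in>{1, 2}. gain_prob P n * ?H n y)"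
        unfolding exp_neg_mark_exponent[OF t] one_minus_mark_laplace by (simp add: ac_simps)
      have nn: "0 \<le> (\<Sum>n\<in>{1, 2}. gain_prob P n * ?H n y)"
        by (intro sum_nonneg mult_nonneg_nonneg gain_prob_nonneg H)
      have y: "0 < y" "0 \<le> q y" using True assms by auto
      have "ennreal (2 * pi * y) * (ennreal (ap_density P * q y) * indicator {\<rho><..} y *
          ennreal (1 - exp_neg (mark_exponent P (s * (C * y powr (- \<alpha>)))))) * indicator {0..} y =
        ennreal (2 * pi * ap_density P * (\<Sum>n\<in>{1, 2}. gain_prob P n * (?H n y * q y * y)))"
        using True y nn pos unfolding e
        by (simp add: ennreal_mult[symmetric] algebra_simps del: sum.insert)
           (simp add: algebra_simps)
      also have "\<dots> = ennreal (2 * pi * ap_density P) * (\<Sum>n\<in>{1, 2}. ennreal (gain_prob P n) *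
          (ennreal (?H n y * q y * y) * indicator {\<rho>..} y))"
        using True y pos H gain_prob_nonneg
        by (simp add: ennreal_mult ennreal_plus)
      finally show ?thesis .
    qed (use \<open>y \<noteq> \<rho>\<close> in auto)
  qed
  also have "\<dots> = ennreal (2 * pi * ap_density P) * (\<Sum>n\<in>{1, 2}. ennreal (gain_prob P n) *
     (\<integral>\<^sup>+x\<in>{\<rho>..}. ennreal (?H n x * q x * x) \<partial>lborel))"
    by (simp add: nn_integral_cmult nn_integral_add)
  finally show ?thesis .
qed

end

section \<open>The conditional capacity\<close>

text \<open>Setting the gain to 0 inside the closed disc lets the interference be summed over all
  indices, as the independence of marks across indices requires, instead of over random index
  sets.\<close>

definition path_gain :: "vcell_params \<Rightarrow> real \<Rightarrow> (real ^ 2) \<times> bool \<Rightarrow> real" where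
  "path_gain P \<rho> = (\<lambda>(x, los). if norm x > \<rho>
     then (if los then los_icpt P * norm x powr (- los_exp P) else nlos_icpt P * norm x powr (- nlos_exp P))
     else 0)"

lemma measurable_path_gain [measurable]:
  "path_gain P \<rho> \<in> borel_measurable (borel \<Otimes>\<^sub>M count_space UNIV)"
  unfolding path_gain_def split_beta' by measurable

lemma path_gain_nonneg: "valid_params P \<Longrightarrow> 0 \<le> path_gain P \<rho> z"
  by (auto simp: path_gain_def valid_params_def split: prod.split)

lemma nn_integral_interferers:
  fixes f g :: "nat \<Rightarrow> ennreal"
  shows "(\<integral>\<^sup>+l. f l \<partial>count_space (los_interferers P N \<omega>)) + (\<integral>\<^sup>+l. g l \<partial>count_space (nlos_interferers P N \<omega>)) =
    (\<Sum>l. if ap_dist N l \<omega> > ap_dist N (cell_size P - 1) \<omega> then (if ap_los N l \<omega> then f l else g l) else 0)"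
  by (simp add: nn_integral_count_space_indicator nn_integral_count_space_nat suminf_add)
     (auto intro!: suminf_cong simp: los_interferers_def nlos_interferers_def)

lemma interference_suminf:
  assumes "valid_params P"
  shows "interference P N \<omega> = (\<Sum>l. ennreal (path_gain P (ap_dist N (cell_size P - 1) \<omega>) (ap_pos N l \<omega>, ap_los N l \<omega>)) *
    ennreal (ap_gain N l \<omega> * ap_fade N l \<omega>))"
proof -
  \<comment> \<open>Only the path gain is nonnegative at every point of the sample space, so gain
    times fading stays under a single \<open>ennreal\<close>.\<close>
  have *: "ennreal (g * c * d * x) = ennreal (c * d) * ennreal (g * x)" if "0 < c" "0 \<le> d" for g c d x :: real
    using that by (subst ennreal_mult'[symmetric]) (auto simp: ac_simps)
  show ?thesis
    using assms unfolding interference_def nn_integral_interferers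
    by (intro suminf_cong) (auto simp: path_gain_def ap_dist_def * valid_params_def)
qed

lemma suminf_if_less:
  fixes a b :: "nat \<Rightarrow> ennreal"
  assumes "\<And>l. l < K \<Longrightarrow> b l = 0"
  shows "(\<Sum>l. if l < K then a l else b l) = (\<Sum>l<K. a l) + (\<Sum>l. b l)"
proof -
  have "(\<Sum>l. if l < K then a l else b l) = (\<Sum>l. (if l < K then a l else 0) + b l)"
    using assms by (intro suminf_cong) auto
  also have "\<dots> = (\<Sum>l. if l < K then a l else 0) + (\<Sum>l. b l)"
    by (intro suminf_add[symmetric]) auto
  also have "(\<Sum>l. if l < K then a l else 0) = (\<Sum>l<K. a l)"
    by (subst suminf_finite[of "{..<K}"]) auto
  finally show ?thesis .
qed

lemma measurable_V_los [measurable]: "V_los P \<rho> \<in> borel_measurable borel"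
  unfolding V_los_def Hfun_def los_prob_def by measurable

lemma measurable_V_nlos [measurable]: "V_nlos P \<rho> \<in> borel_measurable borel"
  unfolding V_nlos_def Hfun_def los_prob_def by measurable

locale conditional_network =
  fixes P :: vcell_params and N :: "'w network" and r :: "nat \<Rightarrow> real" and Q :: "'w measure"
  assumes valid: "valid_params P" and r: "r \<in> dist_dom P" and cm: "conditional_model P N r Q"
begin

sublocale prob_space Q
  using cm by (simp add: conditional_model_def)

lemma conditional_model_measurable:
  shows "ap_pos N l \<in> borel_measurable Q" "ap_los N l \<in> measurable Q (count_space UNIV)"
    "ap_gain N l \<in> borel_measurable Q" "ap_fade N l \<in> borel_measurable Q"
proof -
  have W: "(\<lambda>\<omega> l. (ap_pos N l \<omega>, ap_los N l \<omega>)) \<in> measurable Q (PiM UNIV (\<lambda>_. borel \<Otimes>\<^sub>M count_space UNIV))"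
    and V: "(\<lambda>\<omega> l. (ap_gain N l \<omega>, ap_fade N l \<omega>)) \<in> measurable Q (PiM UNIV (\<lambda>_. borel \<Otimes>\<^sub>M borel))"
    using cm by (auto simp: conditional_model_def indep_elements_def)
  have "(\<lambda>\<omega>. (ap_pos N l \<omega>, ap_los N l \<omega>)) \<in> measurable Q (borel \<Otimes>\<^sub>M count_space UNIV)"
    using measurable_compose[OF W measurable_component_singleton[of l]] by simp
  from measurable_compose[OF this measurable_fst] measurable_compose[OF this measurable_snd]
  show "ap_pos N l \<in> borel_measurable Q" "ap_los N l \<in> measurable Q (count_space UNIV)" by simp_all
  have "(\<lambda>\<omega>. (ap_gain N l \<omega>, ap_fade N l \<omega>)) \<in> measurable Q (borel \<Otimes>\<^sub>M borel)"
    using measurable_compose[OF V measurable_component_singleton[of l]] by simp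
  from measurable_compose[OF this measurable_fst] measurable_compose[OF this measurable_snd]
  show "ap_gain N l \<in> borel_measurable Q" "ap_fade N l \<in> borel_measurable Q" by simp_all
qed

lemmas [measurable] = conditional_model_measurable

lemma measurable_ap_dist [measurable]: "ap_dist N l \<in> borel_measurable Q"
  unfolding ap_dist_def by measurable

lemma measurable_interference [measurable]: "interference P N \<in> borel_measurable Q"
  unfolding interference_suminf[OF valid] path_gain_def split_beta' by (simp cong: measurable_cong)

lemma measurable_sinr [measurable]: "sinr P N \<in> borel_measurable Q"
  unfolding sinr_def by measurable

abbreviation "K \<equiv> cell_size P"

abbreviation "\<rho> \<equiv> r (K - 1)"

abbreviation "link k \<equiv> main_gain P * los_icpt P * r k powr (- los_exp P)"

abbreviation "signal \<omega> \<equiv> \<Sum>k<K. link k * ap_fade N k \<omega>"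

lemma radius_pos: "0 < \<rho>"
  using r valid by (auto simp: dist_dom_def valid_params_def PiE_def Pi_def)

lemma link_nonneg: "0 \<le> link k"
  using valid by (simp add: valid_params_def)

lemma fading_mean_pos: "0 < fading_mean P"
  using valid by (simp add: valid_params_def)

text \<open>The bound by \<rho> is recorded because it places every serving access point in the
  closed disc, where \<open>path_gain P \<rho>\<close> vanishes.\<close>

lemma AE_serving_dists: "AE \<omega> in Q. (\<forall>k<K. ap_dist N k \<omega> = r k \<and> r k \<le> \<rho>) \<and> ap_dist N (K - 1) \<omega> = \<rho>"
proof -
  have "AE \<omega> in Q. serving_dists P N \<omega> = r" using cm by (simp add: conditional_model_def)
  then show ?thesis
  proof eventually_elim
    case (elim \<omega>)
    have K: "K - 1 < K" using valid by (simp add: valid_params_def)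
    have "ap_dist N k \<omega> = r k" if "k < K" for k
      using fun_cong[OF elim, of k] that by (simp add: serving_dists_def)
    moreover have "r k \<le> \<rho>" if "k < K" for k
      using r that K by (auto simp: dist_dom_def mono_on_def)
    ultimately show ?case using K by blast
  qed
qed

lemma fade_distributed: "distributed Q lborel (ap_fade N l) (exponential_density (1 / fading_mean P))"
  using cm by (simp add: conditional_model_def)

lemma AE_fade_nonneg: "AE \<omega> in Q. \<forall>l. 0 \<le> ap_fade N l \<omega>"
proof (subst AE_all_countable, intro allI)
  fix l
  have "AE x in density lborel (\<lambda>x. ennreal (exponential_density (1 / fading_mean P) x)). 0 \<le> x"
    by (subst AE_density) (auto simp: exponential_density_def)
  then have "AE x in distr Q lborel (ap_fade N l). 0 \<le> x"
    unfolding distributed_distr_eq_density[OF fade_distributed] .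
  then show "AE \<omega> in Q. 0 \<le> ap_fade N l \<omega>"
    by (subst (asm) AE_distr_iff) auto
qed

text \<open>The integral equals the fading mean, which is nonzero, whereas the integral of a
  non-integrable function is 0 by default.\<close>

lemma integrable_fade: "integrable Q (ap_fade N l)"
  using exponential_distributed_expectation[OF _ fade_distributed[of l]] fading_mean_pos
    not_integrable_integral_eq[of Q "ap_fade N l"] by auto

text \<open>With the marks averaged out, only positions and LOS flags remain. The sum splits over
  the two independent Poisson processes, and the radial computation identifies their
  exponents.\<close>

lemma expectation_mark_exponent_sum:
  assumes s: "0 \<le> s"
  shows "expectation (\<lambda>\<omega>. exp_neg (\<Sum>l. mark_exponent P (s * path_gain P \<rho> (ap_pos N l \<omega>, ap_los N l \<omega>)))) =
    exp_neg (V_los P \<rho> s + V_nlos P \<rho> s)"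
proof -
  let ?h\<^sub>1 = "\<lambda>x :: real ^ 2. mark_exponent P (s * (los_icpt P * norm x powr (- los_exp P)))"
  let ?h\<^sub>2 = "\<lambda>x :: real ^ 2. mark_exponent P (s * (nlos_icpt P * norm x powr (- nlos_exp P)))"
  have [measurable]: "los_prob P \<in> borel_measurable borel" unfolding los_prob_def by measurable
  have sf: "sigma_finite_measure (los_intensity P \<rho>)" "sigma_finite_measure (nlos_intensity P \<rho>)"
    unfolding los_intensity_def nlos_intensity_def
    by (subst sigma_finite_measure.sigma_finite_iff_density_finite[OF sigma_finite_lborel]; auto split: split_indicator)+
  have m: "?h\<^sub>1 \<in> borel_measurable (los_intensity P \<rho>)" "?h\<^sub>2 \<in> borel_measurable (nlos_intensity P \<rho>)"
    unfolding los_intensity_def nlos_intensity_def by simp_all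
  have pm: "(\<lambda>\<omega>. \<Sum>l. mark_exponent P (s * path_gain P \<rho> (ap_pos N l \<omega>, ap_los N l \<omega>))) \<in> borel_measurable Q"
    by measurable
  have pp: "poisson_process Q (los_intensity P \<rho>) (ap_pos N) (los_interferers P N)"
      "poisson_process Q (nlos_intensity P \<rho>) (ap_pos N) (nlos_interferers P N)"
      "indep_processes Q (los_intensity P \<rho>) (nlos_intensity P \<rho>) (ap_pos N) (los_interferers P N) (nlos_interferers P N)"
    using cm by (auto simp: conditional_model_def)
  have "expectation (\<lambda>\<omega>. exp_neg (\<Sum>l. mark_exponent P (s * path_gain P \<rho> (ap_pos N l \<omega>, ap_los N l \<omega>)))) =
    expectation (\<lambda>\<omega>. exp_neg (\<integral>\<^sup>+l. ?h\<^sub>1 (ap_pos N l \<omega>) \<partial>count_space (los_interferers P N \<omega>)) *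
      exp_neg (\<integral>\<^sup>+l. ?h\<^sub>2 (ap_pos N l \<omega>) \<partial>count_space (nlos_interferers P N \<omega>)))"
  proof (intro integral_cong_AE)
    \<comment> \<open>The interferer sets are cut at the random radius of the last serving access
      point, which is almost surely \<rho>; all other indices have path gain 0 and so exponent
      0.\<close>
    show "AE \<omega> in Q. exp_neg (\<Sum>l. mark_exponent P (s * path_gain P \<rho> (ap_pos N l \<omega>, ap_los N l \<omega>))) =
      exp_neg (\<integral>\<^sup>+l. ?h\<^sub>1 (ap_pos N l \<omega>) \<partial>count_space (los_interferers P N \<omega>)) *
      exp_neg (\<integral>\<^sup>+l. ?h\<^sub>2 (ap_pos N l \<omega>) \<partial>count_space (nlos_interferers P N \<omega>))"
      using AE_serving_dists
    proof eventually_elim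
      case (elim \<omega>)
      then show ?case
        unfolding exp_neg_add[symmetric] nn_integral_interferers
        by (intro arg_cong[where f = exp_neg] suminf_cong)
           (auto simp: path_gain_def ap_dist_def mark_exponent_0[OF valid])
    qed
  qed (use pm measurable_point_sum[OF pp(1) m(1)] measurable_point_sum[OF pp(2) m(2)] in
       \<open>auto intro!: borel_measurable_times measurable_compose[OF _ measurable_exp_neg]\<close>)
  also have "\<dots> = exp_neg (\<integral>\<^sup>+x. ennreal (1 - exp_neg (?h\<^sub>1 x)) \<partial>los_intensity P \<rho>) *
      exp_neg (\<integral>\<^sup>+x. ennreal (1 - exp_neg (?h\<^sub>2 x)) \<partial>nlos_intensity P \<rho>)"
    by (rule poisson_laplace_functional_pair[OF pp sf m])
  also have "(\<integral>\<^sup>+x. ennreal (1 - exp_neg (?h\<^sub>1 x)) \<partial>los_intensity P \<rho>) = V_los P \<rho> s"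
    unfolding los_intensity_def V_los_def
    using valid s radius_pos
    by (intro nn_integral_mark_exponent_radial) (auto simp: los_prob_def valid_params_def)
  also have "(\<integral>\<^sup>+x. ennreal (1 - exp_neg (?h\<^sub>2 x)) \<partial>nlos_intensity P \<rho>) = V_nlos P \<rho> s"
    unfolding nlos_intensity_def V_nlos_def
    using valid s radius_pos
    by (intro nn_integral_mark_exponent_radial) (auto simp: los_prob_def valid_params_def)
  finally show ?thesis by (simp add: exp_neg_add)
qed

text \<open>The serving fading powers are marks of the indices below \<open>K\<close>, so one marked
  sum carries interference and signal together. Choosing \<theta> = 0 yields the transform of the
  interference alone, \<theta> = 1 the joint one.\<close>

lemma expectation_laplace_interference_signal:
  assumes s: "0 \<le> s" and \<theta>: "0 \<le> \<theta>"
  shows "expectation (\<lambda>\<omega>. exp_neg (ennreal s * interference P N \<omega>) * exp (- (\<theta> * s * signal \<omega>))) =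
    exp_neg (V_los P \<rho> s + V_nlos P \<rho> s) * (\<Prod>k<K. 1 / (1 + fading_mean P * (\<theta> * s * link k)))"
proof -
  \<comment> \<open>Serving weights can be the constants \<open>link l\<close> because the serving
    distances are almost surely \<open>r\<close>. The branch for \<open>l < K\<close> displaces no
    interference, the path gain being 0 there.\<close>
  define F where "F w l = (\<lambda>(g, x). if l < K then ennreal (\<theta> * s * link l * x)
      else ennreal (s * path_gain P \<rho> (w l)) * ennreal (g * x))"
    for w :: "nat \<Rightarrow> (real ^ 2) \<times> bool" and l :: nat
  \<comment> \<open>The logarithm is chosen so that \<open>exp_neg\<close> of it is the transform 1
    / (1 + \<mu> c) of an exponential fading power.\<close>
  define k where "k w l = (if l < K then ennreal (ln (1 + fading_mean P * (\<theta> * s * link l)))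
      else mark_exponent P (s * path_gain P \<rho> (w l)))"
    for w :: "nat \<Rightarrow> (real ^ 2) \<times> bool" and l :: nat
  let ?A = "PiM UNIV (\<lambda>_. borel \<Otimes>\<^sub>M count_space UNIV) :: (nat \<Rightarrow> (real ^ 2) \<times> bool) measure"
  have [measurable]: "(\<lambda>w. path_gain P \<rho> (w l)) \<in> borel_measurable ?A" for l
    by (rule measurable_compose[OF _ measurable_path_gain]) (rule measurable_component_singleton, simp)
  have c: "0 \<le> \<theta> * s * link l" for l using s \<theta> link_nonneg by simp
  have F_meas: "(\<lambda>(w, m). F w l m) \<in> borel_measurable (?A \<Otimes>\<^sub>M (borel \<Otimes>\<^sub>M borel))" for l
    unfolding F_def split_beta' by measurable
  have k_meas: "(\<lambda>w. k w l) \<in> borel_measurable ?A" for l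
    unfolding k_def by measurable
  have Fk: "expectation (\<lambda>\<omega>. exp_neg (F w l (ap_gain N l \<omega>, ap_fade N l \<omega>))) = exp_neg (k w l)" for w l
  proof (cases "l < K")
    case True
    have 1: "1 \<le> 1 + fading_mean P * (\<theta> * s * link l)"
      using c fading_mean_pos by (simp add: mult_nonneg_nonneg less_imp_le)
    show ?thesis
      using True 1 expectation_exponential_laplace[OF fade_distributed fading_mean_pos c]
      by (simp add: F_def k_def exp_minus inverse_eq_divide)
  next
    case False
    have "0 \<le> s * path_gain P \<rho> (w l)" using s path_gain_nonneg[OF valid] by simp
    then show ?thesis
      using False expectation_mark_laplace[OF valid prob_space_axioms, of "ap_gain N l" "ap_fade N l"] cm
      by (simp add: F_def k_def exp_neg_mark_exponent[OF valid] conditional_model_def conditional_model_measurable)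
  qed
  have ie: "indep_elements Q ?A (\<lambda>\<omega> l. (ap_pos N l \<omega>, ap_los N l \<omega>))
       (PiM UNIV (\<lambda>_. borel \<Otimes>\<^sub>M borel)) (\<lambda>\<omega> l. (ap_gain N l \<omega>, ap_fade N l \<omega>))"
    and iv: "indep_vars (\<lambda>_. borel \<Otimes>\<^sub>M borel) (\<lambda>l \<omega>. (ap_gain N l \<omega>, ap_fade N l \<omega>)) UNIV"
    using cm by (simp_all add: conditional_model_def)
  have "expectation (\<lambda>\<omega>. exp_neg (ennreal s * interference P N \<omega>) * exp (- (\<theta> * s * signal \<omega>))) =
      expectation (\<lambda>\<omega>. exp_neg (\<Sum>l. F (\<lambda>l. (ap_pos N l \<omega>, ap_los N l \<omega>)) l (ap_gain N l \<omega>, ap_fade N l \<omega>)))"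
  proof (intro integral_cong_AE)
    show "AE \<omega> in Q. exp_neg (ennreal s * interference P N \<omega>) * exp (- (\<theta> * s * signal \<omega>)) =
      exp_neg (\<Sum>l. F (\<lambda>l. (ap_pos N l \<omega>, ap_los N l \<omega>)) l (ap_gain N l \<omega>, ap_fade N l \<omega>))"
      using AE_serving_dists AE_fade_nonneg
    proof eventually_elim
      case (elim \<omega>)
      have 0: "path_gain P \<rho> (ap_pos N l \<omega>, ap_los N l \<omega>) = 0" if "l < K" for l
        using elim(1) that by (auto simp: path_gain_def ap_dist_def)
      have "(\<Sum>l. F (\<lambda>l. (ap_pos N l \<omega>, ap_los N l \<omega>)) l (ap_gain N l \<omega>, ap_fade N l \<omega>)) =
          (\<Sum>l<K. ennreal (\<theta> * s * link l * ap_fade N l \<omega>)) +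
          (\<Sum>l. ennreal (s * path_gain P \<rho> (ap_pos N l \<omega>, ap_los N l \<omega>)) * ennreal (ap_gain N l \<omega> * ap_fade N l \<omega>))"
        unfolding F_def prod.case by (rule suminf_if_less) (simp only: 0 mult_zero_right mult_zero_left ennreal_0)
      also have "(\<Sum>l<K. ennreal (\<theta> * s * link l * ap_fade N l \<omega>)) = ennreal (\<theta> * s * signal \<omega>)"
        using elim(2) mult_nonneg_nonneg[OF c] by (subst sum_ennreal) (simp_all add: sum_distrib_left mult.assoc)
      also have "(\<Sum>l. ennreal (s * path_gain P \<rho> (ap_pos N l \<omega>, ap_los N l \<omega>)) * ennreal (ap_gain N l \<omega> * ap_fade N l \<omega>)) =
          ennreal s * interference P N \<omega>"
        unfolding interference_suminf[OF valid] ennreal_suminf_cmult[symmetric]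
        using elim(1) s path_gain_nonneg[OF valid] by (simp add: ennreal_mult mult.assoc)
      finally show ?case
        using elim(2) s \<theta> link_nonneg
        by (simp add: exp_neg_add sum_nonneg)
    qed
  qed (unfold F_def, measurable)
  also have "\<dots> = expectation (\<lambda>\<omega>. exp_neg (\<Sum>l. k (\<lambda>l. (ap_pos N l \<omega>, ap_los N l \<omega>)) l))"
    by (rule expectation_exp_neg_marked_sum[OF ie iv F_meas k_meas Fk])
  also have "\<dots> = expectation (\<lambda>\<omega>. (\<Prod>k<K. 1 / (1 + fading_mean P * (\<theta> * s * link k))) *
      exp_neg (\<Sum>l. mark_exponent P (s * path_gain P \<rho> (ap_pos N l \<omega>, ap_los N l \<omega>))))"
  proof (intro integral_cong_AE)
    show "AE \<omega> in Q. exp_neg (\<Sum>l. k (\<lambda>l. (ap_pos N l \<omega>, ap_los N l \<omega>)) l) =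
      (\<Prod>k<K. 1 / (1 + fading_mean P * (\<theta> * s * link k))) *
      exp_neg (\<Sum>l. mark_exponent P (s * path_gain P \<rho> (ap_pos N l \<omega>, ap_los N l \<omega>)))"
      using AE_serving_dists
    proof eventually_elim
      case (elim \<omega>)
      have 0: "path_gain P \<rho> (ap_pos N l \<omega>, ap_los N l \<omega>) = 0" if "l < K" for l
        using elim that by (auto simp: path_gain_def ap_dist_def)
      have 1: "1 \<le> 1 + fading_mean P * (\<theta> * s * link l)" for l
        using c[of l] fading_mean_pos by (simp add: mult_nonneg_nonneg less_imp_le)
      have "exp_neg (\<Sum>l<K. ennreal (ln (1 + fading_mean P * (\<theta> * s * link l)))) =
          (\<Prod>k<K. 1 / (1 + fading_mean P * (\<theta> * s * link k)))"
        unfolding exp_neg_sum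
      proof (intro prod.cong refl)
        fix l
        show "exp_neg (ennreal (ln (1 + fading_mean P * (\<theta> * s * link l)))) = 1 / (1 + fading_mean P * (\<theta> * s * link l))"
          using 1[of l] by (subst exp_neg_ennreal) (simp_all add: exp_minus inverse_eq_divide)
      qed
      then show ?case
        unfolding k_def by (subst suminf_if_less) (simp_all add: 0[simplified] mark_exponent_0[OF valid] exp_neg_add)
    qed
  qed (unfold k_def, measurable)
  also have "\<dots> = (\<Prod>k<K. 1 / (1 + fading_mean P * (\<theta> * s * link k))) * exp_neg (V_los P \<rho> s + V_nlos P \<rho> s)"
    by (simp only: integral_mult_right_zero expectation_mark_exponent_sum[OF s])
  finally show ?thesis by (simp only: mult.commute)
qed

abbreviation "capacity_integrand s \<equiv> exp (- s * noise_power P) / s *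
  exp_neg (V_los P \<rho> s + V_nlos P \<rho> s) *
  (1 - (\<Prod>k<K. 1 - Hfun (fading_mean P * s * main_gain P * los_icpt P * r k powr (- los_exp P))))"

lemma capacity_integrand_nonneg: "0 < s \<Longrightarrow> 0 \<le> capacity_integrand s"
proof -
  assume s: "0 < s"
  have "0 \<le> fading_mean P * s * main_gain P * los_icpt P * r k powr (- los_exp P)" for k
    using s valid by (simp add: valid_params_def)
  moreover have "0 \<le> 1 - Hfun x \<and> 1 - Hfun x \<le> 1" if "0 \<le> x" for x
    using that by (auto simp: Hfun_def divide_simps)
  ultimately have "0 \<le> 1 - Hfun (fading_mean P * s * main_gain P * los_icpt P * r k powr (- los_exp P)) \<and>
      1 - Hfun (fading_mean P * s * main_gain P * los_icpt P * r k powr (- los_exp P)) \<le> 1" for k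
    by blast
  then have "(\<Prod>k<K. 1 - Hfun (fading_mean P * s * main_gain P * los_icpt P * r k powr (- los_exp P))) \<le> 1"
    by (intro prod_le_1)
  then show ?thesis using s by simp
qed

section \<open>The Frullani identity averaged over the network\<close>

text \<open>Infinite interference fits the identity: the SINR is 0 by convention, and for
  \<open>s > 0\<close> the factor \<open>exp_neg\<close> vanishes too. The bound by signal over
  noise serves the finiteness of the mean below.\<close>

lemma AE_ln_sinr:
  "AE \<omega> in Q. 0 \<le> sinr P N \<omega> \<and> sinr P N \<omega> \<le> signal \<omega> / noise_power P \<and>
     ennreal (ln (1 + sinr P N \<omega>)) =
     (\<integral>\<^sup>+s\<in>{0<..}. ennreal (exp (- s * noise_power P) / s *
        (exp_neg (ennreal s * interference P N \<omega>) * (1 - exp (- (s * signal \<omega>))))) \<partial>lborel)"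
  using AE_serving_dists AE_fade_nonneg
proof eventually_elim
  case (elim \<omega>)
  have n: "0 < noise_power P" using valid by (simp add: valid_params_def)
  have S: "0 \<le> signal \<omega>" using elim(2) link_nonneg by (auto intro!: sum_nonneg)
  have eq: "(\<Sum>k<K. main_gain P * los_icpt P * ap_dist N k \<omega> powr (- los_exp P) * ap_fade N k \<omega>) = signal \<omega>"
    using elim(1) by (intro sum.cong) auto
  show ?case
  proof (cases "interference P N \<omega> = \<top>")
    case True
    then have "exp_neg (ennreal s * interference P N \<omega>) = 0" if "0 < s" for s
      using that by (simp add: ennreal_mult_top)
    then have "(\<integral>\<^sup>+s\<in>{0<..}. ennreal (exp (- s * noise_power P) / s *
        (exp_neg (ennreal s * interference P N \<omega>) * (1 - exp (- (s * signal \<omega>))))) \<partial>lborel) = (\<integral>\<^sup>+s. 0 \<partial>(lborel::real measure))"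
      by (intro nn_integral_cong) (auto split: split_indicator)
    then show ?thesis using True S n by (simp add: sinr_def)
  next
    case False
    then obtain i where i: "0 \<le> i" "interference P N \<omega> = ennreal i"
      by (cases "interference P N \<omega>") auto
    have sinr: "sinr P N \<omega> = signal \<omega> / (i + noise_power P)"
      using i by (simp add: sinr_def eq)
    have "ennreal (ln (1 + sinr P N \<omega>)) =
      (\<integral>\<^sup>+s\<in>{0<..}. ennreal (exp (- s * (i + noise_power P)) / s * (1 - exp (- s * signal \<omega>))) \<partial>lborel)"
      unfolding sinr using i n S by (intro ln_frullani[symmetric]) auto
    also have "\<dots> = (\<integral>\<^sup>+s\<in>{0<..}. ennreal (exp (- s * noise_power P) / s *
        (exp_neg (ennreal s * interference P N \<omega>) * (1 - exp (- (s * signal \<omega>))))) \<partial>lborel)"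
      using i
      by (intro nn_integral_cong)
         (auto simp: ennreal_mult[symmetric] distrib_left exp_diff exp_minus field_simps split: split_indicator)
    finally show ?thesis
      using S i n unfolding sinr by (auto intro!: divide_left_mono mult_pos_pos add_nonneg_pos)
  qed
qed

lemma nn_integral_ln_sinr:
  "(\<integral>\<^sup>+\<omega>. ennreal (ln (1 + sinr P N \<omega>)) \<partial>Q) = (\<integral>\<^sup>+s\<in>{0<..}. ennreal (capacity_integrand s) \<partial>lborel)"
proof -
  let ?U = "\<lambda>s \<omega>. exp_neg (ennreal s * interference P N \<omega>)"
  let ?f = "\<lambda>s \<omega>. ennreal (exp (- s * noise_power P) / s * (?U s \<omega> * (1 - exp (- (s * signal \<omega>)))))"
  have sf: "sigma_finite_measure Q" by unfold_locales
  interpret pair_sigma_finite Q "lborel :: real measure"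
    by (intro pair_sigma_finite.intro sf lborel.sigma_finite_measure_axioms)
  have "(\<integral>\<^sup>+\<omega>. ennreal (ln (1 + sinr P N \<omega>)) \<partial>Q) = (\<integral>\<^sup>+\<omega>. (\<integral>\<^sup>+s. ?f s \<omega> * indicator {0<..} s \<partial>lborel) \<partial>Q)"
    using AE_ln_sinr by (intro nn_integral_cong_AE) auto
  also have "\<dots> = (\<integral>\<^sup>+s. (\<integral>\<^sup>+\<omega>. ?f s \<omega> * indicator {0<..} s \<partial>Q) \<partial>lborel)"
    by (rule Fubini'[symmetric]) measurable
  also have "\<dots> = (\<integral>\<^sup>+s\<in>{0<..}. ennreal (capacity_integrand s) \<partial>lborel)"
  proof (intro nn_integral_cong)
    fix s :: real
    show "(\<integral>\<^sup>+\<omega>. ?f s \<omega> * indicator {0<..} s \<partial>Q) = ennreal (capacity_integrand s) * indicator {0<..} s"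
    proof (cases "0 < s")
      case True
      \<comment> \<open>Applied with \<theta> = 0 and \<theta> = 1, the two transforms whose
        difference is the integrand.\<close>
      have int: "integrable Q (\<lambda>\<omega>. ?U s \<omega> * exp (- (\<theta> * s * signal \<omega>)))" if "0 \<le> \<theta>" for \<theta>
      proof (rule integrable_const_bound[where B = 1])
        show "AE \<omega> in Q. norm (?U s \<omega> * exp (- (\<theta> * s * signal \<omega>))) \<le> 1"
          using AE_fade_nonneg
        proof eventually_elim
          case (elim \<omega>)
          have "0 \<le> signal \<omega>" using elim link_nonneg by (auto intro!: sum_nonneg)
          then show ?case using True that by (auto simp: abs_mult intro!: mult_le_one)
        qed
      qed measurable
      have int0: "integrable Q (?U s)" using int[of 0] by simp
      have int1: "integrable Q (\<lambda>\<omega>. ?U s \<omega> * exp (- (s * signal \<omega>)))" using int[of 1] by simp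
      let ?d = "\<lambda>\<omega>. exp (- s * noise_power P) / s * (?U s \<omega> * (1 - exp (- (s * signal \<omega>))))"
      \<comment> \<open>Expanding the product separates the transform of the interference from the
        joint transform with the signal, so no further independence argument is needed.\<close>
      have d: "?d = (\<lambda>\<omega>. exp (- s * noise_power P) / s * (?U s \<omega> - ?U s \<omega> * exp (- (s * signal \<omega>))))"
        by (simp add: right_diff_distrib)
      have "(\<integral>\<^sup>+\<omega>. ?f s \<omega> * indicator {0<..} s \<partial>Q) = (\<integral>\<^sup>+\<omega>. ennreal (?d \<omega>) \<partial>Q)"
        using True by simp
      also have "\<dots> = ennreal (expectation ?d)"
      proof (rule nn_integral_eq_integral)
        show "integrable Q ?d" unfolding d by (intro integrable_mult_right Bochner_Integration.integrable_diff int0 int1)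
        show "AE \<omega> in Q. 0 \<le> ?d \<omega>" using AE_fade_nonneg
        proof eventually_elim
          case (elim \<omega>)
          have "0 \<le> signal \<omega>" using elim link_nonneg by (auto intro!: sum_nonneg)
          then show ?case using True by simp
        qed
      qed
      also have "expectation ?d = exp (- s * noise_power P) / s *
          (expectation (?U s) - expectation (\<lambda>\<omega>. ?U s \<omega> * exp (- (s * signal \<omega>))))"
        unfolding d by (simp only: integral_mult_right_zero Bochner_Integration.integral_diff[OF int0 int1])
      also have "expectation (?U s) = exp_neg (V_los P \<rho> s + V_nlos P \<rho> s)"
        using expectation_laplace_interference_signal[of s 0] True by simp
      also have "expectation (\<lambda>\<omega>. ?U s \<omega> * exp (- (s * signal \<omega>))) = exp_neg (V_los P \<rho> s + V_nlos P \<rho> s) *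
          (\<Prod>k<K. 1 - Hfun (fading_mean P * s * main_gain P * los_icpt P * r k powr (- los_exp P)))"
        using expectation_laplace_interference_signal[of s 1] True by (simp add: Hfun_def mult.assoc)
      finally show ?thesis using True by (simp only: indicator_simps greaterThan_iff mult_1_right right_diff_distrib mult.assoc)
    qed simp
  qed
  finally show ?thesis .
qed

text \<open>From ln (1 + x) \<le> x, the bound by signal over noise and the finite mean of the
  fading. Finiteness lets the real conditional capacity replace the nonnegative integral when
  averaging over \<open>r\<close>.\<close>

lemma nn_integral_ln_sinr_finite: "(\<integral>\<^sup>+\<omega>. ennreal (ln (1 + sinr P N \<omega>)) \<partial>Q) < \<top>"
proof -
  have "integrable Q (\<lambda>\<omega>. signal \<omega> / noise_power P)"
    by (intro integrable_divide_zero Bochner_Integration.integrable_sum integrable_mult_right integrable_fade)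
  moreover have "AE \<omega> in Q. 0 \<le> signal \<omega> / noise_power P"
    using AE_ln_sinr by eventually_elim linarith
  ultimately have "(\<integral>\<^sup>+\<omega>. ennreal (signal \<omega> / noise_power P) \<partial>Q) < \<top>"
    by (subst nn_integral_eq_integral) auto
  moreover have "(\<integral>\<^sup>+\<omega>. ennreal (ln (1 + sinr P N \<omega>)) \<partial>Q) \<le> (\<integral>\<^sup>+\<omega>. ennreal (signal \<omega> / noise_power P) \<partial>Q)"
  proof (rule nn_integral_mono_AE, use AE_ln_sinr in eventually_elim)
    case (elim \<omega>)
    then show ?case using ln_add_one_self_le_self[of "sinr P N \<omega>"] by (intro ennreal_leI) linarith
  qed
  ultimately show ?thesis by (rule le_less_trans[rotated])
qed

lemma nn_integral_log_sinr:
  "(\<integral>\<^sup>+\<omega>. ennreal (log 2 (1 + sinr P N \<omega>)) \<partial>Q) = ennreal (\<integral>\<omega>. log 2 (1 + sinr P N \<omega>) \<partial>Q)"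
proof (rule nn_integral_eq_integral)
  show pos: "AE \<omega> in Q. 0 \<le> log 2 (1 + sinr P N \<omega>)"
    using AE_ln_sinr by eventually_elim simp
  have "integrable Q (\<lambda>\<omega>. ln (1 + sinr P N \<omega>))"
    using nn_integral_ln_sinr_finite AE_ln_sinr
    by (intro integrableI_nonneg) (auto elim!: eventually_mono)
  then show "integrable Q (\<lambda>\<omega>. log 2 (1 + sinr P N \<omega>))"
    unfolding log_def by (rule integrable_divide_zero)
qed

lemma AE_log_sinr_nonneg: "AE \<omega> in Q. 0 \<le> log 2 (1 + sinr P N \<omega>)"
  using AE_ln_sinr by eventually_elim simp

lemma expectation_log_sinr:
  "(\<integral>\<omega>. log 2 (1 + sinr P N \<omega>) \<partial>Q) = 1 / ln 2 * (LBINT s:{0<..}. capacity_integrand s)"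
proof -
  have "(\<integral>\<omega>. ln (1 + sinr P N \<omega>) \<partial>Q) = enn2real (\<integral>\<^sup>+\<omega>. ennreal (ln (1 + sinr P N \<omega>)) \<partial>Q)"
    using AE_ln_sinr by (intro integral_eq_nn_integral) (auto elim!: eventually_mono)
  also have "\<dots> = enn2real (\<integral>\<^sup>+s. ennreal (indicator {0<..} s *\<^sub>R capacity_integrand s) \<partial>lborel)"
    unfolding nn_integral_ln_sinr
    by (intro arg_cong[where f = enn2real] nn_integral_cong) (auto split: split_indicator)
  also have "\<dots> = (LBINT s:{0<..}. capacity_integrand s)"
    unfolding set_lebesgue_integral_def
    using capacity_integrand_nonneg
    by (intro integral_eq_nn_integral[symmetric]) (auto simp: Hfun_def split: split_indicator)
  finally show ?thesis unfolding log_def by simp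
qed

end

section \<open>The law of the ordered distances\<close>

lemma emeasure_homogeneous_ball:
  "0 \<le> \<nu> \<Longrightarrow> 0 \<le> c \<Longrightarrow> emeasure (density lborel (\<lambda>_. ennreal \<nu>)) (cball (0 :: real ^ 2) c) = ennreal (pi * \<nu> * c\<^sup>2)"
  by (simp add: emeasure_density nn_integral_cmult_indicator emeasure_cball_plane ennreal_mult[symmetric] mult_ac)

text \<open>With nondecreasing distances, the indices of the points in a disc form such a set; hence
  the count of a disc tells which points lie in it.\<close>

lemma finite_down_closed_eq_lessThan:
  fixes S :: "nat set"
  assumes "finite S" "\<And>k l. l \<in> S \<Longrightarrow> k \<le> l \<Longrightarrow> k \<in> S"
  shows "S = {..<card S}"
proof -
  obtain n where n: "n \<notin> S" "\<And>k. k < n \<Longrightarrow> k \<in> S"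
    using ex_new_if_finite[OF infinite_UNIV_nat assms(1)] exists_least_iff[of "\<lambda>n. n \<notin> S"] by blast
  then have "S = {..<n}"
    using assms(2) by (auto simp: not_less[symmetric])
  then show ?thesis by simp
qed

text \<open>Integrating over coordinate \<open>i\<close> first leaves a single point as section of
  the diagonal, a null set of the line.\<close>

lemma AE_PiM_lborel_distinct:
  fixes I :: "'i set"
  assumes "finite I" "i \<in> I" "j \<in> I" "i \<noteq> j"
  shows "AE x in PiM I (\<lambda>_. lborel :: real measure). x i \<noteq> x j"
proof -
  interpret product_sigma_finite "\<lambda>_. lborel :: real measure"
    by unfold_locales
  define J where "J = I - {i}"
  have J: "I = insert i J" "finite J" "i \<notin> J" "j \<in> J" using assms by (auto simp: J_def)
  have meas [measurable]: "(\<lambda>x. x i) \<in> borel_measurable (PiM I (\<lambda>_. lborel :: real measure))"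
      "(\<lambda>x. x j) \<in> borel_measurable (PiM I (\<lambda>_. lborel :: real measure))"
    using assms measurable_component_singleton[of _ I "\<lambda>_. lborel :: real measure"] by (auto simp: measurable_lborel1)
  have ind: "(\<lambda>x. indicator {x. x i = x j} x :: ennreal) \<in> borel_measurable (PiM I (\<lambda>_. lborel :: real measure))"
    using borel_measurable_eq[OF meas] 
    by (subst measurable_cong[where g = "indicator {x \<in> space (PiM I (\<lambda>_. lborel)). x i = x j}"])
       (auto simp: indicator_def)
  have "(\<integral>\<^sup>+x. indicator {x. x i = x j} x \<partial>PiM I (\<lambda>_. lborel :: real measure)) =
      (\<integral>\<^sup>+x. (\<integral>\<^sup>+y. indicator {x. x i = x j} (x(i := y)) \<partial>(lborel :: real measure)) \<partial>PiM J (\<lambda>_. lborel))"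
    using ind unfolding J(1) by (intro product_nn_integral_insert J)
  also have "\<dots> = (\<integral>\<^sup>+x. (\<integral>\<^sup>+y. indicator {x j} y \<partial>(lborel :: real measure)) \<partial>PiM J (\<lambda>_. lborel))"
    using J by (intro nn_integral_cong) (auto simp: indicator_def intro!: nn_integral_cong)
  also have "\<dots> = 0" by simp
  finally have "AE x in PiM I (\<lambda>_. lborel :: real measure). indicator {x. x i = x j} x = (0 :: ennreal)"
    using nn_integral_0_iff_AE[OF ind] by blast
  then show ?thesis by eventually_elim (auto simp: indicator_def split: if_splits)
qed

section \<open>The claimed density on ordered boxes\<close>

text \<open>Half-open sides correspond to differences of closed discs and are stable under
  intersection. The order of the sides is imposed as the hypothesis
  \<open>b k \<le> a (Suc k)\<close> where boxes are used.\<close>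

definition ordered_box :: "nat \<Rightarrow> (nat \<Rightarrow> real) \<Rightarrow> (nat \<Rightarrow> real) \<Rightarrow> (nat \<Rightarrow> real) set" where
  "ordered_box K a b = (\<Pi>\<^sub>E k\<in>{..<K}. {a k<..b k})"

definition distance_density :: "nat \<Rightarrow> real \<Rightarrow> (nat \<Rightarrow> real) \<Rightarrow> real" where
  "distance_density K \<nu> r = (2 * pi * \<nu>) ^ K * (\<Prod>k<K. r k) * exp (- pi * \<nu> * (r (K - 1))\<^sup>2)"

definition ordered_dists :: "nat \<Rightarrow> (nat \<Rightarrow> real) set" where
  "ordered_dists K = {r \<in> {..<K} \<rightarrow>\<^sub>E {0<..}. mono_on {..<K} r}"

lemma sets_ordered_dists [measurable]: "ordered_dists K \<in> sets (PiM {..<K} (\<lambda>_. borel))"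
proof -
  have comp: "(\<lambda>r. r k) \<in> borel_measurable (PiM {..<K} (\<lambda>_. borel :: real measure))" if "k < K" for k
    using that by (intro measurable_component_singleton) auto
  have "ordered_dists K = {r \<in> space (PiM {..<K} (\<lambda>_. borel)). (\<forall>k\<in>{..<K}. 0 < r k) \<and> (\<forall>k\<in>{..<K}. \<forall>l\<in>{k..<K}. r k \<le> r l)}"
    by (auto simp: ordered_dists_def space_PiM PiE_def Pi_def mono_on_def)
  also have "\<dots> \<in> sets (PiM {..<K} (\<lambda>_. borel))"
    by (intro sets.sets_Collect_conj sets.sets_Collect_finite_All borel_measurable_le borel_measurable_less comp) auto
  finally show ?thesis .
qed

lemma measurable_distance_density:
  assumes "0 < K"
  shows "distance_density K \<nu> \<in> borel_measurable (PiM {..<K} (\<lambda>_. borel))"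
proof -
  have [measurable]: "(\<lambda>r. r (K - 1)) \<in> borel_measurable (PiM {..<K} (\<lambda>_. borel))"
    using assms by (intro measurable_component_singleton) auto
  show ?thesis unfolding distance_density_def by measurable
qed

lemma sets_PiM_lborel: "sets (PiM I (\<lambda>_. lborel)) = sets (PiM I (\<lambda>_. borel :: 'a :: euclidean_space measure))"
  by (intro sets_PiM_cong) auto

lemma nn_integral_linear_Ioc:
  fixes a b \<nu> :: real
  assumes "0 \<le> a" "a \<le> b" "0 \<le> \<nu>"
  shows "(\<integral>\<^sup>+x. ennreal (2 * pi * \<nu> * x) * indicator {a<..b} x \<partial>lborel) = ennreal (pi * \<nu> * (b\<^sup>2 - a\<^sup>2))"
proof -
  have "(\<integral>\<^sup>+x. ennreal (2 * pi * \<nu> * x) * indicator {a<..b} x \<partial>lborel) = (\<integral>\<^sup>+x. ennreal (2 * pi * \<nu> * x) * indicator {a..b} x \<partial>lborel)"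
    by (intro nn_integral_cong_AE, use AE_lborel_singleton[of a] in eventually_elim) (auto split: split_indicator)
  also have "\<dots> = ennreal (pi * \<nu> * b\<^sup>2 - pi * \<nu> * a\<^sup>2)"
    using assms by (intro nn_integral_FTC_Icc) (auto intro!: derivative_eq_intros)
  finally show ?thesis by (simp add: algebra_simps)
qed

lemma nn_integral_rayleigh_Ioc:
  fixes a b \<nu> :: real
  assumes "0 \<le> a" "a \<le> b" "0 \<le> \<nu>"
  shows "(\<integral>\<^sup>+x. ennreal (2 * pi * \<nu> * x * exp (- pi * \<nu> * x\<^sup>2)) * indicator {a<..b} x \<partial>lborel) =
    ennreal (exp (- pi * \<nu> * a\<^sup>2) - exp (- pi * \<nu> * b\<^sup>2))"
proof -
  have "(\<integral>\<^sup>+x. ennreal (2 * pi * \<nu> * x * exp (- pi * \<nu> * x\<^sup>2)) * indicator {a<..b} x \<partial>lborel) =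
      (\<integral>\<^sup>+x. ennreal (2 * pi * \<nu> * x * exp (- pi * \<nu> * x\<^sup>2)) * indicator {a..b} x \<partial>lborel)"
    by (intro nn_integral_cong_AE, use AE_lborel_singleton[of a] in eventually_elim) (auto split: split_indicator)
  also have "\<dots> = ennreal (- exp (- pi * \<nu> * b\<^sup>2) - - exp (- pi * \<nu> * a\<^sup>2))"
    using assms by (intro nn_integral_FTC_Icc) (auto intro!: derivative_eq_intros)
  finally show ?thesis by simp
qed

lemma ordered_box_nonneg:
  fixes a b :: "nat \<Rightarrow> real"
  assumes "0 \<le> a 0" "\<And>k. Suc k < K \<Longrightarrow> b k \<le> a (Suc k)" "\<And>k. k < K \<Longrightarrow> a k < b k"
  shows "k < K \<Longrightarrow> 0 \<le> a k"
proof (induction k)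
  case (Suc k)
  then show ?case using assms(2)[of k] assms(3)[of k] by simp
qed (use assms in auto)

lemma ordered_box_chain:
  fixes a b :: "nat \<Rightarrow> real"
  assumes "\<And>k. Suc k < K \<Longrightarrow> b k \<le> a (Suc k)" "\<And>k. k < K \<Longrightarrow> a k < b k"
  shows "k < l \<Longrightarrow> l < K \<Longrightarrow> b k \<le> a l"
proof (induction l)
  case (Suc l)
  show ?case
  proof (cases "k = l")
    case False
    then have "b k \<le> a l" using Suc by auto
    also have "\<dots> \<le> b l" using assms(2)[of l] Suc by simp
    also have "\<dots> \<le> a (Suc l)" using assms(1) Suc by simp
    finally show ?thesis .
  qed (use assms Suc in auto)
qed auto

text \<open>The order of the sides puts the box inside \<open>ordered_dists K\<close>, so the
  indicator disappears and the density factorizes over the coordinates.\<close>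

lemma emeasure_distance_density_box:
  assumes K: "0 < K" and \<nu>: "0 < \<nu>"
    and box: "0 \<le> a 0" "\<And>k. Suc k < K \<Longrightarrow> b k \<le> a (Suc k)" "\<And>k. k < K \<Longrightarrow> a k < b k"
  shows "emeasure (density (PiM {..<K} (\<lambda>_. lborel)) (\<lambda>r. ennreal (distance_density K \<nu> r) * indicator (ordered_dists K) r))
      (ordered_box K a b) =
    ennreal ((\<Prod>k<K - 1. pi * \<nu> * ((b k)\<^sup>2 - (a k)\<^sup>2)) * (exp (- pi * \<nu> * (a (K - 1))\<^sup>2) - exp (- pi * \<nu> * (b (K - 1))\<^sup>2)))"
proof -
  interpret product_sigma_finite "\<lambda>_. lborel :: real measure"
    by unfold_locales
  have nonneg: "0 \<le> a k" if "k < K" for k using ordered_box_nonneg[of a K b] box that by blast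
  have chain: "b k \<le> a l" if "k < l" "l < K" for k l using ordered_box_chain[of K b a] box that by blast
  have sub: "ordered_box K a b \<subseteq> ordered_dists K"
  proof
    fix r assume r: "r \<in> ordered_box K a b"
    then have rk: "a k < r k" "r k \<le> b k" if "k < K" for k
      using that by (auto simp: ordered_box_def PiE_def Pi_def)
    have "r k \<le> r l" if "k \<le> l" "l < K" for k l
      using rk[of k] rk[of l] chain[of k l] that by (cases "k = l") auto
    moreover have "0 < r k" if "k < K" for k using rk[OF that] nonneg[OF that] by simp
    ultimately show "r \<in> ordered_dists K"
      using r by (auto simp: ordered_dists_def ordered_box_def PiE_def Pi_def mono_on_def)
  qed
  have box_sets: "ordered_box K a b \<in> sets (PiM {..<K} (\<lambda>_. borel))"
    unfolding ordered_box_def by (intro sets_PiM_I_finite) auto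
  \<comment> \<open>The exponential of the density depends on the largest distance alone and is
    given to the last coordinate, making it a Rayleigh density; the other coordinates stay
    linear.\<close>
  define f where "f k x = (if k = K - 1 then ennreal (2 * pi * \<nu> * x * exp (- pi * \<nu> * x\<^sup>2))
     else ennreal (2 * pi * \<nu> * x)) * indicator {a k<..b k} x" for k x
  have f_meas: "f k \<in> borel_measurable lborel" for k unfolding f_def by measurable
  have prod_split: "(\<Prod>k<K. g k) = (\<Prod>k<K - 1. g k) * g (K - 1)" for g :: "nat \<Rightarrow> 'z :: comm_monoid_mult"
    using K prod.lessThan_Suc[of g "K - 1"] by simp
  have "emeasure (density (PiM {..<K} (\<lambda>_. lborel)) (\<lambda>r. ennreal (distance_density K \<nu> r) * indicator (ordered_dists K) r))
      (ordered_box K a b) =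
    (\<integral>\<^sup>+r. ennreal (distance_density K \<nu> r) * indicator (ordered_dists K) r * indicator (ordered_box K a b) r \<partial>PiM {..<K} (\<lambda>_. lborel))"
    using box_sets measurable_distance_density[OF K] sets_ordered_dists[of K]
    by (intro emeasure_density) (auto simp: sets_PiM_lborel measurable_cong_sets[OF sets_PiM_lborel refl])
  also have "\<dots> = (\<integral>\<^sup>+r. (\<Prod>k<K. f k (r k)) \<partial>PiM {..<K} (\<lambda>_. lborel))"
  proof (intro nn_integral_cong)
    fix r assume r: "r \<in> space (PiM {..<K} (\<lambda>_. lborel :: real measure))"
    show "ennreal (distance_density K \<nu> r) * indicator (ordered_dists K) r * indicator (ordered_box K a b) r = (\<Prod>k<K. f k (r k))"
    proof (cases "r \<in> ordered_box K a b")
      case True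
      then have rk: "a k < r k" "r k \<le> b k" if "k < K" for k
        using that by (auto simp: ordered_box_def PiE_def Pi_def)
      have pos: "0 < r k" if "k < K" for k using rk[OF that] nonneg[OF that] by simp
      have "(\<Prod>k<K. f k (r k)) = (\<Prod>k<K - 1. ennreal (2 * pi * \<nu> * r k)) *
          ennreal (2 * pi * \<nu> * r (K - 1) * exp (- pi * \<nu> * (r (K - 1))\<^sup>2))"
        unfolding prod_split using rk K by (auto simp: f_def intro!: arg_cong2[where f = times] prod.cong)
      also have "\<dots> = ennreal ((\<Prod>k<K - 1. 2 * pi * \<nu> * r k) * (2 * pi * \<nu> * r (K - 1) * exp (- pi * \<nu> * (r (K - 1))\<^sup>2)))"
      proof -
        have "0 \<le> (\<Prod>k<K - 1. 2 * pi * \<nu> * r k)" using \<nu> pos by (intro prod_nonneg) (auto simp: less_imp_le)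
        moreover have "0 \<le> 2 * pi * \<nu> * r (K - 1) * exp (- pi * \<nu> * (r (K - 1))\<^sup>2)"
          using \<nu> pos[of "K - 1"] K by simp
        ultimately show ?thesis
          using \<nu> pos by (subst prod_ennreal) (auto simp: less_imp_le ennreal_mult)
      qed
      also have "(\<Prod>k<K - 1. 2 * pi * \<nu> * r k) * (2 * pi * \<nu> * r (K - 1) * exp (- pi * \<nu> * (r (K - 1))\<^sup>2)) =
          (\<Prod>k<K. 2 * pi * \<nu> * r k) * exp (- pi * \<nu> * (r (K - 1))\<^sup>2)"
        unfolding prod_split by (simp add: mult.assoc)
      also have "\<dots> = distance_density K \<nu> r"
        by (simp add: distance_density_def prod.distrib)
      finally show ?thesis using True sub by auto
    next
      case False
      then obtain k where "k < K" "r k \<notin> {a k<..b k}"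
        using r by (auto simp: ordered_box_def space_PiM PiE_def Pi_def)
      then have "f k (r k) = 0" by (auto simp: f_def)
      then have "(\<Prod>k<K. f k (r k)) = 0" using \<open>k < K\<close> by (intro prod_zero) auto
      then show ?thesis using False by simp
    qed
  qed
  also have "\<dots> = (\<Prod>k<K. integral\<^sup>N lborel (f k))"
    by (intro product_nn_integral_prod f_meas) auto
  also have "\<dots> = (\<Prod>k<K - 1. ennreal (pi * \<nu> * ((b k)\<^sup>2 - (a k)\<^sup>2))) *
      ennreal (exp (- pi * \<nu> * (a (K - 1))\<^sup>2) - exp (- pi * \<nu> * (b (K - 1))\<^sup>2))"
  proof -
    have "integral\<^sup>N lborel (f k) = ennreal (pi * \<nu> * ((b k)\<^sup>2 - (a k)\<^sup>2))" if "k < K - 1" for k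
    proof -
      have "f k = (\<lambda>x. ennreal (2 * pi * \<nu> * x) * indicator {a k<..b k} x)" using that by (auto simp: f_def)
      then show ?thesis
        using nonneg[of k] less_imp_le[OF box(3)[of k]] that \<nu> by (simp only:) (intro nn_integral_linear_Ioc, simp_all)
    qed
    moreover have "integral\<^sup>N lborel (f (K - 1)) = ennreal (exp (- pi * \<nu> * (a (K - 1))\<^sup>2) - exp (- pi * \<nu> * (b (K - 1))\<^sup>2))"
    proof -
      have "f (K - 1) = (\<lambda>x. ennreal (2 * pi * \<nu> * x * exp (- pi * \<nu> * x\<^sup>2)) * indicator {a (K - 1)<..b (K - 1)} x)"
        by (auto simp: f_def)
      then show ?thesis
        using nonneg[of "K - 1"] box(3)[of "K - 1"] K \<nu> by (simp only:) (intro nn_integral_rayleigh_Ioc, auto)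
    qed
    ultimately show ?thesis unfolding prod_split by simp
  qed
  also have "\<dots> = ennreal ((\<Prod>k<K - 1. pi * \<nu> * ((b k)\<^sup>2 - (a k)\<^sup>2)) *
      (exp (- pi * \<nu> * (a (K - 1))\<^sup>2) - exp (- pi * \<nu> * (b (K - 1))\<^sup>2)))"
  proof -
    have sq: "(a k)\<^sup>2 \<le> (b k)\<^sup>2" if "k < K" for k using nonneg[OF that] box(3)[OF that] by (intro power_mono) auto
    then have "0 \<le> pi * \<nu> * ((b k)\<^sup>2 - (a k)\<^sup>2)" if "k < K - 1" for k using that \<nu> by simp
    moreover have "0 \<le> exp (- pi * \<nu> * (a (K - 1))\<^sup>2) - exp (- pi * \<nu> * (b (K - 1))\<^sup>2)"
      using sq[of "K - 1"] K \<nu> by simp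
    moreover from calculation(1) have "0 \<le> (\<Prod>k<K - 1. pi * \<nu> * ((b k)\<^sup>2 - (a k)\<^sup>2))"
      by (intro prod_nonneg) auto
    ultimately show ?thesis
      by (subst prod_ennreal) (auto simp: ennreal_mult)
  qed
  finally show ?thesis .
qed

section \<open>Counts of the planar process in discs and annuli\<close>

locale ordered_planar_poisson = prob_space M
  for M :: "'w measure" +
  fixes X :: "nat \<Rightarrow> 'w \<Rightarrow> real ^ 2" and \<nu> :: real
  assumes \<nu>: "0 < \<nu>"
    and pp: "poisson_process M (density lborel (\<lambda>_. ennreal \<nu>)) X (\<lambda>_. UNIV)"
    and mono_dist: "\<And>\<omega>. \<omega> \<in> space M \<Longrightarrow> mono (\<lambda>l. norm (X l \<omega>))"
begin

abbreviation "\<Lambda> \<equiv> density (lborel :: (real ^ 2) measure) (\<lambda>_. ennreal \<nu>)"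

abbreviation "npoints A \<omega> \<equiv> point_count X (\<lambda>_. UNIV) A \<omega>"

lemma measurable_homogeneous_points [measurable]: "X l \<in> borel_measurable M"
  using poisson_process_measurable(1)[OF pp, of l] by simp

lemma cball_finite_sets: "0 \<le> c \<Longrightarrow> cball 0 c \<in> finite_sets \<Lambda>"
  using \<nu> by (simp add: finite_sets_def emeasure_homogeneous_ball)

lemma finite_sets_subset: "A \<in> finite_sets \<Lambda> \<Longrightarrow> B \<in> sets borel \<Longrightarrow> B \<subseteq> A \<Longrightarrow> B \<in> finite_sets \<Lambda>"
  using emeasure_mono[of B A \<Lambda>] by (auto simp: finite_sets_def)

lemma AE_finite_points: "AE \<omega> in M. \<forall>t. finite {l. norm (X l \<omega>) \<le> t}"
proof -
  have "AE \<omega> in M. \<forall>n::nat. finite {l. norm (X l \<omega>) \<le> n}"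
    unfolding AE_all_countable
    using poisson_process_AE_finite[OF pp cball_finite_sets[of "real n" for n]] by simp
  then show ?thesis
  proof eventually_elim
    case (elim \<omega>)
    show ?case
    proof
      fix t :: real
      obtain n :: nat where "t \<le> n" using real_arch_simple by blast
      then have "{l. norm (X l \<omega>) \<le> t} \<subseteq> {l. norm (X l \<omega>) \<le> n}" by auto
      then show "finite {l. norm (X l \<omega>) \<le> t}" using elim finite_subset by blast
    qed
  qed
qed

text \<open>Measurability of a count is part of the independence clause, here applied to
  \<open>A\<close> followed by empty sets.\<close>

lemma count_measurable:
  assumes "A \<in> finite_sets \<Lambda>"
  shows "npoints A \<in> measurable M (count_space UNIV)"
proof -
  have "indep_vars (\<lambda>_. count_space UNIV) (\<lambda>i::nat. npoints (if i = 0 then A else {})) UNIV"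
    using assms by (intro poisson_process_indep_vars[OF pp]) (auto simp: disjoint_family_on_def)
  then have "npoints (if (0::nat) = 0 then A else {}) \<in> measurable M (count_space UNIV)"
    unfolding indep_vars_def by blast
  then show ?thesis by simp
qed

text \<open>The first three values are those of the boxes: empty gap, single point, and last side.
  The quadratic bound rules out ties and uses \<open>exp (- m) \<ge> 1 - m\<close>.\<close>

lemma prob_count:
  assumes "A \<in> finite_sets \<Lambda>"
  shows "prob {\<omega> \<in> space M. npoints A \<omega> = 0} = exp (- measure \<Lambda> A)"
    "prob {\<omega> \<in> space M. npoints A \<omega> = 1} = measure \<Lambda> A * exp (- measure \<Lambda> A)"
    "prob {\<omega> \<in> space M. 1 \<le> npoints A \<omega>} = 1 - exp (- measure \<Lambda> A)"
    "prob {\<omega> \<in> space M. 2 \<le> npoints A \<omega>} \<le> (measure \<Lambda> A)\<^sup>2"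
proof -
  note [measurable] = count_measurable[OF assms]
  let ?m = "measure \<Lambda> A"
  show 0: "prob {\<omega> \<in> space M. npoints A \<omega> = 0} = exp (- ?m)"
    and 1: "prob {\<omega> \<in> space M. npoints A \<omega> = 1} = ?m * exp (- ?m)"
    using poisson_process_prob[OF pp assms, of 0] poisson_process_prob[OF pp assms, of 1] by simp_all
  have "prob {\<omega> \<in> space M. 1 \<le> npoints A \<omega>} = prob (space M - {\<omega> \<in> space M. npoints A \<omega> = 0})"
    by (intro arg_cong[where f = prob]) auto
  also have "\<dots> = 1 - prob {\<omega> \<in> space M. npoints A \<omega> = 0}"
    by (intro prob_compl) measurable
  finally show "prob {\<omega> \<in> space M. 1 \<le> npoints A \<omega>} = 1 - exp (- ?m)" using 0 by simp
  have "prob {\<omega> \<in> space M. 2 \<le> npoints A \<omega>} =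
      prob (space M - ({\<omega> \<in> space M. npoints A \<omega> = 0} \<union> {\<omega> \<in> space M. npoints A \<omega> = 1}))"
    by (intro arg_cong[where f = prob]) auto
  also have "\<dots> = 1 - prob ({\<omega> \<in> space M. npoints A \<omega> = 0} \<union> {\<omega> \<in> space M. npoints A \<omega> = 1})"
    by (intro prob_compl) measurable
  also have "prob ({\<omega> \<in> space M. npoints A \<omega> = 0} \<union> {\<omega> \<in> space M. npoints A \<omega> = 1}) = exp (- ?m) + ?m * exp (- ?m)"
    by (subst finite_measure_Union) (auto simp: 0 1[simplified])
  finally have "prob {\<omega> \<in> space M. 2 \<le> npoints A \<omega>} = 1 - (1 + ?m) * exp (- ?m)"
    by (simp add: algebra_simps)
  also have "\<dots> \<le> 1 - (1 + ?m) * (1 - ?m)"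
    using exp_ge_add_one_self[of "- ?m"] by (intro diff_left_mono mult_left_mono) auto
  finally show "prob {\<omega> \<in> space M. 2 \<le> npoints A \<omega>} \<le> ?m\<^sup>2"
    by (simp add: algebra_simps power2_eq_square)
qed

context
  fixes c :: "nat \<Rightarrow> real"
  assumes c: "mono c" "\<And>i. 0 \<le> c i"
begin

abbreviation "annulus \<equiv> disjointed (\<lambda>i. cball (0 :: real ^ 2) (c i))"

lemma annulus_Suc: "annulus (Suc i) = cball 0 (c (Suc i)) - cball 0 (c i)"
  by (rule disjointed_mono) (use c(1) in \<open>auto intro!: monoI subset_cball dest: monoD\<close>)

lemma annulus_0: "annulus 0 = cball 0 (c 0)"
  by (simp add: disjointed_def)

lemma annulus_finite_sets: "annulus i \<in> finite_sets \<Lambda>"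
  by (rule finite_sets_subset[OF cball_finite_sets[OF c(2)[of i]]])
     (auto simp: disjointed_def)

lemma measure_annulus_Suc: "measure \<Lambda> (annulus (Suc i)) = pi * \<nu> * ((c (Suc i))\<^sup>2 - (c i)\<^sup>2)"
proof -
  have "measure \<Lambda> (cball 0 (c i)) = pi * \<nu> * (c i)\<^sup>2" for i
    using emeasure_homogeneous_ball[of \<nu> "c i"] \<nu> c(2)[of i] by (simp add: measure_def)
  moreover have "measure \<Lambda> (cball 0 (c (Suc i)) - cball 0 (c i)) =
      measure \<Lambda> (cball 0 (c (Suc i))) - measure \<Lambda> (cball 0 (c i))"
    using cball_finite_sets[OF c(2), of "Suc i"] monoD[OF c(1), of i "Suc i"]
    by (intro measure_Diff) (auto simp: finite_sets_def less_top)
  ultimately show ?thesis by (simp add: annulus_Suc algebra_simps)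
qed

lemma measure_annulus_0: "measure \<Lambda> (annulus 0) = pi * \<nu> * (c 0)\<^sup>2"
  using emeasure_homogeneous_ball[of \<nu> "c 0"] \<nu> c(2)[of 0] by (simp add: measure_def annulus_0)

lemma card_annulus:
  assumes "\<And>t. finite {l. norm (X l \<omega>) \<le> t}"
  shows "card {l. norm (X l \<omega>) \<le> c 0} = npoints (annulus 0) \<omega>"
    "card {l. norm (X l \<omega>) \<le> c (Suc i)} = card {l. norm (X l \<omega>) \<le> c i} + npoints (annulus (Suc i)) \<omega>"
proof -
  show "card {l. norm (X l \<omega>) \<le> c 0} = npoints (annulus 0) \<omega>"
    by (simp add: point_count_def annulus_0)
  have "{l. norm (X l \<omega>) \<le> c (Suc i)} = {l. norm (X l \<omega>) \<le> c i} \<union> {l. X l \<omega> \<in> annulus (Suc i)}"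
    using monoD[OF c(1), of i "Suc i"] by (auto simp: annulus_Suc)
  moreover have "finite {l. X l \<omega> \<in> annulus (Suc i)}"
    by (rule finite_subset[OF _ assms[of "c (Suc i)"]]) (auto simp: annulus_Suc)
  ultimately show "card {l. norm (X l \<omega>) \<le> c (Suc i)} = card {l. norm (X l \<omega>) \<le> c i} + npoints (annulus (Suc i)) \<omega>"
    by (simp add: point_count_def card_Un_disjoint assms disjoint_iff annulus_Suc)
qed

end

text \<open>The points are sorted by distance, so the indices found in a disc form an initial
  segment, determined by its size.\<close>

lemma norm_le_iff_less_card:
  assumes "\<omega> \<in> space M" "\<And>t. finite {l. norm (X l \<omega>) \<le> t}"
  shows "norm (X l \<omega>) \<le> t \<longleftrightarrow> l < card {l. norm (X l \<omega>) \<le> t}"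
proof -
  have "{l. norm (X l \<omega>) \<le> t} = {..<card {l. norm (X l \<omega>) \<le> t}}"
    using assms(2) monoD[OF mono_dist[OF assms(1)]]
    by (intro finite_down_closed_eq_lessThan) (auto intro: order_trans)
  then show ?thesis by blast
qed

lemma AE_first_dist_pos: "AE \<omega> in M. 0 < norm (X 0 \<omega>)"
proof -
  have A: "{0} \<in> finite_sets \<Lambda>" using finite_sets_subset[OF cball_finite_sets[of 0]] by simp
  note [measurable] = count_measurable[OF A]
  have "measure \<Lambda> {0} = 0" using emeasure_homogeneous_ball[of \<nu> 0] \<nu> by (simp add: measure_def)
  then have "prob {\<omega> \<in> space M. npoints {0} \<omega> = 0} = 1"
    using prob_count(1)[OF A] by simp
  then have "AE \<omega> in M. npoints {0} \<omega> = 0"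
    by (subst (asm) prob_Collect_eq_1) auto
  with AE_finite_points show ?thesis
  proof eventually_elim
    case (elim \<omega>)
    \<comment> \<open>A zero count means that no point is there only once the index set is known to
      be finite.\<close>
    have "finite {l. X l \<omega> \<in> {0}}" using spec[OF elim(1), of 0] by simp
    with elim(2) have "{l. X l \<omega> \<in> {0}} = {}" by (simp add: point_count_def)
    then show ?case by auto
  qed
qed

text \<open>Cut the disc of radius \<open>T\<close> into \<open>n\<close> annuli of equal area: a tie puts two points into one of
  them, which has probability at most \<open>n\<close> times a constant over \<open>n\<^sup>2\<close>.\<close>

lemma AE_no_ties: "AE \<omega> in M. norm (X k \<omega>) \<noteq> norm (X (Suc k) \<omega>)"
proof -
  have "AE \<omega> in M. \<not> (norm (X k \<omega>) = norm (X (Suc k) \<omega>) \<and> norm (X k \<omega>) \<le> real T)" for T :: nat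
  proof -
    let ?tie = "{\<omega> \<in> space M. norm (X k \<omega>) = norm (X (Suc k) \<omega>) \<and> norm (X k \<omega>) \<le> real T}"
    have [measurable]: "?tie \<in> sets M" by measurable
    \<comment> \<open>The mean number of points in the disc of radius \<open>T\<close>.\<close>
    define B where "B = pi * \<nu> * (real T)\<^sup>2"
    have bound: "prob ?tie \<le> B\<^sup>2 / real (Suc n)" for n
    proof -
      \<comment> \<open>The squared radii grow linearly and reach T^2 at \<open>i = n\<close>, so
        the indices up to \<open>n\<close> give \<open>Suc n\<close> pieces with mean
        \<open>B / Suc n\<close> each, the innermost being a disc.\<close>
      define c where "c i = real T * sqrt (real (Suc i) / real (Suc n))" for i
      have c: "mono c" "\<And>i. 0 \<le> c i"
        by (auto simp: c_def mono_def intro!: mult_left_mono real_sqrt_le_mono divide_right_mono)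
      let ?A = "disjointed (\<lambda>i. cball (0 :: real ^ 2) (c i))"
      have fs: "?A i \<in> finite_sets \<Lambda>" for i by (rule annulus_finite_sets[OF c])
      note [measurable] = count_measurable[OF fs]
      have c2: "(c i)\<^sup>2 = (real T)\<^sup>2 * (real (Suc i) / real (Suc n))" for i
        by (simp add: c_def power_mult_distrib)
      have m: "measure \<Lambda> (?A i) = B / real (Suc n)" for i
      proof (cases i)
        case 0
        show ?thesis unfolding 0 measure_annulus_0[OF c] c2 B_def by simp
      next
        case (Suc j)
        show ?thesis
          unfolding Suc measure_annulus_Suc[OF c] c2 B_def
          by (simp add: right_diff_distrib[symmetric] diff_divide_distrib[symmetric])
      qed
      have "AE \<omega> in M. \<omega> \<in> ?tie \<longrightarrow> \<omega> \<in> (\<Union>i\<in>{..n}. {\<omega> \<in> space M. 2 \<le> npoints (?A i) \<omega>})"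
        using AE_finite_points AE_space
      proof eventually_elim
        case (elim \<omega>)
        show ?case
        proof
          assume t: "\<omega> \<in> ?tie"
          have "c n = real T" by (simp add: c_def)
          then have "X k \<omega> \<in> (\<Union>i<Suc n. cball 0 (c i))" using t by (auto intro!: bexI[of _ n])
          then have "X k \<omega> \<in> (\<Union>i<Suc n. ?A i)"
            using finite_UN_disjointed_eq[of "\<lambda>i. cball (0 :: real ^ 2) (c i)" "Suc n"] by (simp add: atLeast0LessThan)
          then obtain i where i: "i < Suc n" "X k \<omega> \<in> ?A i" by auto
          then have "X (Suc k) \<omega> \<in> ?A i"
            using t by (auto simp: disjointed_def)
          then have "{k, Suc k} \<subseteq> {l. X l \<omega> \<in> ?A i}" using i by auto
          moreover have "finite {l. X l \<omega> \<in> ?A i}"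
            using elim(1) by (rule_tac finite_subset[of _ "{l. norm (X l \<omega>) \<le> c i}"]) (auto simp: disjointed_def)
          ultimately have "card {k, Suc k} \<le> npoints (?A i) \<omega>"
            unfolding point_count_def by (intro card_mono) auto
          then show "\<omega> \<in> (\<Union>i\<in>{..n}. {\<omega> \<in> space M. 2 \<le> npoints (?A i) \<omega>})"
            using i elim by (auto intro!: bexI[of _ i])
        qed
      qed
      then have "prob ?tie \<le> prob (\<Union>i\<in>{..n}. {\<omega> \<in> space M. 2 \<le> npoints (?A i) \<omega>})"
        by (intro finite_measure_mono_AE) auto
      also have "\<dots> \<le> (\<Sum>i\<in>{..n}. prob {\<omega> \<in> space M. 2 \<le> npoints (?A i) \<omega>})"
        by (intro finite_measure_subadditive_finite) auto
      also have "\<dots> \<le> (\<Sum>i\<in>{..n}. (B / real (Suc n))\<^sup>2)"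
        using prob_count(4)[OF fs] unfolding m by (intro sum_mono)
      also have "\<dots> = B\<^sup>2 / real (Suc n)"
        by (simp add: power2_eq_square del: of_nat_Suc)
      finally show ?thesis .
    qed
    have "(\<lambda>n. B\<^sup>2 / real (Suc n)) \<longlonglongrightarrow> 0"
      using lim_const_over_n[of "B\<^sup>2"] by (rule LIMSEQ_Suc)
    then have "prob ?tie \<le> 0"
      using bound by (intro LIMSEQ_le_const) auto
    then have "prob ?tie = 0" by (simp add: measure_le_0_iff)
    then show ?thesis by (subst (asm) prob_Collect_eq_0) auto
  qed
  then have "AE \<omega> in M. \<forall>T::nat. \<not> (norm (X k \<omega>) = norm (X (Suc k) \<omega>) \<and> norm (X k \<omega>) \<le> real T)"
    unfolding AE_all_countable by blast
  then show ?thesis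
  proof eventually_elim
    case (elim \<omega>)
    then show ?case using real_arch_simple[of "norm (X k \<omega>)"] by blast
  qed
qed

end

section \<open>Probabilities of ordered boxes\<close>

text \<open>\<open>N\<close> are counts of nested discs and \<open>n\<close> those of the annuli
  between them. Point \<open>k - 1\<close> lying in the previous side forces
  \<open>N (2 * k) \<ge> k\<close>, and point \<open>k\<close> lying outside the gap forces
  equality. After the last side nothing limits the count, hence at least one there instead of
  exactly one.\<close>

lemma partial_counts_iff:
  fixes N n :: "nat \<Rightarrow> nat"
  assumes "0 < K" and N: "N 0 = n 0" "\<And>i. N (Suc i) = N i + n (Suc i)"
  shows "(\<forall>k<K. N (2 * k) \<le> k \<and> k < N (Suc (2 * k))) \<longleftrightarrow>
    (\<forall>k<K. n (2 * k) = 0 \<and> (if Suc k < K then n (Suc (2 * k)) = 1 else 1 \<le> n (Suc (2 * k))))"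
proof
  assume *: "\<forall>k<K. N (2 * k) \<le> k \<and> k < N (Suc (2 * k))"
  have N_even: "N (2 * k) = k" if "k < K" for k
  proof (cases k)
    case (Suc j)
    have "j < N (Suc (2 * j))" using * that Suc by auto
    also have "\<dots> \<le> N (2 * k)" using N(2)[of "Suc (2 * j)"] Suc by simp
    finally show ?thesis using * that Suc by (intro antisym) auto
  qed (use * that in auto)
  show "\<forall>k<K. n (2 * k) = 0 \<and> (if Suc k < K then n (Suc (2 * k)) = 1 else 1 \<le> n (Suc (2 * k)))"
  proof (intro allI impI conjI)
    fix k assume k: "k < K"
    show "n (2 * k) = 0"
    proof (cases k)
      case 0
      then show ?thesis using N_even[OF k] N(1) by simp
    next
      case (Suc j)
      then show ?thesis using N_even[OF k] N(2)[of "Suc (2 * j)"] *[rule_format, of j] k by simp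
    qed
    have "N (Suc (2 * k)) = k + n (Suc (2 * k))" using N(2)[of "2 * k"] N_even[OF k] by simp
    moreover have "k < N (Suc (2 * k))" using * k by blast
    moreover have "N (Suc (2 * k)) \<le> Suc k" if "Suc k < K"
      using N_even[OF that] N(2)[of "Suc (2 * k)"] by simp
    ultimately show "if Suc k < K then n (Suc (2 * k)) = 1 else 1 \<le> n (Suc (2 * k))" by auto
  qed
next
  assume *: "\<forall>k<K. n (2 * k) = 0 \<and> (if Suc k < K then n (Suc (2 * k)) = 1 else 1 \<le> n (Suc (2 * k)))"
  have N_even: "k < K \<Longrightarrow> N (2 * k) = k" for k
  proof (induction k)
    case 0
    then show ?case using * N(1) by auto
  next
    case (Suc j)
    then have "n (Suc (2 * j)) = 1" "n (2 * Suc j) = 0"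
      using *[rule_format, of j] *[rule_format, of "Suc j"] by auto
    then show ?case using Suc N(2)[of "2 * j"] N(2)[of "Suc (2 * j)"] by simp
  qed
  show "\<forall>k<K. N (2 * k) \<le> k \<and> k < N (Suc (2 * k))"
  proof (intro allI impI)
    fix k assume k: "k < K"
    have "1 \<le> n (Suc (2 * k))" using *[rule_format, OF k] by (auto split: if_splits)
    then show "N (2 * k) \<le> k \<and> k < N (Suc (2 * k))"
      using N_even[OF k] N(2)[of "2 * k"] by simp
  qed
qed

context ordered_planar_poisson
begin

text \<open>The event fixes the counts of \<open>2 * K\<close> disjoint pieces: gaps empty, inner
  sides with one point, last side nonempty. In the product of their probabilities the exponentials
  telescope, leaving areas of the inner sides and a difference for the last one.\<close>

lemma prob_ordered_box:
  assumes K: "0 < K"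
    and box: "0 \<le> a 0" "\<And>k. Suc k < K \<Longrightarrow> b k \<le> a (Suc k)" "\<And>k. k < K \<Longrightarrow> a k < b k"
  shows "prob {\<omega> \<in> space M. \<forall>k<K. a k < norm (X k \<omega>) \<and> norm (X k \<omega>) \<le> b k} =
    (\<Prod>k<K - 1. pi * \<nu> * ((b k)\<^sup>2 - (a k)\<^sup>2)) * (exp (- pi * \<nu> * (a (K - 1))\<^sup>2) - exp (- pi * \<nu> * (b (K - 1))\<^sup>2))"
proof -
  \<comment> \<open>The endpoints interlaced as a 0, b 0, a 1, b 1, ..., then constant, so that the
    sequence of radii is monotone on all of \<open>nat\<close>. Even indices close a gap, odd
    indices close a side.\<close>
  define c where "c i = (if i < 2 * K then (if even i then a (i div 2) else b (i div 2)) else b (K - 1))" for i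
  have c_even: "c (2 * k) = a k" and c_odd: "c (Suc (2 * k)) = b k" if "k < K" for k
    using that by (auto simp: c_def)
  have "c i \<le> c (Suc i)" for i
  proof (cases "even i")
    case True
    then obtain k where i: "i = 2 * k" by (elim evenE)
    show ?thesis using box(3)[of k] unfolding i by (cases "k < K") (auto simp: c_def less_imp_le)
  next
    case False
    then obtain k where i: "i = Suc (2 * k)" by (elim oddE) simp
    consider "Suc k < K" | "Suc k = K" | "K < Suc k" by linarith
    then show ?thesis
    proof cases
      case 1
      then show ?thesis using box(2)[of k] c_odd[of k] c_even[of "Suc k"] by (simp add: i)
    next
      case 2
      then show ?thesis by (auto simp: i c_def)
    next
      case 3
      then show ?thesis by (auto simp: i c_def)
    qed
  qed
  then have c: "mono c" by (simp add: mono_iff_le_Suc)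
  have "0 \<le> c 0" using box(1) K by (simp add: c_def)
  then have c0: "0 \<le> c i" for i using monoD[OF c, of 0 i] by simp
  note c = c c0
  have "0 \<in> {..<2 * K}" using K by simp
  then have ne: "{..<2 * K} \<noteq> {}" by blast
  let ?A = "disjointed (\<lambda>i. cball (0 :: real ^ 2) (c i))"
  \<comment> \<open>The allowed counts; among odd indices below \<open>2 * K\<close>, the test
    \<open>Suc i < 2 * K\<close> fails only for the last side.\<close>
  define B where "B i = (if even i then {0} else if Suc i < 2 * K then {1} else {1::nat..})" for i
  have fs: "?A i \<in> finite_sets \<Lambda>" for i by (rule annulus_finite_sets[OF c])
  note [measurable] = count_measurable[OF fs]
  define p where "p i = prob (npoints (?A i) -` B i \<inter> space M)" for i
  have iv: "indep_vars (\<lambda>_. count_space UNIV) (\<lambda>i. npoints (?A i)) UNIV"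
    using fs by (intro poisson_process_indep_vars[OF pp] disjoint_family_disjointed) auto
  have set_eq: "AE \<omega> in M. (\<omega> \<in> {\<omega> \<in> space M. \<forall>k<K. a k < norm (X k \<omega>) \<and> norm (X k \<omega>) \<le> b k}) =
      (\<omega> \<in> (\<Inter>i\<in>{..<2 * K}. npoints (?A i) -` B i \<inter> space M))"
    using AE_finite_points AE_space
  proof eventually_elim
    case (elim \<omega>)
    have fin: "finite {l. norm (X l \<omega>) \<le> t}" for t using elim by blast
    define N where "N i = card {l. norm (X l \<omega>) \<le> c i}" for i
    define n where "n i = npoints (?A i) \<omega>" for i
    have N: "N 0 = n 0" "N (Suc i) = N i + n (Suc i)" for i
      unfolding N_def n_def by (rule card_annulus[OF c fin])+
    have iff: "norm (X l \<omega>) \<le> c i \<longleftrightarrow> l < N i" for l i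
      unfolding N_def by (rule norm_le_iff_less_card[OF elim(2) fin])
    have "(\<forall>k<K. a k < norm (X k \<omega>) \<and> norm (X k \<omega>) \<le> b k) \<longleftrightarrow> (\<forall>k<K. N (2 * k) \<le> k \<and> k < N (Suc (2 * k)))"
      using iff c_even c_odd by (metis linorder_not_le)
    also have "\<dots> \<longleftrightarrow> (\<forall>k<K. n (2 * k) = 0 \<and> (if Suc k < K then n (Suc (2 * k)) = 1 else 1 \<le> n (Suc (2 * k))))"
      by (rule partial_counts_iff[OF K N])
    also have "\<dots> \<longleftrightarrow> (\<forall>k<K. n (2 * k) \<in> B (2 * k) \<and> n (Suc (2 * k)) \<in> B (Suc (2 * k)))"
      by (intro all_cong) (auto simp: B_def)
    also have "\<dots> \<longleftrightarrow> (\<forall>i<2 * K. n i \<in> B i)"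
    proof (intro iffI allI impI)
      fix i assume *: "\<forall>k<K. n (2 * k) \<in> B (2 * k) \<and> n (Suc (2 * k)) \<in> B (Suc (2 * k))" and i: "i < 2 * K"
      show "n i \<in> B i"
      proof (cases "even i")
        case True
        then obtain k where "i = 2 * k" by (elim evenE)
        then show ?thesis using * i by auto
      next
        case False
        then obtain k where "i = Suc (2 * k)" by (elim oddE) simp
        then show ?thesis using * i by auto
      qed
    qed auto
    finally show ?case using elim K by (auto simp: n_def)
  qed
  have B_last: "B (Suc (2 * (K - 1))) = {1..}" proof -
    have "\<not> Suc (Suc (2 * (K - 1))) < 2 * K" by linarith
    then show ?thesis unfolding B_def by simp
  qed
  then have p_last: "p (Suc (2 * (K - 1))) = 1 - exp (- pi * \<nu> * ((b (K - 1))\<^sup>2 - (a (K - 1))\<^sup>2))"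
    using prob_count(3)[OF fs[of "Suc (2 * (K - 1))"]] K c_even[of "K - 1"] c_odd[of "K - 1"]
    unfolding measure_annulus_Suc[OF c]
    by (simp add: p_def vimage_def Int_def conj_commute)
  have "prob {\<omega> \<in> space M. \<forall>k<K. a k < norm (X k \<omega>) \<and> norm (X k \<omega>) \<le> b k} =
      prob (\<Inter>i\<in>{..<2 * K}. npoints (?A i) -` B i \<inter> space M)"
  proof (rule finite_measure_eq_AE[OF set_eq])
    show "{\<omega> \<in> space M. \<forall>k<K. a k < norm (X k \<omega>) \<and> norm (X k \<omega>) \<le> b k} \<in> events" by measurable
    show "(\<Inter>i\<in>{..<2 * K}. npoints (?A i) -` B i \<inter> space M) \<in> events"
      by (intro sets.finite_INT ne measurable_sets[OF count_measurable[OF fs]]) auto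
  qed
  also have "\<dots> = (\<Prod>i<2 * K. p i)"
    unfolding p_def by (intro indep_varsD[OF iv] ne) auto
  also have "2 * K = Suc (Suc (2 * (K - 1)))" using K by simp
  also have "(\<Prod>i<Suc (Suc (2 * (K - 1))). p i) = (\<Prod>i<Suc (2 * (K - 1)). p i) * p (Suc (2 * (K - 1)))"
    by simp
  also have "(\<Prod>i<Suc (2 * (K - 1)). p i) = exp (- pi * \<nu> * (a (K - 1))\<^sup>2) * (\<Prod>k<K - 1. pi * \<nu> * ((b k)\<^sup>2 - (a k)\<^sup>2))"
  proof -
    have p0: "p 0 = exp (- pi * \<nu> * (c 0)\<^sup>2)"
      using prob_count(1)[OF fs[of 0]] measure_annulus_0[OF c]
      by (simp add: p_def B_def vimage_def Int_def conj_commute)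
    have p_even: "p (Suc i) = exp (- pi * \<nu> * ((c (Suc i))\<^sup>2 - (c i)\<^sup>2))" if "odd i" for i
      using prob_count(1)[OF fs[of "Suc i"]] that unfolding measure_annulus_Suc[OF c]
      by (simp add: p_def B_def vimage_def Int_def conj_commute)
    have p_odd: "p (Suc i) = pi * \<nu> * ((c (Suc i))\<^sup>2 - (c i)\<^sup>2) * exp (- pi * \<nu> * ((c (Suc i))\<^sup>2 - (c i)\<^sup>2))"
      if "even i" "Suc (Suc i) < 2 * K" for i
      using prob_count(2)[OF fs[of "Suc i"]] that unfolding measure_annulus_Suc[OF c]
      by (simp add: p_def B_def vimage_def Int_def conj_commute)
    \<comment> \<open>Invariant at radius \<open>a n\<close>: the factors for absent points have
      merged into one exponential of the whole disc, and each side passed has left its mean number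
      of points.\<close>
    have "n < K \<Longrightarrow> (\<Prod>i<Suc (2 * n). p i) = exp (- pi * \<nu> * (a n)\<^sup>2) * (\<Prod>k<n. pi * \<nu> * ((b k)\<^sup>2 - (a k)\<^sup>2))" for n
    proof (induction n)
      case 0
      then show ?case using c_even[of 0] by (simp add: p0)
    next
      case (Suc n)
      have e: "exp (- pi * \<nu> * (a n)\<^sup>2) * exp (- pi * \<nu> * ((b n)\<^sup>2 - (a n)\<^sup>2)) *
          exp (- pi * \<nu> * ((a (Suc n))\<^sup>2 - (b n)\<^sup>2)) = exp (- pi * \<nu> * (a (Suc n))\<^sup>2)"
        by (simp add: exp_add[symmetric] algebra_simps)
      have "(\<Prod>i<Suc (2 * Suc n). p i) = (\<Prod>i<Suc (2 * n). p i) * p (Suc (2 * n)) * p (Suc (Suc (2 * n)))"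
        by simp
      also have "\<dots> = (exp (- pi * \<nu> * (a n)\<^sup>2) * (\<Prod>k<n. pi * \<nu> * ((b k)\<^sup>2 - (a k)\<^sup>2))) *
          (pi * \<nu> * ((b n)\<^sup>2 - (a n)\<^sup>2) * exp (- pi * \<nu> * ((b n)\<^sup>2 - (a n)\<^sup>2))) *
          exp (- pi * \<nu> * ((a (Suc n))\<^sup>2 - (b n)\<^sup>2))"
        using Suc c_even[of n] c_odd[of n] c_even[of "Suc n"] p_odd[of "2 * n"] p_even[of "Suc (2 * n)"] by simp
      also have "\<dots> = exp (- pi * \<nu> * (a (Suc n))\<^sup>2) * (\<Prod>k<Suc n. pi * \<nu> * ((b k)\<^sup>2 - (a k)\<^sup>2))"
        unfolding e[symmetric] by (simp only: prod.lessThan_Suc mult_ac)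
      finally show ?case .
    qed
    from this[of "K - 1"] show ?thesis using K by simp
  qed
  also note p_last
  also have "exp (- pi * \<nu> * (a (K - 1))\<^sup>2) * (\<Prod>k<K - 1. pi * \<nu> * ((b k)\<^sup>2 - (a k)\<^sup>2)) *
      (1 - exp (- pi * \<nu> * ((b (K - 1))\<^sup>2 - (a (K - 1))\<^sup>2))) =
    (\<Prod>k<K - 1. pi * \<nu> * ((b k)\<^sup>2 - (a k)\<^sup>2)) *
      (exp (- pi * \<nu> * (a (K - 1))\<^sup>2) - exp (- pi * \<nu> * (a (K - 1))\<^sup>2) * exp (- pi * \<nu> * ((b (K - 1))\<^sup>2 - (a (K - 1))\<^sup>2)))"
    by (simp only: right_diff_distrib mult_1_right mult_ac)
  also have "exp (- pi * \<nu> * (a (K - 1))\<^sup>2) * exp (- pi * \<nu> * ((b (K - 1))\<^sup>2 - (a (K - 1))\<^sup>2)) = exp (- pi * \<nu> * (b (K - 1))\<^sup>2)"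
    by (simp add: exp_add[symmetric] algebra_simps)
  finally show ?thesis .
qed

section \<open>From ordered boxes to the whole law\<close>

definition first_dists :: "nat \<Rightarrow> 'w \<Rightarrow> nat \<Rightarrow> real" where
  "first_dists K \<omega> = (\<lambda>k\<in>{..<K}. norm (X k \<omega>))"

lemma measurable_first_dists [measurable]: "first_dists K \<in> measurable M (PiM {..<K} (\<lambda>_. borel))"
  unfolding first_dists_def by measurable

abbreviation "dists_law K \<equiv> distr M (PiM {..<K} (\<lambda>_. borel)) (first_dists K)"

abbreviation "dists_density K \<equiv> density (PiM {..<K} (\<lambda>_. lborel))
  (\<lambda>r. ennreal (distance_density K \<nu> r) * indicator (ordered_dists K) r)"

lemma sets_dists_density: "sets (dists_density K) = sets (PiM {..<K} (\<lambda>_. borel))"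
  by (simp add: sets_PiM_lborel)

lemma sets_ordered_box: "ordered_box K a b \<in> sets (PiM {..<K} (\<lambda>_. borel))"
  unfolding ordered_box_def by (intro sets_PiM_I_finite) auto

lemma emeasure_ordered_box:
  assumes K: "0 < K" and box: "0 \<le> a 0" "\<And>k. Suc k < K \<Longrightarrow> b k \<le> a (Suc k)"
  shows "emeasure (dists_law K) (ordered_box K a b) = emeasure (dists_density K) (ordered_box K a b)"
    "emeasure (dists_density K) (ordered_box K a b) < \<infinity>"
proof -
  have "emeasure (dists_law K) (ordered_box K a b) = emeasure (dists_density K) (ordered_box K a b) \<and>
    emeasure (dists_density K) (ordered_box K a b) < \<infinity>"
  proof (cases "\<forall>k<K. a k < b k")
    case True
    have "first_dists K -` ordered_box K a b \<inter> space M =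
        {\<omega> \<in> space M. \<forall>k<K. a k < norm (X k \<omega>) \<and> norm (X k \<omega>) \<le> b k}"
      by (auto simp: first_dists_def ordered_box_def PiE_def Pi_def)
    then have "emeasure (dists_law K) (ordered_box K a b) =
        ennreal (prob {\<omega> \<in> space M. \<forall>k<K. a k < norm (X k \<omega>) \<and> norm (X k \<omega>) \<le> b k})"
      by (simp add: emeasure_distr sets_ordered_box emeasure_eq_measure)
    then show ?thesis
      using prob_ordered_box[OF K box] emeasure_distance_density_box[OF K \<nu> box] True by simp
  next
    case False
    then obtain k where "k < K" "{a k<..b k} = {}" by auto
    then have "ordered_box K a b = {}" unfolding ordered_box_def by (auto simp: PiE_eq_empty_iff)
    then show ?thesis by simp
  qed
  then show "emeasure (dists_law K) (ordered_box K a b) = emeasure (dists_density K) (ordered_box K a b)"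
    "emeasure (dists_density K) (ordered_box K a b) < \<infinity>" by auto
qed

text \<open>Intersecting an arbitrary box with an ordered box gives an ordered box, so both laws agree on
  a generating \<open>\<inter>\<close>-stable family after restriction to one ordered box.\<close>

lemma emeasure_Int_ordered_box:
  assumes K: "0 < K" and box: "0 \<le> a 0" "\<And>k. Suc k < K \<Longrightarrow> b k \<le> a (Suc k)"
    and A: "A \<in> sets (PiM {..<K} (\<lambda>_. borel))"
  shows "emeasure (dists_law K) (A \<inter> ordered_box K a b) = emeasure (dists_density K) (A \<inter> ordered_box K a b)"
proof -
  let ?P = "PiM {..<K} (\<lambda>_. borel :: real measure)"
  let ?I = "range (\<lambda>(c, d). {c<..d::real})"
  let ?E = "{Pi\<^sub>E {..<K} F |F. \<forall>i\<in>{..<K}. F i \<in> ?I}"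
  \<comment> \<open>Restriction to one ordered box is encoded as an indicator density; it makes both
    measures finite, as the uniqueness theorem requires on the exhausting sets.\<close>
  let ?\<mu> = "density (dists_law K) (indicator (ordered_box K a b))"
  let ?\<eta> = "density (dists_density K) (indicator (ordered_box K a b))"
  have restr: "emeasure ?\<mu> S = emeasure (dists_law K) (S \<inter> ordered_box K a b)"
      "emeasure ?\<eta> S = emeasure (dists_density K) (S \<inter> ordered_box K a b)" if "S \<in> sets ?P" for S
    using that sets_ordered_box[of K a b]
    by (simp_all only: sets_distr sets_dists_density emeasure_restricted Int_commute)
  have gen: "sets ?P = sigma_sets (space ?P) ?E"
  proof -
    \<comment> \<open>The standard generator of a product \<sigma>-algebra with one block of
      coordinates, so that its members are full rectangles. It requires a countable cover of the
      line by intervals.\<close>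
    let ?Q = "{{f \<in> (\<Pi>\<^sub>E i\<in>{..<K}. UNIV). \<forall>i\<in>j. f i \<in> A i} |A j. j \<in> {{..<K}} \<and> A \<in> Pi j (\<lambda>_. ?I)}"
    have cover: "\<exists>S\<subseteq>?I. countable S \<and> UNIV = \<Union>S"
    proof (intro exI[of _ "range (\<lambda>j::nat. {- real j<..real j})"] conjI)
      show "UNIV = \<Union> (range (\<lambda>j::nat. {- real j<..real j}))"
      proof (intro equalityI subsetI)
        fix x :: real
        obtain j :: nat where "\<bar>x\<bar> < j" using reals_Archimedean2 by blast
        then show "x \<in> \<Union> (range (\<lambda>j::nat. {- real j<..real j}))" by (intro UN_I[of j]) auto
      qed auto
    qed auto
    have "sets ?P = sets (PiM {..<K} (\<lambda>_. sigma UNIV ?I))"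
      by (intro sets_PiM_cong) (simp_all flip: borel_sigma_sets_Ioc)
    also have "\<dots> = sets (sigma (\<Pi>\<^sub>E i\<in>{..<K}. UNIV) ?Q)"
      using cover by (intro sets_PiM_sigma) auto
    also have "?Q = ?E"
    proof -
      have "{f \<in> (\<Pi>\<^sub>E i\<in>{..<K}. UNIV). \<forall>i\<in>{..<K}. f i \<in> A i} = Pi\<^sub>E {..<K} A" for A :: "nat \<Rightarrow> real set"
        by (auto simp: PiE_def Pi_def)
      then show ?thesis by (simp add: Pi_def Ball_def)
    qed
    also have "sets (sigma (\<Pi>\<^sub>E i\<in>{..<K}. UNIV) ?E) = sigma_sets (space ?P) ?E"
      by (subst sets_measure_of) (auto simp: space_PiM PiE_def)
    finally show ?thesis .
  qed
  have E: "X \<in> ?E \<Longrightarrow> \<exists>c d. X = (\<Pi>\<^sub>E k\<in>{..<K}. {c k<..d k})" for X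
  proof -
    assume "X \<in> ?E"
    then obtain F where F: "X = Pi\<^sub>E {..<K} F" "\<forall>i\<in>{..<K}. F i \<in> ?I" by blast
    then have "\<forall>i\<in>{..<K}. \<exists>cd. F i = {fst cd<..snd cd}" by (auto simp: image_iff)
    then obtain cd where "\<forall>i\<in>{..<K}. F i = {fst (cd i)<..snd (cd i)}" by metis
    then have "X = (\<Pi>\<^sub>E k\<in>{..<K}. {fst (cd k)<..snd (cd k)})" unfolding F(1) by (intro PiE_cong) auto
    then show ?thesis by (intro exI[of _ "\<lambda>k. fst (cd k)"] exI[of _ "\<lambda>k. snd (cd k)"])
  qed
  have E': "(\<Pi>\<^sub>E k\<in>{..<K}. {c k<..d k}) \<in> ?E" for c d :: "nat \<Rightarrow> real"
  proof (intro CollectI exI[of _ "\<lambda>k. {c k<..d k}"] conjI refl ballI)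
    fix k
    show "{c k<..d k} \<in> ?I" by (rule range_eqI[of _ _ "(c k, d k)"]) simp
  qed
  have sub: "X \<in> ?E \<Longrightarrow> X \<in> sets ?P" for X
    unfolding gen by (rule sigma_sets.Basic)
  have "?\<mu> = ?\<eta>"
  proof (rule measure_eqI_generator_eq[where E = ?E and \<Omega> = "space ?P" and A = "\<lambda>i. \<Pi>\<^sub>E k\<in>{..<K}. {- real i<..real i}"])
    show "Int_stable ?E"
    proof (rule Int_stableI)
      fix X Y assume X: "X \<in> ?E" and Y: "Y \<in> ?E"
      obtain c d where "X = (\<Pi>\<^sub>E k\<in>{..<K}. {c k<..d k})" using E[OF X] by (elim exE)
      moreover obtain c' d' where "Y = (\<Pi>\<^sub>E k\<in>{..<K}. {c' k<..d' k})" using E[OF Y] by (elim exE)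
      ultimately have "X \<inter> Y = (\<Pi>\<^sub>E k\<in>{..<K}. {max (c k) (c' k)<..min (d k) (d' k)})"
        by (simp add: PiE_Int)
      then show "X \<inter> Y \<in> ?E" using E'[of "\<lambda>k. max (c k) (c' k)" "\<lambda>k. min (d k) (d' k)"] by simp
    qed
    show "sets ?\<mu> = sigma_sets (space ?P) ?E" "sets ?\<eta> = sigma_sets (space ?P) ?E"
      using gen by (simp_all add: sets_PiM_lborel)
    show "?E \<subseteq> Pow (space ?P)" by (intro subsetI PowI) (rule sets.sets_into_space[OF sub, THEN subsetD])
    show "range (\<lambda>i. \<Pi>\<^sub>E k\<in>{..<K}. {- real i<..real i}) \<subseteq> ?E" using E' by (intro image_subsetI)
    show "(\<Union>i. \<Pi>\<^sub>E k\<in>{..<K}. {- real i<..real i}) = space ?P"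
    proof (intro equalityI subsetI)
      fix x assume x: "x \<in> space ?P"
      \<comment> \<open>The sum of absolute values bounds all coordinates at once.\<close>
      obtain i :: nat where i: "(\<Sum>k<K. \<bar>x k\<bar>) < i" using reals_Archimedean2 by blast
      have "\<bar>x k\<bar> < i" if "k < K" for k
        using member_le_sum[of k "{..<K}" "\<lambda>k. \<bar>x k\<bar>"] i that by simp
      then have "x \<in> (\<Pi>\<^sub>E k\<in>{..<K}. {- real i<..real i})"
      proof (intro PiE_I)
        fix k assume "k \<in> {..<K}"
        then show "x k \<in> {- real i<..real i}" using \<open>\<And>k. k < K \<Longrightarrow> \<bar>x k\<bar> < i\<close>[of k] by auto
      qed (use x in \<open>auto simp: space_PiM PiE_def extensional_def\<close>)
      then show "x \<in> (\<Union>i. \<Pi>\<^sub>E k\<in>{..<K}. {- real i<..real i})" by blast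
    qed (auto simp: space_PiM PiE_def)
    fix i
    have S: "(\<Pi>\<^sub>E k\<in>{..<K}. {- real i<..real i}) \<in> sets ?P" by (intro sub E')
    have "emeasure ?\<mu> (\<Pi>\<^sub>E k\<in>{..<K}. {- real i<..real i}) \<le> emeasure (dists_law K) (ordered_box K a b)"
      unfolding restr(1)[OF S] using sets_ordered_box by (intro emeasure_mono) auto
    then show "emeasure ?\<mu> (\<Pi>\<^sub>E k\<in>{..<K}. {- real i<..real i}) \<noteq> \<infinity>"
      using emeasure_ordered_box[OF K box] by (auto simp: less_top[symmetric] top_unique)
  next
    fix X assume X: "X \<in> ?E"
    obtain c d where "X = (\<Pi>\<^sub>E k\<in>{..<K}. {c k<..d k})" using E[OF X] by (elim exE)
    \<comment> \<open>The order of sides survives: \<open>min (d k) (b k) \<le> b k \<le> a (Suc k)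
      \<le> max (c (Suc k)) (a (Suc k))\<close>.\<close>
    then have int: "X \<inter> ordered_box K a b = ordered_box K (\<lambda>k. max (c k) (a k)) (\<lambda>k. min (d k) (b k))"
      by (simp add: ordered_box_def PiE_Int)
    show "emeasure ?\<mu> X = emeasure ?\<eta> X"
      unfolding restr[OF sub[OF X]] int using box
      by (intro emeasure_ordered_box K) (auto simp: le_max_iff_disj min_le_iff_disj)
  qed
  then show ?thesis using restr[OF A] by simp
qed

lemma AE_law_strict:
  assumes K: "0 < K"
  shows "AE r in dists_law K. \<forall>k. (k = 0 \<longrightarrow> 0 < r 0) \<and> (Suc k < K \<longrightarrow> r k < r (Suc k))"
proof -
  have comp [measurable]: "(\<lambda>r. r k) \<in> borel_measurable (PiM {..<K} (\<lambda>_. borel :: real measure))" if "k < K" for k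
    using that by (intro measurable_component_singleton) auto
  show ?thesis unfolding AE_all_countable
  proof
    fix k
    have "AE \<omega> in M. (k = 0 \<longrightarrow> 0 < first_dists K \<omega> 0) \<and> (Suc k < K \<longrightarrow> first_dists K \<omega> k < first_dists K \<omega> (Suc k))"
      using AE_first_dist_pos AE_no_ties[of k] AE_space
    proof eventually_elim
      case (elim \<omega>)
      then show ?case
        using K monoD[OF mono_dist, of \<omega> k "Suc k"] by (auto simp: first_dists_def)
    qed
    moreover have S: "{r \<in> space (PiM {..<K} (\<lambda>_. borel)). (k = 0 \<longrightarrow> 0 < r 0) \<and> (Suc k < K \<longrightarrow> r k < r (Suc k))}
        \<in> sets (PiM {..<K} (\<lambda>_. borel :: real measure))"
      using K by (cases "k = 0"; cases "Suc k < K") (auto intro!: sets.sets_Collect_conj borel_measurable_less comp)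
    ultimately show "AE r in dists_law K. (k = 0 \<longrightarrow> 0 < r 0) \<and> (Suc k < K \<longrightarrow> r k < r (Suc k))"
      by (simp only: AE_distr_iff[OF measurable_first_dists S])
  qed
qed

text \<open>The density is carried by the weakly ordered positive vectors, and equal neighbouring
  coordinates form a Lebesgue null set.\<close>

lemma AE_density_strict:
  assumes K: "0 < K"
  shows "AE r in dists_density K. \<forall>k. (k = 0 \<longrightarrow> 0 < r 0) \<and> (Suc k < K \<longrightarrow> r k < r (Suc k))"
proof -
  have "AE r in PiM {..<K} (\<lambda>_. lborel :: real measure). \<forall>k. Suc k < K \<longrightarrow> r k \<noteq> r (Suc k)"
    unfolding AE_all_countable
  proof
    fix k
    show "AE r in PiM {..<K} (\<lambda>_. lborel :: real measure). Suc k < K \<longrightarrow> r k \<noteq> r (Suc k)"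
    proof (cases "Suc k < K")
      case True
      then show ?thesis using AE_PiM_lborel_distinct[of "{..<K}" k "Suc k"] by simp
    qed simp
  qed
  then have "AE r in PiM {..<K} (\<lambda>_. lborel). 0 < ennreal (distance_density K \<nu> r) * indicator (ordered_dists K) r \<longrightarrow>
      (\<forall>k. (k = 0 \<longrightarrow> 0 < r 0) \<and> (Suc k < K \<longrightarrow> r k < r (Suc k)))"
  proof eventually_elim
    case (elim r)
    show ?case
    proof
      assume "0 < ennreal (distance_density K \<nu> r) * indicator (ordered_dists K) r"
      then have "r \<in> ordered_dists K" by (auto split: split_indicator_asm)
      then have "0 < r 0" "\<And>k. Suc k < K \<Longrightarrow> r k \<le> r (Suc k)"
        using K by (auto simp: ordered_dists_def PiE_def Pi_def mono_on_def)
      then show "\<forall>k. (k = 0 \<longrightarrow> 0 < r 0) \<and> (Suc k < K \<longrightarrow> r k < r (Suc k))"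
        using elim by (auto simp: less_le)
    qed
  qed
  then show ?thesis
    using measurable_distance_density[OF K] sets_ordered_dists[of K]
    by (subst AE_density) (auto simp: measurable_cong_sets[OF sets_PiM_lborel refl])
qed

text \<open>Rational separators between consecutive distances enclose a strictly increasing vector,
  and there are countably many choices. Adjacent sides share an endpoint, so
  \<open>b k \<le> a (Suc k)\<close> holds with equality.\<close>

lemma strict_dists_cover:
  assumes K: "0 < K"
  obtains q :: "nat \<Rightarrow> nat \<Rightarrow> real" where "\<And>n. 0 \<le> q n 0"
    "\<And>r. r \<in> space (PiM {..<K} (\<lambda>_. borel)) \<Longrightarrow> \<forall>k. (k = 0 \<longrightarrow> 0 < r 0) \<and> (Suc k < K \<longrightarrow> r k < r (Suc k)) \<Longrightarrow>
      \<exists>n. r \<in> ordered_box K (q n) (\<lambda>k. q n (Suc k))"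
proof -
  \<comment> \<open>\<open>K\<close> distances need \<open>K + 1\<close> separators, hence the index
    set \<open>{..K}\<close>; extensional functions with rational values on it are
    countable.\<close>
  define C where "C = {x \<in> {..K} \<rightarrow>\<^sub>E \<rat>. 0 \<le> (x 0 :: real)}"
  have "countable C"
    unfolding C_def by (rule countable_subset[OF _ countable_PiE[of "{..K}" "\<lambda>_. \<rat>"]]) (auto simp: countable_rat)
  moreover have "(\<lambda>k\<in>{..K}. 0) \<in> C" by (auto simp: C_def)
  ultimately have C: "range (from_nat_into C) = C" by (intro range_from_nat_into) auto
  show ?thesis
  proof (rule that[of "from_nat_into C"])
    show "0 \<le> from_nat_into C n 0" for n
      using C by (auto simp: C_def set_eq_iff image_iff)
    fix r assume r: "r \<in> space (PiM {..<K} (\<lambda>_. borel :: real measure))"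
      and s: "\<forall>k. (k = 0 \<longrightarrow> 0 < r 0) \<and> (Suc k < K \<longrightarrow> r k < r (Suc k))"
    \<comment> \<open>Neighbouring distances bracket each separator; 0 serves as the bound below the
      first, and one more than the largest distance as the bound above the last.\<close>
    define lo where "lo k = (if k = 0 then 0 else r (k - 1))" for k
    define hi where "hi k = (if k < K then r k else r (K - 1) + 1)" for k
    have "\<exists>x\<in>\<rat>. lo k < x \<and> x < hi k" if "k \<le> K" for k
    proof -
      have "lo k < hi k" using that s K by (cases k) (auto simp: lo_def hi_def le_eq_less_or_eq)
      then show ?thesis by (rule Rats_dense_in_real)
    qed
    then obtain x where x: "\<And>k. k \<le> K \<Longrightarrow> x k \<in> \<rat> \<and> lo k < x k \<and> x k < hi k" by metis
    let ?x = "\<lambda>k\<in>{..K}. x k"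
    have "?x \<in> C" using x x[of 0] by (auto simp: C_def lo_def)
    then obtain n where n: "from_nat_into C n = ?x" using C by (metis rangeE)
    have "r \<in> ordered_box K ?x (\<lambda>k. ?x (Suc k))"
      unfolding ordered_box_def
    proof (rule PiE_I)
      fix k assume k: "k \<in> {..<K}"
      have "x k < r k" "r k < x (Suc k)" using x[of k] x[of "Suc k"] k by (auto simp: lo_def hi_def)
      then show "r k \<in> {?x k<..?x (Suc k)}" using k by auto
    qed (use r in \<open>auto simp: space_PiM PiE_def extensional_def\<close>)
    then show "\<exists>n. r \<in> ordered_box K (from_nat_into C n) (\<lambda>k. from_nat_into C n (Suc k))"
      using n by metis
  qed
qed

text \<open>Both measures are carried by a countable union of ordered boxes. Making the cover
  disjoint keeps each piece inside one box, where they agree, and countable additivity joins the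
  pieces.\<close>

lemma distr_first_dists:
  assumes K: "0 < K"
  shows "dists_law K = dists_density K"
proof (rule measure_eqI)
  show "sets (dists_law K) = sets (dists_density K)" by (simp add: sets_PiM_lborel)
  fix A assume "A \<in> sets (dists_law K)"
  then have A: "A \<in> sets (PiM {..<K} (\<lambda>_. borel))" by simp
  obtain q :: "nat \<Rightarrow> nat \<Rightarrow> real" where q: "\<And>n. 0 \<le> q n 0"
    "\<And>r. r \<in> space (PiM {..<K} (\<lambda>_. borel)) \<Longrightarrow> \<forall>k. (k = 0 \<longrightarrow> 0 < r 0) \<and> (Suc k < K \<longrightarrow> r k < r (Suc k)) \<Longrightarrow>
      \<exists>n. r \<in> ordered_box K (q n) (\<lambda>k. q n (Suc k))"
    using strict_dists_cover[OF K] by metis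
  define C where "C n = ordered_box K (q n) (\<lambda>k. q n (Suc k))" for n
  have C: "C n \<in> sets (PiM {..<K} (\<lambda>_. borel))" for n unfolding C_def by (rule sets_ordered_box)
  have D: "A \<inter> disjointed C n \<in> sets (PiM {..<K} (\<lambda>_. borel))" for n
    using A C sets.range_disjointed_sets[of C "PiM {..<K} (\<lambda>_. borel)"] by auto
  have split: "emeasure L A = (\<Sum>n. emeasure L (A \<inter> disjointed C n))"
    if L: "sets L = sets (PiM {..<K} (\<lambda>_. borel))"
      and ae: "AE r in L. \<forall>k. (k = 0 \<longrightarrow> 0 < r 0) \<and> (Suc k < K \<longrightarrow> r k < r (Suc k))" for L
  proof -
    have "AE r in L. r \<in> (\<Union>n. C n)"
    proof (rule AE_mp[OF ae], intro AE_I2 impI)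
      fix r assume "r \<in> space L" "\<forall>k. (k = 0 \<longrightarrow> 0 < r 0) \<and> (Suc k < K \<longrightarrow> r k < r (Suc k))"
      then show "r \<in> (\<Union>n. C n)" using q(2)[of r] unfolding sets_eq_imp_space_eq[OF L] C_def by blast
    qed
    then have "emeasure L A = emeasure L (A \<inter> (\<Union>n. C n))"
      using A C L by (intro emeasure_eq_AE) auto
    also have "A \<inter> (\<Union>n. C n) = (\<Union>n. A \<inter> disjointed C n)"
      using UN_disjointed_eq[of C] by blast
    also have "emeasure L \<dots> = (\<Sum>n. emeasure L (A \<inter> disjointed C n))"
      using D L disjoint_family_disjointed[of C]
      by (intro suminf_emeasure[symmetric]) (auto simp: disjoint_family_on_def disjoint_iff)
    finally show ?thesis .
  qed
  have "emeasure (dists_law K) (A \<inter> disjointed C n) = emeasure (dists_density K) (A \<inter> disjointed C n)" for n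
  proof -
    have "A \<inter> disjointed C n = (A \<inter> disjointed C n) \<inter> ordered_box K (q n) (\<lambda>k. q n (Suc k))"
      using disjointed_subset[of C n] by (auto simp: C_def)
    then show ?thesis
      using emeasure_Int_ordered_box[OF K _ _ D, of "q n" "\<lambda>k. q n (Suc k)" n] q(1) by simp
  qed
  then show "emeasure (dists_law K) A = emeasure (dists_density K) A"
    using split[OF _ AE_law_strict[OF K]] split[OF sets_dists_density AE_density_strict[OF K]] by simp
qed

end

section \<open>The ergodic capacity\<close>

lemma ordered_dists_cell: "ordered_dists (cell_size P) = dist_dom P"
  by (simp add: ordered_dists_def dist_dom_def)

text \<open>Taking \<open>B\<close> as the whole space in the defining equation of \<kappa> exhibits
  \<open>M\<close> as the mixture of the kernels, so the integral disintegrates.\<close>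

lemma regular_cond_prob_nn_integral:
  assumes "prob_space M" and rcp: "regular_cond_prob M S R \<kappa>" and f: "f \<in> borel_measurable M"
  shows "(\<integral>\<^sup>+\<omega>. f \<omega> \<partial>M) = (\<integral>\<^sup>+r. (\<integral>\<^sup>+\<omega>. f \<omega> \<partial>\<kappa> r) \<partial>distr M S R)"
proof -
  interpret prob_space M by fact
  have R [measurable]: "R \<in> measurable M S" and \<kappa>: "\<kappa> \<in> measurable S (prob_algebra M)"
    and eq: "\<And>A B. A \<in> sets M \<Longrightarrow> B \<in> sets S \<Longrightarrow>
      emeasure M (A \<inter> (R -` B \<inter> space M)) = (\<integral>\<^sup>+r\<in>B. emeasure (\<kappa> r) A \<partial>distr M S R)"
    using rcp by (auto simp: regular_cond_prob_def)
  interpret D: prob_space "distr M S R" by (rule prob_space_distr) measurable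
  have \<kappa>': "\<kappa> \<in> measurable (distr M S R) (subprob_algebra M)"
    using measurable_prob_algebraD[OF \<kappa>] by simp
  have ne: "space (distr M S R) \<noteq> {}" by (rule D.not_empty)
  have "M = distr M S R \<bind> \<kappa>"
  proof (rule measure_eqI)
    show sets: "sets M = sets (distr M S R \<bind> \<kappa>)"
      using sets_bind[OF sets_kernel[OF \<kappa>'] ne] by simp
    fix A assume A: "A \<in> sets M"
    have "R -` space S \<inter> space M = space M" using measurable_space[OF R] by auto
    then have "emeasure M A = (\<integral>\<^sup>+r\<in>space S. emeasure (\<kappa> r) A \<partial>distr M S R)"
      using eq[OF A sets.top] sets.sets_into_space[OF A] by (simp add: Int_absorb2)
    also have "\<dots> = (\<integral>\<^sup>+r. emeasure (\<kappa> r) A \<partial>distr M S R)"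
      by (intro nn_integral_cong) auto
    finally show "emeasure M A = emeasure (distr M S R \<bind> \<kappa>) A"
      by (simp add: emeasure_bind[OF ne \<kappa>' A])
  qed
  then show ?thesis
    using nn_integral_bind[OF f \<kappa>'] by simp
qed

theorem theorem2:
  fixes P :: vcell_params
    and M :: "'w measure"
    and N :: "'w network"
    and \<kappa> :: "(nat \<Rightarrow> real) \<Rightarrow> 'w measure"
  assumes "valid_params P"
    and "virtual_cell_network P M N \<kappa>"
  shows "(\<forall>r\<in>dist_dom P.
      cond_capacity P N \<kappa> r =
        1 / ln 2 * (LBINT s:{0<..}.
          exp (- s * noise_power P) / s *
          exp_neg (V_los P (r (cell_size P - 1)) s + V_nlos P (r (cell_size P - 1)) s) *
          (1 - (\<Prod>k<cell_size P. 1 - Hfun (fading_mean P * s * main_gain P * los_icpt P *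
                  r k powr (- los_exp P)))))) \<and>
    ergodic_capacity P M N =
      (2 * pi * ap_density P) ^ cell_size P / ln 2 *
      (LINT r:dist_dom P|PiM {..<cell_size P} (\<lambda>_. lborel).
        (\<Prod>k<cell_size P. r k) * exp (- pi * ap_density P * (r (cell_size P - 1))\<^sup>2) *
        (LBINT s:{0<..}.
          exp (- s * noise_power P) / s *
          exp_neg (V_los P (r (cell_size P - 1)) s + V_nlos P (r (cell_size P - 1)) s) *
          (1 - (\<Prod>k<cell_size P. 1 - Hfun (fading_mean P * s * main_gain P * los_icpt P *
                  r k powr (- los_exp P))))))"
proof -
  define G where "G r = (LBINT s:{0<..}.
          exp (- s * noise_power P) / s *
          exp_neg (V_los P (r (cell_size P - 1)) s + V_nlos P (r (cell_size P - 1)) s) *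
          (1 - (\<Prod>k<cell_size P. 1 - Hfun (fading_mean P * s * main_gain P * los_icpt P *
                  r k powr (- los_exp P)))))" for r
  let ?K = "cell_size P" and ?f = "\<lambda>\<omega>. log 2 (1 + sinr P N \<omega>)"
  let ?S = "PiM {..<?K} (\<lambda>_. borel :: real measure)"
  let ?L = "PiM {..<?K} (\<lambda>_. lborel :: real measure)"
  have K: "0 < ?K" and pos: "0 < ap_density P" using assms(1) by (auto simp: valid_params_def)
  have M: "prob_space M"
    and pp: "poisson_process M (density lborel (\<lambda>_. ennreal (ap_density P))) (ap_pos N) (\<lambda>_. UNIV)"
    and mono: "\<And>\<omega>. \<omega> \<in> space M \<Longrightarrow> mono (\<lambda>l. ap_dist N l \<omega>)"
    and rcp: "regular_cond_prob M ?S (serving_dists P N) \<kappa>"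
    and cm: "\<And>r. r \<in> dist_dom P \<Longrightarrow> conditional_model P N r (\<kappa> r)"
    using assms(2) by (auto simp: virtual_cell_network_def)
  interpret prob_space M by (rule M)
  interpret ordered_planar_poisson M "ap_pos N" "ap_density P"
    using mono pos pp by unfold_locales (auto simp: ap_dist_def)
  have cn: "conditional_network P N r (\<kappa> r)" if "r \<in> dist_dom P" for r
    using assms(1) that cm[OF that] by (rule conditional_network.intro)
  have \<kappa>: "\<kappa> \<in> measurable ?S (prob_algebra M)" using rcp by (simp add: regular_cond_prob_def)
  have cap: "cond_capacity P N \<kappa> r = 1 / ln 2 * G r" if "r \<in> dist_dom P" for r
    unfolding cond_capacity_def G_def by (rule conditional_network.expectation_log_sinr[OF cn[OF that]])
  have cap_nn: "(\<integral>\<^sup>+\<omega>. ennreal (?f \<omega>) \<partial>\<kappa> r) = ennreal (cond_capacity P N \<kappa> r)" if "r \<in> dist_dom P" for r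
    unfolding cond_capacity_def by (rule conditional_network.nn_integral_log_sinr[OF cn[OF that]])
  have cap_nonneg: "0 \<le> cond_capacity P N \<kappa> r" if "r \<in> dist_dom P" for r
    unfolding cond_capacity_def
    using conditional_network.AE_log_sinr_nonneg[OF cn[OF that]] by (rule integral_nonneg_AE)
  have f_meas [measurable]: "?f \<in> borel_measurable M"
  proof -
    \<comment> \<open>Measurability of the SINR is known under each conditional law, whose
      \<sigma>-algebra is that of \<open>M\<close>; any vector in \<open>dist_dom P\<close> will do,
      here the constant 1.\<close>
    have r: "(\<lambda>k\<in>{..<?K}. 1) \<in> dist_dom P" by (auto simp: dist_dom_def mono_on_def)
    have "(\<lambda>k\<in>{..<?K}. 1) \<in> space ?S" by (simp add: space_PiM)
    then have "sets (\<kappa> (\<lambda>k\<in>{..<?K}. 1)) = sets M"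
      using measurable_space[OF \<kappa>] by (auto simp: space_prob_algebra)
    then have "sinr P N \<in> borel_measurable M"
      using conditional_network.measurable_sinr[OF cn[OF r]] by (simp cong: measurable_cong_sets)
    then show ?thesis by measurable
  qed
  have dists: "first_dists ?K = serving_dists P N"
    by (simp add: fun_eq_iff first_dists_def serving_dists_def ap_dist_def)
  have law: "distr M ?S (serving_dists P N) =
      density ?L (\<lambda>r. ennreal (distance_density ?K (ap_density P) r) * indicator (dist_dom P) r)"
    using distr_first_dists[OF K] by (simp add: dists ordered_dists_cell)
  have D [measurable]: "dist_dom P \<in> sets ?L"
    using sets_ordered_dists[of ?K] by (simp add: ordered_dists_cell sets_PiM_lborel)
  have d [measurable]: "distance_density ?K (ap_density P) \<in> borel_measurable ?L"
    using measurable_distance_density[OF K] by (simp add: measurable_cong_sets[OF sets_PiM_lborel refl])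
  have in_meas: "(\<lambda>r. \<integral>\<^sup>+\<omega>. ennreal (?f \<omega>) \<partial>\<kappa> r) \<in> borel_measurable ?L"
  proof -
    have "(\<lambda>r. \<integral>\<^sup>+\<omega>. ennreal (?f \<omega>) \<partial>\<kappa> r) \<in> borel_measurable ?S"
      using f_meas
      by (intro measurable_compose[OF measurable_prob_algebraD[OF \<kappa>]] nn_integral_measurable_subprob_algebra) auto
    then show ?thesis by (simp add: measurable_cong_sets[OF sets_PiM_lborel refl])
  qed
  \<comment> \<open>The indicator confines the conditional capacity to \<open>dist_dom P\<close>,
    the only vectors for which the conditional model is assumed.\<close>
  define h where "h r = indicator (dist_dom P) r * (distance_density ?K (ap_density P) r * cond_capacity P N \<kappa> r)" for r
  have h_nonneg: "0 \<le> h r" for r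
    using cap_nonneg[of r] pos
    by (auto simp: h_def distance_density_def dist_dom_def PiE_def Pi_def less_imp_le
        intro!: mult_nonneg_nonneg prod_nonneg split: split_indicator)
  have h_eq: "ennreal (h r) = ennreal (distance_density ?K (ap_density P) r) * indicator (dist_dom P) r * (\<integral>\<^sup>+\<omega>. ennreal (?f \<omega>) \<partial>\<kappa> r)" for r
    using cap_nn[of r] cap_nonneg[of r] by (auto simp: h_def ennreal_mult'' split: split_indicator)
  have h_meas: "h \<in> borel_measurable ?L"
  proof -
    \<comment> \<open>Measurability comes from the kernel integral through \<open>h_eq\<close>;
      nonnegativity of \<open>h\<close> then undoes the passage to \<open>ennreal\<close>.\<close>
    have "(\<lambda>r. enn2real (ennreal (h r))) \<in> borel_measurable ?L"
      unfolding h_eq using in_meas by measurable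
    then show ?thesis using h_nonneg by simp
  qed
  have "(\<integral>\<^sup>+\<omega>. ennreal (?f \<omega>) \<partial>M) = (\<integral>\<^sup>+r. (\<integral>\<^sup>+\<omega>. ennreal (?f \<omega>) \<partial>\<kappa> r) \<partial>distr M ?S (serving_dists P N))"
    by (rule regular_cond_prob_nn_integral[OF M rcp]) measurable
  also have "\<dots> = (\<integral>\<^sup>+r. ennreal (h r) \<partial>?L)"
    unfolding law using in_meas by (subst nn_integral_density) (auto simp: h_eq)
  finally have nn: "(\<integral>\<^sup>+\<omega>. ennreal (?f \<omega>) \<partial>M) = (\<integral>\<^sup>+r. ennreal (h r) \<partial>?L)" .
  \<comment> \<open>Fading powers are nonnegative only almost surely and only under the conditional
    laws, so the set where the logarithm is negative is shown null by mixing over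
    \<open>r\<close>.\<close>
  have f_nonneg: "AE \<omega> in M. 0 \<le> ?f \<omega>"
  proof -
    have "(\<integral>\<^sup>+\<omega>. indicator {\<omega> \<in> space M. \<not> 0 \<le> ?f \<omega>} \<omega> \<partial>M) =
        (\<integral>\<^sup>+r. (\<integral>\<^sup>+\<omega>. indicator {\<omega> \<in> space M. \<not> 0 \<le> ?f \<omega>} \<omega> \<partial>\<kappa> r) \<partial>distr M ?S (serving_dists P N))"
      by (rule regular_cond_prob_nn_integral[OF M rcp]) measurable
    also have "\<dots> = (\<integral>\<^sup>+r. ennreal (distance_density ?K (ap_density P) r) * indicator (dist_dom P) r *
        (\<integral>\<^sup>+\<omega>. indicator {\<omega> \<in> space M. \<not> 0 \<le> ?f \<omega>} \<omega> \<partial>\<kappa> r) \<partial>?L)"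
    proof -
      have "(\<lambda>r. \<integral>\<^sup>+\<omega>. indicator {\<omega> \<in> space M. \<not> 0 \<le> ?f \<omega>} \<omega> \<partial>\<kappa> r) \<in> borel_measurable ?S"
        using f_meas
        by (intro measurable_compose[OF measurable_prob_algebraD[OF \<kappa>]] nn_integral_measurable_subprob_algebra) auto
      then show ?thesis
        unfolding law by (subst nn_integral_density) (auto simp: measurable_cong_sets[OF sets_PiM_lborel refl])
    qed
    also have "\<dots> = (\<integral>\<^sup>+r. 0 \<partial>?L)"
    proof (intro nn_integral_cong)
      fix r
      show "ennreal (distance_density ?K (ap_density P) r) * indicator (dist_dom P) r *
          (\<integral>\<^sup>+\<omega>. indicator {\<omega> \<in> space M. \<not> 0 \<le> ?f \<omega>} \<omega> \<partial>\<kappa> r) = 0"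
      proof (cases "r \<in> dist_dom P")
        case True
        have "(\<integral>\<^sup>+\<omega>. indicator {\<omega> \<in> space M. \<not> 0 \<le> ?f \<omega>} \<omega> \<partial>\<kappa> r) = (\<integral>\<^sup>+\<omega>. 0 \<partial>\<kappa> r)"
          using conditional_network.AE_log_sinr_nonneg[OF cn[OF True]]
          by (intro nn_integral_cong_AE) (auto elim!: eventually_mono split: split_indicator)
        then show ?thesis by simp
      qed simp
    qed
    finally have "(\<integral>\<^sup>+\<omega>. indicator {\<omega> \<in> space M. \<not> 0 \<le> ?f \<omega>} \<omega> \<partial>M) = 0" by simp
    then have "emeasure M {\<omega> \<in> space M. \<not> 0 \<le> ?f \<omega>} = 0"
      by (subst (asm) nn_integral_indicator) auto
    then show ?thesis by (rule AE_I[where N = "{\<omega> \<in> space M. \<not> 0 \<le> ?f \<omega>}", OF subset_refl]) measurable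
  qed
  have "ergodic_capacity P M N = enn2real (\<integral>\<^sup>+\<omega>. ennreal (?f \<omega>) \<partial>M)"
    unfolding ergodic_capacity_def using f_nonneg by (intro integral_eq_nn_integral) measurable
  \<comment> \<open>Both real integrals are \<open>enn2real\<close> of the same nonnegative
    integral, so they agree whatever its value.\<close>
  also have "\<dots> = (\<integral>r. h r \<partial>?L)"
    unfolding nn using h_meas h_nonneg by (intro integral_eq_nn_integral[symmetric]) auto
  also have "\<dots> = (\<integral>r. (2 * pi * ap_density P) ^ ?K / ln 2 * (indicator (dist_dom P) r *\<^sub>R
      ((\<Prod>k<?K. r k) * exp (- pi * ap_density P * (r (?K - 1))\<^sup>2) * G r)) \<partial>?L)"
    using cap
    by (intro Bochner_Integration.integral_cong)
       (auto simp: h_def distance_density_def mult_ac split: split_indicator)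
  also have "\<dots> = (2 * pi * ap_density P) ^ ?K / ln 2 * (LINT r:dist_dom P|?L.
      (\<Prod>k<?K. r k) * exp (- pi * ap_density P * (r (?K - 1))\<^sup>2) * G r)"
    unfolding set_lebesgue_integral_def by (rule integral_mult_right_zero)
  finally show ?thesis
    using cap unfolding G_def by blast
qed

end
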